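(* Let $(\mathcal{C},\mathbb{E},\mathfrak{s})$ be an extriangulated category satisfying Condition (WIC), and let $\xi$ be a proper class of $\mathbb{E}$-triangles such that $\mathcal{C}$ has enough $\xi$-projectives and enough $\xi$-injectives. Let $A\xrightarrow{x}B\xrightarrow{y}C\overset{\delta}{\dashrightarrow}$ be a $\mathcal C(-,\mathcal{GI}(\xi))$-exact $\mathbb E$-triangle in $\xi$ with $A\in\mathbf{Res}(\mathcal{GI}(\xi))$ and $C\in\mathbf{Res}(\mathcal{GI}(\xi))$. Then for every object $X\in\mathcal C$ there are natural connecting homomorphisms $\partial^n_X:\xi\mathrm{xt}^n_{\mathcal{GI}(\xi)}(X,C)\to\xi\mathrm{xt}^{n+1}_{\mathcal{GI}(\xi)}(X,A)$, $n\geqslant0$, making the sequence $$0\to\xi\mathrm{xt}^0_{\mathcal{GI}(\xi)}(X,A)\to\xi\mathrm{xt}^0_{\mathcal{GI}(\xi)}(X,B)\to\xi\mathrm{xt}^0_{\mathcal{GI}(\xi)}(X,C)\xrightarrow{\partial^0_X}\xi\mathrm{xt}^1_{\mathcal{GI}(\xi)}(X,A)\to\cdots$$ exact.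
   Context: Extriangulated category: an additive category $\mathcal C$ with (ET1) a biadditive functor $\mathbb E:\mathcal C^{op}\times\mathcal C\to\mathbf{Ab}$ and a correspondence $\mathfrak s$ sending each $\delta\in\mathbb E(C,A)$ to a class $[A\xrightarrow{x}B\xrightarrow{y}C]$ of sequences modulo isomorphisms that are the identity on $A$ and $C$. Write $a_*\delta=\mathbb E(C,a)(\delta)$, $c^*\delta=\mathbb E(c,A)(\delta)$; a morphism from $\delta\in\mathbb E(C,A)$ to $\delta'\in\mathbb E(C',A')$ is a pair $(a:A\to A',c:C\to C')$ with $a_*\delta=c^*\delta'$. Axioms: (ET2) every morphism $(a,c)$ of extensions is realized by some $b$ making both squares between the realizing sequences commute, $\mathfrak s(0)=[A\to A\oplus C\to C]$, and $\mathfrak s(\delta\oplus\delta')=\mathfrak s(\delta)\oplus\mathfrak s(\delta')$; (ET3) if $\mathfrak s(\delta)=[A\xrightarrow{x}B\xrightarrow{y}C]$, $\mathfrak s(\delta')=[A'\xrightarrow{x'}B'\xrightarrow{y'}C']$ and $bx=x'a$, there is $c$ with $cy=y'b$ and $(a,c):\delta\to\delta'$ a morphism; (ET4) if $\delta\in\mathbb E(D,A)$, $\delta'\in\mathbb E(F,B)$ are realized by $A\xrightarrow{f}B\xrightarrow{f'}D$ and $B\xrightarrow{g}C\xrightarrow{g'}F$, there are an object $E$, $\delta''\in\mathbb E(E,A)$ realized by $A\xrightarrow{gf}C\xrightarrow{h'}E$, and $D\xrightarrow{d}E\xrightarrow{e}F$ realizing $f'_*\delta'$, with $h'g=df'$,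 $eh'=g'$, $d^*\delta''=\delta$, $f_*\delta''=e^*\delta'$; and the duals (ET3)$^{op}$, (ET4)$^{op}$. If $\mathfrak s(\delta)=[A\xrightarrow{x}B\xrightarrow{y}C]$, then $A\xrightarrow{x}B\xrightarrow{y}C\overset{\delta}{\dashrightarrow}$ is called an $\mathbb E$-triangle, $x$ an inflation, $y$ a deflation; it is split if $\delta=0$. Condition (WIC): for composable $f,g$, if $gf$ is an inflation so is $f$; if $gf$ is a deflation so is $g$. Proper class: a class $\xi$ of $\mathbb E$-triangles closed under isomorphisms such that (1) $\xi$ contains the split $\mathbb E$-triangles and is closed under finite coproducts; (2) if $A\to B\to C\overset{\delta}{\dashrightarrow}$ is in $\xi$, so is every $\mathbb E$-triangle realizing $c^*\delta$ or $a_*\delta$, for any $c:C'\to C$, $a:A\to A'$; (3) (saturated) for $\mathbb E$-triangles $A_i\xrightarrow{x_i}B_i\xrightarrow{y_i}C\overset{\delta_i}{\dashrightarrow}$, $i=1,2$, if the second one and the $\mathbb E$-triangle $A_1\to M\to B_2\overset{y_2^*\delta_1}{\dashrightarrow}$ are in $\xi$, then the first one is in $\xi$. $P$ is $\xi$-projective if $0\to\mathcal C(P,A)\to\mathcal C(P,B)\to\mathcal C(P,C)\to0$ is exact for every $\mathbb E$-triangle $A\to B\to C\dashrightarrow$ in $\xi$; $I$ is $\xi$-injective if $0\to\mathcal C(C,I)\to\mathcal C(B,I)\to\mathcal C(A,I)\to0$ is exact for all such. $\mathcal P(\xi)$, $\mathcal I(\xi)$ denote the corresponding classes. Enough $\xi$-projectives: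 each $A$ admits an $\mathbb E$-triangle $K\to P\to A\dashrightarrow$ in $\xi$ with $P\in\mathcal P(\xi)$; enough $\xi$-injectives: each $A$ admits $A\to I\to K\dashrightarrow$ in $\xi$ with $I\in\mathcal I(\xi)$. For a class $\mathcal W$, an $\mathbb E$-triangle $A\to B\to C\dashrightarrow$ in $\xi$ is $\mathcal C(\mathcal W,-)$-exact if $0\to\mathcal C(W,A)\to\mathcal C(W,B)\to\mathcal C(W,C)\to0$ is exact for all $W\in\mathcal W$, and $\mathcal C(-,\mathcal W)$-exact if $0\to\mathcal C(C,W)\to\mathcal C(B,W)\to\mathcal C(A,W)\to0$ is exact for all $W\in\mathcal W$. A complex $\cdots\to X_1\xrightarrow{d_1}X_0\xrightarrow{d_0}X_{-1}\to\cdots$ is $\xi$-exact if there are $\mathbb E$-triangles $K_{n+1}\xrightarrow{g_n}X_n\xrightarrow{f_n}K_n\dashrightarrow$ in $\xi$ (resolution $\mathbb E$-triangles) with $d_n=g_{n-1}f_n$ for all $n$. A complete $\xi$-injective coresolution is a $\xi$-exact complex of $\xi$-injectives whose resolution $\mathbb E$-triangles are $\mathcal C(\mathcal I(\xi),-)$-exact; the objects $K_n$ occurring are called $\xi$-$\mathcal G$injective, forming $\mathcal{GI}(\xi)$. A proper $\xi$-$\mathcal G$injective coresolution of $B$ is a $\xi$-exact complex $0\to B\to H^0\to H^1\to\cdots$ with all $H^i\in\mathcal{GI}(\xi)$ whose resolution $\mathbb E$-triangles $L^i\to H^i\to L^{i+1}\dashrightarrow$ ($L^0=B$) are $\mathcal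 C(-,\mathcal{GI}(\xi))$-exact; its deleted complex $\mathbf H_\sharp$ is $0\to H^0\to H^1\to\cdots$. $\mathbf{Res}(\mathcal{GI}(\xi))$ is the full subcategory of objects having a proper $\xi$-$\mathcal G$injective coresolution. For $B\in\mathbf{Res}(\mathcal{GI}(\xi))$ and any $X$, $\xi\mathrm{xt}^n_{\mathcal{GI}(\xi)}(X,B):=H^n(\mathcal C(X,\mathbf H_\sharp))$, independent of the choice of coresolution up to isomorphism. In the situation of the claim the middle object $B$ also lies in $\mathbf{Res}(\mathcal{GI}(\xi))$, so all terms are defined; the unnamed maps are those induced by $x$ and $y$. *)

theory Defs
  imports "HOL-Algebra.Exact_Sequence"
begin

section \<open>Extriangulated categories\<close>

text \<open>
  Abelian groups are rendered by HOL-Algebra's \<open>comm_group\<close>, whose operations are written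
  multiplicatively. So in \<open>Mor \<C> A B\<close>, the group of morphisms from \<open>A\<close> to \<open>B\<close>, and in
  \<open>Ext \<C> C A\<close>, the group \<open>\<bbbE>(C,A)\<close>, the sign \<open>\<otimes>\<close> is addition and \<open>\<one>\<close> is zero; composition
  of morphisms is \<open>\<cdot>\<close> and identities are \<open>ide\<close>.

  For \<open>c : C' \<rightarrow> C\<close> and \<open>a : A \<rightarrow> A'\<close>, \<open>emap \<C> c a : \<bbbE>(C,A) \<rightarrow> \<bbbE>(C',A')\<close> is the action of the
  bifunctor. \<open>realiz \<C> C A \<delta>\<close> is the class of sequences \<open>(x,y)\<close> realizing \<open>\<delta> \<in> \<bbbE>(C,A)\<close>.
\<close>

record ('o, 'm, 'e) extri =
  obj :: "'o set"
  src :: "'m \<Rightarrow> 'o"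
  trg :: "'m \<Rightarrow> 'o"
  Mor :: "'o \<Rightarrow> 'o \<Rightarrow> 'm monoid"
  ide :: "'o \<Rightarrow> 'm"
  cmp :: "'m \<Rightarrow> 'm \<Rightarrow> 'm" (infixl \<open>\<cdot>\<index>\<close> 75)
  Ext :: "'o \<Rightarrow> 'o \<Rightarrow> 'e monoid"
  emap :: "'m \<Rightarrow> 'm \<Rightarrow> 'e \<Rightarrow> 'e"
  realiz :: "'o \<Rightarrow> 'o \<Rightarrow> 'e \<Rightarrow> ('m \<times> 'm) set"

abbreviation mor :: "('o, 'm, 'e) extri \<Rightarrow> 'o \<Rightarrow> 'o \<Rightarrow> 'm set" where
  "mor \<C> A B \<equiv> carrier (Mor \<C> A B)"

abbreviation ext :: "('o, 'm, 'e) extri \<Rightarrow> 'o \<Rightarrow> 'o \<Rightarrow> 'e set" where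
  "ext \<C> C A \<equiv> carrier (Ext \<C> C A)"


subsection \<open>Additive categories\<close>

record ('o, 'm) biprod =
  bobj :: 'o
  in1 :: 'm
  in2 :: 'm
  pr1 :: 'm
  pr2 :: 'm

definition is_biprod ::
    "('o, 'm, 'e) extri \<Rightarrow> 'o \<Rightarrow> 'o \<Rightarrow> ('o, 'm) biprod \<Rightarrow> bool" where
  "is_biprod \<C> A B P \<longleftrightarrow>
     bobj P \<in> obj \<C> \<and>
     in1 P \<in> mor \<C> A (bobj P) \<and> in2 P \<in> mor \<C> B (bobj P) \<and>
     pr1 P \<in> mor \<C> (bobj P) A \<and> pr2 P \<in> mor \<C> (bobj P) B \<and>
     pr1 P \<cdot>\<^bsub>\<C>\<^esub> in1 P = ide \<C> A \<and> pr2 P \<cdot>\<^bsub>\<C>\<^esub> in2 P = ide \<C> B \<and>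
     pr2 P \<cdot>\<^bsub>\<C>\<^esub> in1 P = \<one>\<^bsub>Mor \<C> A B\<^esub> \<and> pr1 P \<cdot>\<^bsub>\<C>\<^esub> in2 P = \<one>\<^bsub>Mor \<C> B A\<^esub> \<and>
     (in1 P \<cdot>\<^bsub>\<C>\<^esub> pr1 P) \<otimes>\<^bsub>Mor \<C> (bobj P) (bobj P)\<^esub> (in2 P \<cdot>\<^bsub>\<C>\<^esub> pr2 P) = ide \<C> (bobj P)"

definition mor_sum ::
    "('o, 'm, 'e) extri \<Rightarrow> ('o, 'm) biprod \<Rightarrow> ('o, 'm) biprod \<Rightarrow> 'm \<Rightarrow> 'm \<Rightarrow> 'm" where
  "mor_sum \<C> P Q f g =
     (in1 Q \<cdot>\<^bsub>\<C>\<^esub> f \<cdot>\<^bsub>\<C>\<^esub> pr1 P) \<otimes>\<^bsub>Mor \<C> (bobj P) (bobj Q)\<^esub> (in2 Q \<cdot>\<^bsub>\<C>\<^esub> g \<cdot>\<^bsub>\<C>\<^esub> pr2 P)"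

definition is_iso :: "('o, 'm, 'e) extri \<Rightarrow> 'o \<Rightarrow> 'o \<Rightarrow> 'm \<Rightarrow> bool" where
  "is_iso \<C> A B f \<longleftrightarrow>
     f \<in> mor \<C> A B \<and> (\<exists>g \<in> mor \<C> B A. g \<cdot>\<^bsub>\<C>\<^esub> f = ide \<C> A \<and> f \<cdot>\<^bsub>\<C>\<^esub> g = ide \<C> B)"

locale additive_category =
  fixes \<C> :: "('o, 'm, 'e) extri" (structure)
  assumes mor_src_trg:
      "\<lbrakk>A \<in> obj \<C>; B \<in> obj \<C>; f \<in> mor \<C> A B\<rbrakk> \<Longrightarrow> src \<C> f = A \<and> trg \<C> f = B"
    and ide_closed: "A \<in> obj \<C> \<Longrightarrow> ide \<C> A \<in> mor \<C> A A"
    and cmp_closed: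
      "\<lbrakk>A \<in> obj \<C>; B \<in> obj \<C>; D \<in> obj \<C>; f \<in> mor \<C> A B; g \<in> mor \<C> B D\<rbrakk>
         \<Longrightarrow> g \<cdot> f \<in> mor \<C> A D"
    and ide_left: "\<lbrakk>A \<in> obj \<C>; B \<in> obj \<C>; f \<in> mor \<C> A B\<rbrakk> \<Longrightarrow> ide \<C> B \<cdot> f = f"
    and ide_right: "\<lbrakk>A \<in> obj \<C>; B \<in> obj \<C>; f \<in> mor \<C> A B\<rbrakk> \<Longrightarrow> f \<cdot> ide \<C> A = f"
    and cmp_assoc:
      "\<lbrakk>A \<in> obj \<C>; B \<in> obj \<C>; D \<in> obj \<C>; E \<in> obj \<C>;
        f \<in> mor \<C> A B; g \<in> mor \<C> B D; h \<in> mor \<C> D E\<rbrakk> \<Longrightarrow> h \<cdot> (g \<cdot> f) = h \<cdot> g \<cdot> f"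
    and Mor_group: "\<lbrakk>A \<in> obj \<C>; B \<in> obj \<C>\<rbrakk> \<Longrightarrow> comm_group (Mor \<C> A B)"
    and cmp_add_left:
      "\<lbrakk>A \<in> obj \<C>; B \<in> obj \<C>; D \<in> obj \<C>; f \<in> mor \<C> A B; g \<in> mor \<C> B D; g' \<in> mor \<C> B D\<rbrakk>
         \<Longrightarrow> (g \<otimes>\<^bsub>Mor \<C> B D\<^esub> g') \<cdot> f = (g \<cdot> f) \<otimes>\<^bsub>Mor \<C> A D\<^esub> (g' \<cdot> f)"
    and cmp_add_right:
      "\<lbrakk>A \<in> obj \<C>; B \<in> obj \<C>; D \<in> obj \<C>; f \<in> mor \<C> A B; f' \<in> mor \<C> A B; g \<in> mor \<C> B D\<rbrakk>
         \<Longrightarrow> g \<cdot> (f \<otimes>\<^bsub>Mor \<C> A B\<^esub> f') = (g \<cdot> f) \<otimes>\<^bsub>Mor \<C> A D\<^esub> (g \<cdot> f')"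
    and zero_object:
      "\<exists>Z \<in> obj \<C>. \<forall>A \<in> obj \<C>. (\<exists>!f. f \<in> mor \<C> Z A) \<and> (\<exists>!f. f \<in> mor \<C> A Z)"
    and biproducts: "\<lbrakk>A \<in> obj \<C>; B \<in> obj \<C>\<rbrakk> \<Longrightarrow> \<exists>P. is_biprod \<C> A B P"


subsection \<open>Extensions and realizations\<close>

definition push :: "('o, 'm, 'e) extri \<Rightarrow> 'o \<Rightarrow> 'm \<Rightarrow> 'e \<Rightarrow> 'e" where
  "push \<C> C a \<delta> = emap \<C> (ide \<C> C) a \<delta>"

definition pull :: "('o, 'm, 'e) extri \<Rightarrow> 'o \<Rightarrow> 'm \<Rightarrow> 'e \<Rightarrow> 'e" where
  "pull \<C> A c \<delta> = emap \<C> c (ide \<C> A) \<delta>"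

text \<open>
  \<open>ext_mor \<C> A C \<delta> A' C' \<delta>' a c\<close>: the pair \<open>(a,c)\<close> is a morphism of extensions from
  \<open>\<delta> \<in> \<bbbE>(C,A)\<close> to \<open>\<delta>' \<in> \<bbbE>(C',A')\<close>, i.e. \<open>a\<^sub>* \<delta> = c\<^sup>* \<delta>'\<close>.
\<close>

definition ext_mor ::
    "('o, 'm, 'e) extri \<Rightarrow> 'o \<Rightarrow> 'o \<Rightarrow> 'e \<Rightarrow> 'o \<Rightarrow> 'o \<Rightarrow> 'e \<Rightarrow> 'm \<Rightarrow> 'm \<Rightarrow> bool" where
  "ext_mor \<C> A C \<delta> A' C' \<delta>' a c \<longleftrightarrow>
     a \<in> mor \<C> A A' \<and> c \<in> mor \<C> C C' \<and> push \<C> C a \<delta> = pull \<C> A' c \<delta>'"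

text \<open>
  The element of \<open>\<bbbE>(C \<oplus> C', A \<oplus> A')\<close> that corresponds to \<open>(\<delta>,0,0,\<delta>')\<close> under the decomposition
  into four summands given by biadditivity; \<open>P = A \<oplus> A'\<close> and \<open>R = C \<oplus> C'\<close>.
\<close>

definition ext_sum ::
    "('o, 'm, 'e) extri \<Rightarrow> ('o, 'm) biprod \<Rightarrow> ('o, 'm) biprod \<Rightarrow> 'e \<Rightarrow> 'e \<Rightarrow> 'e" where
  "ext_sum \<C> P R \<delta> \<delta>' =
     emap \<C> (pr1 R) (in1 P) \<delta> \<otimes>\<^bsub>Ext \<C> (bobj R) (bobj P)\<^esub> emap \<C> (pr2 R) (in2 P) \<delta>'"

definition seqs :: "('o, 'm, 'e) extri \<Rightarrow> 'o \<Rightarrow> 'o \<Rightarrow> ('m \<times> 'm) set" where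
  "seqs \<C> A C = {(x, y). \<exists>B \<in> obj \<C>. x \<in> mor \<C> A B \<and> y \<in> mor \<C> B C}"

definition seq_equiv :: "('o, 'm, 'e) extri \<Rightarrow> 'o \<Rightarrow> 'o \<Rightarrow> (('m \<times> 'm) \<times> ('m \<times> 'm)) set" where
  "seq_equiv \<C> A C =
     {((x, y), (x', y')). (x, y) \<in> seqs \<C> A C \<and> (x', y') \<in> seqs \<C> A C \<and>
        (\<exists>b. is_iso \<C> (trg \<C> x) (trg \<C> x') b \<and> b \<cdot>\<^bsub>\<C>\<^esub> x = x' \<and> y' \<cdot>\<^bsub>\<C>\<^esub> b = y)}"

text \<open>
  \<open>etri \<C> A B C x y \<delta>\<close>: \<open>A \<rightarrow> B \<rightarrow> C \<dashrightarrow>\<close> with morphisms \<open>x\<close>, \<open>y\<close> and extension \<open>\<delta>\<close> is an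
  \<open>\<bbbE>\<close>-triangle.
\<close>

definition etri ::
    "('o, 'm, 'e) extri \<Rightarrow> 'o \<Rightarrow> 'o \<Rightarrow> 'o \<Rightarrow> 'm \<Rightarrow> 'm \<Rightarrow> 'e \<Rightarrow> bool" where
  "etri \<C> A B C x y \<delta> \<longleftrightarrow>
     A \<in> obj \<C> \<and> B \<in> obj \<C> \<and> C \<in> obj \<C> \<and> x \<in> mor \<C> A B \<and> y \<in> mor \<C> B C \<and>
     \<delta> \<in> ext \<C> C A \<and> (x, y) \<in> realiz \<C> C A \<delta>"

locale extriangulated_category = additive_category +
  assumes
    \<comment> \<open>(ET1)\<close>
    Ext_group: "\<lbrakk>A \<in> obj \<C>; C \<in> obj \<C>\<rbrakk> \<Longrightarrow> comm_group (Ext \<C> C A)"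
    and emap_hom:
      "\<lbrakk>A \<in> obj \<C>; A' \<in> obj \<C>; C \<in> obj \<C>; C' \<in> obj \<C>; c \<in> mor \<C> C' C; a \<in> mor \<C> A A'\<rbrakk>
         \<Longrightarrow> emap \<C> c a \<in> hom (Ext \<C> C A) (Ext \<C> C' A')"
    and emap_ide:
      "\<lbrakk>A \<in> obj \<C>; C \<in> obj \<C>; \<delta> \<in> ext \<C> C A\<rbrakk> \<Longrightarrow> emap \<C> (ide \<C> C) (ide \<C> A) \<delta> = \<delta>"
    and emap_cmp:
      "\<lbrakk>A \<in> obj \<C>; A' \<in> obj \<C>; A'' \<in> obj \<C>; C \<in> obj \<C>; C' \<in> obj \<C>; C'' \<in> obj \<C>;
        c \<in> mor \<C> C' C; c' \<in> mor \<C> C'' C'; a \<in> mor \<C> A A'; a' \<in> mor \<C> A' A''; \<delta> \<in> ext \<C> C A\<rbrakk>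
         \<Longrightarrow> emap \<C> (c \<cdot> c') (a' \<cdot> a) \<delta> = emap \<C> c' a' (emap \<C> c a \<delta>)"
    and emap_add_left:
      "\<lbrakk>A \<in> obj \<C>; A' \<in> obj \<C>; C \<in> obj \<C>; C' \<in> obj \<C>;
        c \<in> mor \<C> C' C; d \<in> mor \<C> C' C; a \<in> mor \<C> A A'; \<delta> \<in> ext \<C> C A\<rbrakk>
         \<Longrightarrow> emap \<C> (c \<otimes>\<^bsub>Mor \<C> C' C\<^esub> d) a \<delta> = emap \<C> c a \<delta> \<otimes>\<^bsub>Ext \<C> C' A'\<^esub> emap \<C> d a \<delta>"
    and emap_add_right:
      "\<lbrakk>A \<in> obj \<C>; A' \<in> obj \<C>; C \<in> obj \<C>; C' \<in> obj \<C>;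
        c \<in> mor \<C> C' C; a \<in> mor \<C> A A'; b \<in> mor \<C> A A'; \<delta> \<in> ext \<C> C A\<rbrakk>
         \<Longrightarrow> emap \<C> c (a \<otimes>\<^bsub>Mor \<C> A A'\<^esub> b) \<delta> = emap \<C> c a \<delta> \<otimes>\<^bsub>Ext \<C> C' A'\<^esub> emap \<C> c b \<delta>"
    and realiz_class:
      "\<lbrakk>A \<in> obj \<C>; C \<in> obj \<C>; \<delta> \<in> ext \<C> C A\<rbrakk>
         \<Longrightarrow> realiz \<C> C A \<delta> \<in> seqs \<C> A C // seq_equiv \<C> A C"
    \<comment> \<open>(ET2)\<close>
    and realiz_mor:
      "\<lbrakk>etri \<C> A B C x y \<delta>; etri \<C> A' B' C' x' y' \<delta>'; ext_mor \<C> A C \<delta> A' C' \<delta>' a c\<rbrakk>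
         \<Longrightarrow> \<exists>b \<in> mor \<C> B B'. b \<cdot> x = x' \<cdot> a \<and> y' \<cdot> b = c \<cdot> y"
    and realiz_zero:
      "\<lbrakk>A \<in> obj \<C>; C \<in> obj \<C>; is_biprod \<C> A C P\<rbrakk>
         \<Longrightarrow> (in1 P, pr2 P) \<in> realiz \<C> C A \<one>\<^bsub>Ext \<C> C A\<^esub>"
    and realiz_sum:
      "\<lbrakk>etri \<C> A B C x y \<delta>; etri \<C> A' B' C' x' y' \<delta>';
        is_biprod \<C> A A' P; is_biprod \<C> B B' Q; is_biprod \<C> C C' R\<rbrakk>
         \<Longrightarrow> (mor_sum \<C> P Q x x', mor_sum \<C> Q R y y')
               \<in> realiz \<C> (bobj R) (bobj P) (ext_sum \<C> P R \<delta> \<delta>')"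
    \<comment> \<open>(ET3) and its dual\<close>
    and ET3:
      "\<lbrakk>etri \<C> A B C x y \<delta>; etri \<C> A' B' C' x' y' \<delta>';
        a \<in> mor \<C> A A'; b \<in> mor \<C> B B'; b \<cdot> x = x' \<cdot> a\<rbrakk>
         \<Longrightarrow> \<exists>c \<in> mor \<C> C C'. c \<cdot> y = y' \<cdot> b \<and> ext_mor \<C> A C \<delta> A' C' \<delta>' a c"
    and ET3_op:
      "\<lbrakk>etri \<C> A B C x y \<delta>; etri \<C> A' B' C' x' y' \<delta>';
        b \<in> mor \<C> B B'; c \<in> mor \<C> C C'; c \<cdot> y = y' \<cdot> b\<rbrakk>
         \<Longrightarrow> \<exists>a \<in> mor \<C> A A'. b \<cdot> x = x' \<cdot> a \<and> ext_mor \<C> A C \<delta> A' C' \<delta>' a c"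
    \<comment> \<open>(ET4) and its dual\<close>
    and ET4:
      "\<lbrakk>etri \<C> A B D f f' \<delta>; etri \<C> B C F g g' \<delta>'\<rbrakk>
         \<Longrightarrow> \<exists>E h' d e \<delta>''. etri \<C> A C E (g \<cdot> f) h' \<delta>'' \<and>
               etri \<C> D E F d e (push \<C> F f' \<delta>') \<and>
               h' \<cdot> g = d \<cdot> f' \<and> e \<cdot> h' = g' \<and>
               pull \<C> A d \<delta>'' = \<delta> \<and> push \<C> E f \<delta>'' = pull \<C> B e \<delta>'"
    and ET4_op:
      "\<lbrakk>etri \<C> D B A f' f \<delta>; etri \<C> F C B g' g \<delta>'\<rbrakk>
         \<Longrightarrow> \<exists>E h' d e \<delta>''. etri \<C> E C A h' (f \<cdot> g) \<delta>'' \<and>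
               etri \<C> F E D e d (pull \<C> F f' \<delta>') \<and>
               g \<cdot> h' = f' \<cdot> d \<and> h' \<cdot> e = g' \<and>
               push \<C> A d \<delta>'' = \<delta> \<and> pull \<C> E f \<delta>'' = push \<C> B e \<delta>'"

definition inflation :: "('o, 'm, 'e) extri \<Rightarrow> 'm \<Rightarrow> bool" where
  "inflation \<C> x \<longleftrightarrow> (\<exists>A B C y \<delta>. etri \<C> A B C x y \<delta>)"

definition deflation :: "('o, 'm, 'e) extri \<Rightarrow> 'm \<Rightarrow> bool" where
  "deflation \<C> y \<longleftrightarrow> (\<exists>A B C x \<delta>. etri \<C> A B C x y \<delta>)"

definition WIC :: "('o, 'm, 'e) extri \<Rightarrow> bool" where
  "WIC \<C> \<longleftrightarrow>
     (\<forall>A \<in> obj \<C>. \<forall>B \<in> obj \<C>. \<forall>D \<in> obj \<C>. \<forall>f \<in> mor \<C> A B. \<forall>g \<in> mor \<C> B D.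
        (inflation \<C> (g \<cdot>\<^bsub>\<C>\<^esub> f) \<longrightarrow> inflation \<C> f) \<and>
        (deflation \<C> (g \<cdot>\<^bsub>\<C>\<^esub> f) \<longrightarrow> deflation \<C> g))"


section \<open>Proper classes of \<open>\<bbbE>\<close>-triangles\<close>

text \<open>
  A class \<open>\<xi>\<close> of \<open>\<bbbE>\<close>-triangles is a set of triples \<open>(x,y,\<delta>)\<close>; the three objects are determined by
  the morphisms \<open>x\<close> and \<open>y\<close>.
\<close>

definition xtri ::
    "('o, 'm, 'e) extri \<Rightarrow> ('m \<times> 'm \<times> 'e) set \<Rightarrow>
     'o \<Rightarrow> 'o \<Rightarrow> 'o \<Rightarrow> 'm \<Rightarrow> 'm \<Rightarrow> 'e \<Rightarrow> bool" where
  "xtri \<C> \<xi> A B C x y \<delta> \<longleftrightarrow> etri \<C> A B C x y \<delta> \<and> (x, y, \<delta>) \<in> \<xi>"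

locale proper_class =
  fixes \<C> :: "('o, 'm, 'e) extri" (structure)
    and \<xi> :: "('m \<times> 'm \<times> 'e) set"
  assumes etriangles: "(x, y, \<delta>) \<in> \<xi> \<Longrightarrow> \<exists>A B C. etri \<C> A B C x y \<delta>"
    and iso_closed:
      "\<lbrakk>xtri \<C> \<xi> A B C x y \<delta>; etri \<C> A' B' C' x' y' \<delta>';
        is_iso \<C> A A' a; is_iso \<C> B B' b; is_iso \<C> C C' c;
        b \<cdot> x = x' \<cdot> a; c \<cdot> y = y' \<cdot> b; ext_mor \<C> A C \<delta> A' C' \<delta>' a c\<rbrakk>
         \<Longrightarrow> (x', y', \<delta>') \<in> \<xi>"
    and split: "etri \<C> A B C x y \<one>\<^bsub>Ext \<C> C A\<^esub> \<Longrightarrow> (x, y, \<one>\<^bsub>Ext \<C> C A\<^esub>) \<in> \<xi>"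
    and coproducts:
      "\<lbrakk>xtri \<C> \<xi> A B C x y \<delta>; xtri \<C> \<xi> A' B' C' x' y' \<delta>';
        is_biprod \<C> A A' P; is_biprod \<C> B B' Q; is_biprod \<C> C C' R\<rbrakk>
         \<Longrightarrow> (mor_sum \<C> P Q x x', mor_sum \<C> Q R y y', ext_sum \<C> P R \<delta> \<delta>') \<in> \<xi>"
    and base_change:
      "\<lbrakk>xtri \<C> \<xi> A B C x y \<delta>; c \<in> mor \<C> C' C; etri \<C> A B' C' x' y' (pull \<C> A c \<delta>)\<rbrakk>
         \<Longrightarrow> (x', y', pull \<C> A c \<delta>) \<in> \<xi>"
    and cobase_change:
      "\<lbrakk>xtri \<C> \<xi> A B C x y \<delta>; a \<in> mor \<C> A A'; etri \<C> A' B' C x' y' (push \<C> C a \<delta>)\<rbrakk>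
         \<Longrightarrow> (x', y', push \<C> C a \<delta>) \<in> \<xi>"
    and saturated:
      "\<lbrakk>etri \<C> A1 B1 C x1 y1 \<delta>1; xtri \<C> \<xi> A2 B2 C x2 y2 \<delta>2;
        xtri \<C> \<xi> A1 M B2 m n (pull \<C> A1 y2 \<delta>1)\<rbrakk>
         \<Longrightarrow> (x1, y1, \<delta>1) \<in> \<xi>"

text \<open>
  Note the argument order of the library's \<open>short_exact_sequence\<close>: \<open>short_exact_sequence G3 G2 G1 q p\<close>
  says that \<open>0 \<rightarrow> G1 \<rightarrow> G2 \<rightarrow> G3 \<rightarrow> 0\<close> with maps \<open>p\<close>, \<open>q\<close> is exact.
\<close>

definition cov_exact ::
    "('o, 'm, 'e) extri \<Rightarrow> 'o set \<Rightarrow> 'o \<Rightarrow> 'o \<Rightarrow> 'o \<Rightarrow> 'm \<Rightarrow> 'm \<Rightarrow> bool" where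
  "cov_exact \<C> \<W> A B C x y \<longleftrightarrow>
     (\<forall>W \<in> \<W>. short_exact_sequence (Mor \<C> W C) (Mor \<C> W B) (Mor \<C> W A)
                 (\<lambda>f. y \<cdot>\<^bsub>\<C>\<^esub> f) (\<lambda>f. x \<cdot>\<^bsub>\<C>\<^esub> f))"

definition contra_exact ::
    "('o, 'm, 'e) extri \<Rightarrow> 'o set \<Rightarrow> 'o \<Rightarrow> 'o \<Rightarrow> 'o \<Rightarrow> 'm \<Rightarrow> 'm \<Rightarrow> bool" where
  "contra_exact \<C> \<W> A B C x y \<longleftrightarrow>
     (\<forall>W \<in> \<W>. short_exact_sequence (Mor \<C> A W) (Mor \<C> B W) (Mor \<C> C W)
                 (\<lambda>f. f \<cdot>\<^bsub>\<C>\<^esub> x) (\<lambda>f. f \<cdot>\<^bsub>\<C>\<^esub> y))"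

definition xproj :: "('o, 'm, 'e) extri \<Rightarrow> ('m \<times> 'm \<times> 'e) set \<Rightarrow> 'o set" where
  "xproj \<C> \<xi> =
     {P \<in> obj \<C>. \<forall>A B C x y \<delta>. xtri \<C> \<xi> A B C x y \<delta> \<longrightarrow> cov_exact \<C> {P} A B C x y}"

definition xinj :: "('o, 'm, 'e) extri \<Rightarrow> ('m \<times> 'm \<times> 'e) set \<Rightarrow> 'o set" where
  "xinj \<C> \<xi> =
     {I \<in> obj \<C>. \<forall>A B C x y \<delta>. xtri \<C> \<xi> A B C x y \<delta> \<longrightarrow> contra_exact \<C> {I} A B C x y}"

definition enough_xproj :: "('o, 'm, 'e) extri \<Rightarrow> ('m \<times> 'm \<times> 'e) set \<Rightarrow> bool" where
  "enough_xproj \<C> \<xi> \<longleftrightarrow>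
     (\<forall>A \<in> obj \<C>. \<exists>K P x y \<delta>. P \<in> xproj \<C> \<xi> \<and> xtri \<C> \<xi> K P A x y \<delta>)"

definition enough_xinj :: "('o, 'm, 'e) extri \<Rightarrow> ('m \<times> 'm \<times> 'e) set \<Rightarrow> bool" where
  "enough_xinj \<C> \<xi> \<longleftrightarrow>
     (\<forall>A \<in> obj \<C>. \<exists>I K x y \<delta>. I \<in> xinj \<C> \<xi> \<and> xtri \<C> \<xi> A I K x y \<delta>)"


section \<open>\<open>\<xi>\<close>-\<open>\<G>\<close>injective objects and their coresolutions\<close>

text \<open>
  A complete \<open>\<xi>\<close>-injective coresolution \<open>(X, d)\<close> with \<open>d n : X n \<rightarrow> X (n - 1)\<close>, together with the
  objects \<open>K n\<close> of a family of resolution \<open>\<bbbE>\<close>-triangles \<open>K (n + 1) \<rightarrow> X n \<rightarrow> K n\<close>.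
\<close>

definition complete_xinj_cores ::
    "('o, 'm, 'e) extri \<Rightarrow> ('m \<times> 'm \<times> 'e) set \<Rightarrow>
     (int \<Rightarrow> 'o) \<Rightarrow> (int \<Rightarrow> 'm) \<Rightarrow> (int \<Rightarrow> 'o) \<Rightarrow> bool" where
  "complete_xinj_cores \<C> \<xi> X d K \<longleftrightarrow>
     (\<forall>n. X n \<in> xinj \<C> \<xi>) \<and>
     (\<forall>n. d n \<in> mor \<C> (X n) (X (n - 1))) \<and>
     (\<forall>n. d n \<cdot>\<^bsub>\<C>\<^esub> d (n + 1) = \<one>\<^bsub>Mor \<C> (X (n + 1)) (X (n - 1))\<^esub>) \<and>
     (\<exists>g f \<rho>. \<forall>n. xtri \<C> \<xi> (K (n + 1)) (X n) (K n) (g n) (f n) (\<rho> n) \<and>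
                  cov_exact \<C> (xinj \<C> \<xi>) (K (n + 1)) (X n) (K n) (g n) (f n) \<and>
                  d n = g (n - 1) \<cdot>\<^bsub>\<C>\<^esub> f n)"

definition GI :: "('o, 'm, 'e) extri \<Rightarrow> ('m \<times> 'm \<times> 'e) set \<Rightarrow> 'o set" where
  "GI \<C> \<xi> = {M. \<exists>X d K n. complete_xinj_cores \<C> \<xi> X d K \<and> M = K n}"

text \<open>A complex \<open>0 \<rightarrow> B \<rightarrow> H\<^sup>0 \<rightarrow> H\<^sup>1 \<rightarrow> \<dots>\<close> with augmentation \<open>caug : B \<rightarrow> H\<^sup>0\<close>.\<close>

record ('o, 'm) cores =
  caug :: 'm
  cobj :: "nat \<Rightarrow> 'o"
  cdiff :: "nat \<Rightarrow> 'm"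

definition proper_GI_cores ::
    "('o, 'm, 'e) extri \<Rightarrow> ('m \<times> 'm \<times> 'e) set \<Rightarrow> 'o \<Rightarrow> ('o, 'm) cores \<Rightarrow> bool" where
  "proper_GI_cores \<C> \<xi> B H \<longleftrightarrow>
     (\<forall>i. cobj H i \<in> GI \<C> \<xi>) \<and>
     caug H \<in> mor \<C> B (cobj H 0) \<and>
     (\<forall>i. cdiff H i \<in> mor \<C> (cobj H i) (cobj H (Suc i))) \<and>
     cdiff H 0 \<cdot>\<^bsub>\<C>\<^esub> caug H = \<one>\<^bsub>Mor \<C> B (cobj H 1)\<^esub> \<and>
     (\<forall>i. cdiff H (Suc i) \<cdot>\<^bsub>\<C>\<^esub> cdiff H i = \<one>\<^bsub>Mor \<C> (cobj H i) (cobj H (Suc (Suc i)))\<^esub>) \<and>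
     (\<exists>L g f \<rho>. L 0 = B \<and> caug H = g 0 \<and>
        (\<forall>i. xtri \<C> \<xi> (L i) (cobj H i) (L (Suc i)) (g i) (f i) (\<rho> i) \<and>
             contra_exact \<C> (GI \<C> \<xi>) (L i) (cobj H i) (L (Suc i)) (g i) (f i) \<and>
             cdiff H i = g (Suc i) \<cdot>\<^bsub>\<C>\<^esub> f i))"

definition Res_GI :: "('o, 'm, 'e) extri \<Rightarrow> ('m \<times> 'm \<times> 'e) set \<Rightarrow> 'o set" where
  "Res_GI \<C> \<xi> = {B \<in> obj \<C>. \<exists>H. proper_GI_cores \<C> \<xi> B H}"


section \<open>The groups \<open>\<xi>xt\<^sup>n(X,B)\<close>\<close>

text \<open>
  \<open>xt \<C> H n X\<close> is the cohomology \<open>H\<^sup>n(\<C>(X, H\<^sub>\<sharp>))\<close> of the deleted complex of \<open>H\<close>; this is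
  \<open>\<xi>xt\<^sup>n(X,B)\<close> when \<open>H\<close> is a proper coresolution of \<open>B\<close>. Its elements are cosets of coboundaries.
\<close>

definition cocycles :: "('o, 'm, 'e) extri \<Rightarrow> ('o, 'm) cores \<Rightarrow> nat \<Rightarrow> 'o \<Rightarrow> 'm set" where
  "cocycles \<C> H n X =
     kernel (Mor \<C> X (cobj H n)) (Mor \<C> X (cobj H (Suc n))) (\<lambda>f. cdiff H n \<cdot>\<^bsub>\<C>\<^esub> f)"

definition cobounds :: "('o, 'm, 'e) extri \<Rightarrow> ('o, 'm) cores \<Rightarrow> nat \<Rightarrow> 'o \<Rightarrow> 'm set" where
  "cobounds \<C> H n X =
     (case n of 0 \<Rightarrow> {\<one>\<^bsub>Mor \<C> X (cobj H 0)\<^esub>}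
      | Suc m \<Rightarrow> (\<lambda>f. cdiff H m \<cdot>\<^bsub>\<C>\<^esub> f) ` mor \<C> X (cobj H m))"

definition xt :: "('o, 'm, 'e) extri \<Rightarrow> ('o, 'm) cores \<Rightarrow> nat \<Rightarrow> 'o \<Rightarrow> 'm set monoid" where
  "xt \<C> H n X =
     (Mor \<C> X (cobj H n))\<lparr>carrier := cocycles \<C> H n X\<rparr> Mod cobounds \<C> H n X"

definition coh_class ::
    "('o, 'm, 'e) extri \<Rightarrow> ('o, 'm) cores \<Rightarrow> nat \<Rightarrow> 'o \<Rightarrow> 'm \<Rightarrow> 'm set" where
  "coh_class \<C> H n X f = cobounds \<C> H n X #>\<^bsub>Mor \<C> X (cobj H n)\<^esub> f"

text \<open>Chain maps \<open>\<phi>\<close> between coresolutions lying over a morphism \<open>b\<close> of the coresolved objects.\<close>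

definition lifts ::
    "('o, 'm, 'e) extri \<Rightarrow> ('o, 'm) cores \<Rightarrow> ('o, 'm) cores \<Rightarrow> 'm \<Rightarrow> (nat \<Rightarrow> 'm) \<Rightarrow> bool" where
  "lifts \<C> H H' b \<phi> \<longleftrightarrow>
     (\<forall>i. \<phi> i \<in> mor \<C> (cobj H i) (cobj H' i)) \<and>
     \<phi> 0 \<cdot>\<^bsub>\<C>\<^esub> caug H = caug H' \<cdot>\<^bsub>\<C>\<^esub> b \<and>
     (\<forall>i. \<phi> (Suc i) \<cdot>\<^bsub>\<C>\<^esub> cdiff H i = cdiff H' i \<cdot>\<^bsub>\<C>\<^esub> \<phi> i)"

text \<open>
  The map \<open>\<xi>xt\<^sup>n(X,B) \<rightarrow> \<xi>xt\<^sup>n(X,B')\<close> induced by \<open>b : B \<rightarrow> B'\<close>: the common value of the class of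
  \<open>\<phi> n \<cdot> f\<close> over all representatives \<open>f\<close> and all chain maps \<open>\<phi>\<close> over \<open>b\<close>. It is meaningful only if
  such a \<open>\<phi>\<close> exists and the class does not depend on the choices.
\<close>

definition xt_map ::
    "('o, 'm, 'e) extri \<Rightarrow> ('o, 'm) cores \<Rightarrow> ('o, 'm) cores \<Rightarrow> 'm \<Rightarrow> nat \<Rightarrow> 'o \<Rightarrow>
     'm set \<Rightarrow> 'm set" where
  "xt_map \<C> H H' b n X K =
     the_elem {coh_class \<C> H' n X (\<phi> n \<cdot>\<^bsub>\<C>\<^esub> f) | \<phi> f. lifts \<C> H H' b \<phi> \<and> f \<in> K}"

text \<open>The map \<open>\<xi>xt\<^sup>n(X,B) \<rightarrow> \<xi>xt\<^sup>n(X',B)\<close> induced by precomposition with \<open>u : X' \<rightarrow> X\<close>.\<close>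

definition xt_pre ::
    "('o, 'm, 'e) extri \<Rightarrow> ('o, 'm) cores \<Rightarrow> nat \<Rightarrow> 'o \<Rightarrow> 'm \<Rightarrow> 'm set \<Rightarrow> 'm set" where
  "xt_pre \<C> H n X' u K = the_elem ((\<lambda>f. coh_class \<C> H n X' (f \<cdot>\<^bsub>\<C>\<^esub> u)) ` K)"

end

theory Submission
  imports Defs
begin

text \<open>
  Splicing the resolution triangles \<open>A \<rightarrow> H \<rightarrow> L\<close> and \<open>C \<rightarrow> H' \<rightarrow> L'\<close> over \<open>A \<rightarrow> B \<rightarrow> C\<close> is a horseshoe
  argument. Since \<open>H\<close> is \<open>\<xi>\<close>-\<open>\<G>\<close>injective, \<open>A \<rightarrow> H\<close> extends to \<open>B\<close>; this makes \<open>B \<rightarrow> H \<oplus> C\<close> an inflation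
  with cone \<open>L\<close>, and (ET4) applied to \<open>B \<rightarrow> H \<oplus> C \<rightarrow> H \<oplus> H'\<close> gives \<open>B \<rightarrow> H \<oplus> H' \<rightarrow> M\<close> together with
  \<open>L \<rightarrow> M \<rightarrow> L'\<close>, to which the step can be applied again. The resulting coresolution of \<open>B\<close> is
  degreewise the biproduct of those of \<open>A\<close> and \<open>C\<close>, so it has a long exact cohomology sequence whose
  connecting map is induced by the off-diagonal entry of its differential. Any other proper
  coresolution of \<open>B\<close> has the same cohomology, because morphisms lift to chain maps that are unique
  up to homotopy.
\<close>

section \<open>Additive categories\<close>

text \<open>Inflations need not be monic nor deflations epic: an extriangle yields only weak kernels
  and cokernels, so fill-in maps exist without being unique. What replaces uniqueness is the
  injective left end of the \<open>\<C>(-,W)\<close>-exact sequences: a map into \<open>W\<close>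
  that vanishes on the deflation of such a triangle is zero. (ET4) is silent about these sequences
  and about \<xi>, so both exactness and membership in \<xi> are carried through every horseshoe
  step; the next step consumes them. Membership of a composite in \<xi> is no axiom. Saturation is
  turned into a test against \<xi>-projectives \<open>P\<close>, and the test for a composite comes
  down to exactness of \<open>\<C>(P,C) \<rightarrow> E(P,A) \<rightarrow> E(P,B)\<close> in the
  middle. The splice is made before \<open>X\<close> is fixed. The off-diagonal entry is therefore a
  family of arrows independent of \<open>X\<close>; the connecting map composes with it on the left,
  restriction along \<open>X' \<rightarrow> X\<close> composes on the right, and naturality is
  associativity.\<close>

context additive_category
begin

abbreviation dm where "dm \<equiv> src \<C>"
abbreviation cd where "cd \<equiv> trg \<C>"
abbreviation zer where "zer X Y \<equiv> \<one>\<^bsub>Mor \<C> X Y\<^esub>"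

text \<open>Membership \<open>f \<in> mor \<C> X Y\<close> is split into \<open>arr f\<close>, \<open>dm f = X\<close> and \<open>cd f = Y\<close>, so that the typing
  conditions of the categorical laws no longer mention objects that are absent from the terms to
  be rewritten.\<close>

definition arr where
  "arr f \<longleftrightarrow> dm f \<in> obj \<C> \<and> cd f \<in> obj \<C> \<and> f \<in> mor \<C> (dm f) (cd f)"

text \<open>The hom group is read off the first summand, so the notation carries no objects; for
  parallel arrows both summands give the same group.\<close>

definition add (infixl \<open>\<boxplus>\<close> 65) where
  "f \<boxplus> g = f \<otimes>\<^bsub>Mor \<C> (dm f) (cd f)\<^esub> g"

definition neg where
  "neg f = inv\<^bsub>Mor \<C> (dm f) (cd f)\<^esub> f"

section \<open>Typing and composition of arrows\<close>

lemma arrD [simp]: "arr f \<Longrightarrow> dm f \<in> obj \<C>" "arr f \<Longrightarrow> cd f \<in> obj \<C>"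
  by (auto simp: arr_def)

lemma mor_iff:
  assumes "X \<in> obj \<C>" "Y \<in> obj \<C>"
  shows "f \<in> mor \<C> X Y \<longleftrightarrow> arr f \<and> dm f = X \<and> cd f = Y"
  using assms mor_src_trg arr_def by metis

lemma arr_ide [simp]:
  assumes "X \<in> obj \<C>"
  shows "arr (ide \<C> X)" "dm (ide \<C> X) = X" "cd (ide \<C> X) = X"
  using mor_iff[OF assms assms] ide_closed[OF assms] by auto

lemma arr_cmp [simp]:
  assumes "arr f" "arr g" "dm g = cd f"
  shows "arr (g \<cdot> f)" "dm (g \<cdot> f) = dm f" "cd (g \<cdot> f) = cd g"
proof -
  have "g \<cdot> f \<in> mor \<C> (dm f) (cd g)"
    using assms cmp_closed[of "dm f" "cd f" "cd g" f g] unfolding arr_def by simp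
  then show "arr (g \<cdot> f)" "dm (g \<cdot> f) = dm f" "cd (g \<cdot> f) = cd g"
    using mor_iff assms by auto
qed

lemma cmp_assoc' [simp]:
  assumes "arr f" "arr g" "arr h" "dm g = cd f" "dm h = cd g"
  shows "(h \<cdot> g) \<cdot> f = h \<cdot> (g \<cdot> f)"
  using assms cmp_assoc[of "dm f" "cd f" "cd g" "cd h" f g h] unfolding arr_def by simp

lemma cmp_ide [simp]:
  "\<lbrakk>arr f; dm f = X\<rbrakk> \<Longrightarrow> f \<cdot> ide \<C> X = f"
  "\<lbrakk>arr f; cd f = X\<rbrakk> \<Longrightarrow> ide \<C> X \<cdot> f = f"
  using ide_left ide_right unfolding arr_def by metis+

section \<open>The abelian group of parallel arrows\<close>

lemma Mor_comm_group: "arr f \<Longrightarrow> comm_group (Mor \<C> (dm f) (cd f))"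
  using Mor_group arr_def by blast

lemma arr_zer [simp]:
  assumes "X \<in> obj \<C>" "Y \<in> obj \<C>"
  shows "arr (zer X Y)" "dm (zer X Y) = X" "cd (zer X Y) = Y"
proof -
  interpret comm_group "Mor \<C> X Y" using Mor_group assms by blast
  show "arr (zer X Y)" "dm (zer X Y) = X" "cd (zer X Y) = Y"
    using mor_iff[OF assms] one_closed by auto
qed

lemma arr_add [simp]:
  assumes "arr f" "arr g" "dm g = dm f" "cd g = cd f"
  shows "arr (f \<boxplus> g)" "dm (f \<boxplus> g) = dm f" "cd (f \<boxplus> g) = cd f"
proof -
  interpret comm_group "Mor \<C> (dm f) (cd f)" using Mor_comm_group assms by blast
  have "f \<boxplus> g \<in> mor \<C> (dm f) (cd f)"
    using assms arr_def add_def by (metis m_closed)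
  then show "arr (f \<boxplus> g)" "dm (f \<boxplus> g) = dm f" "cd (f \<boxplus> g) = cd f"
    using mor_iff assms by auto
qed

lemma arr_neg [simp]:
  assumes "arr f"
  shows "arr (neg f)" "dm (neg f) = dm f" "cd (neg f) = cd f"
proof -
  interpret comm_group "Mor \<C> (dm f) (cd f)" using Mor_comm_group assms by blast
  have "neg f \<in> mor \<C> (dm f) (cd f)"
    using assms arr_def neg_def by (metis inv_closed)
  then show "arr (neg f)" "dm (neg f) = dm f" "cd (neg f) = cd f"
    using mor_iff assms by auto
qed

lemma add_assoc':
  assumes "arr f" "arr g" "arr h" "dm g = dm f" "cd g = cd f" "dm h = dm f" "cd h = cd f"
  shows "(f \<boxplus> g) \<boxplus> h = f \<boxplus> (g \<boxplus> h)"
proof -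
  interpret comm_group "Mor \<C> (dm f) (cd f)" using Mor_comm_group assms by blast
  show ?thesis using assms m_assoc arr_add[of f g] unfolding add_def arr_def by simp
qed

lemma add_comm:
  assumes "arr f" "arr g" "dm g = dm f" "cd g = cd f"
  shows "f \<boxplus> g = g \<boxplus> f"
proof -
  interpret comm_group "Mor \<C> (dm f) (cd f)" using Mor_comm_group assms by blast
  show ?thesis using assms m_comm unfolding add_def arr_def by simp
qed

lemma add_left_comm:
  assumes "arr f" "arr g" "arr h" "dm g = dm f" "cd g = cd f" "dm h = dm f" "cd h = cd f"
  shows "f \<boxplus> (g \<boxplus> h) = g \<boxplus> (f \<boxplus> h)"
  using assms by (metis add_assoc' add_comm)

lemma add_zer [simp]:
  assumes "arr f" "dm f = X" "cd f = Y"
  shows "f \<boxplus> zer X Y = f" "zer X Y \<boxplus> f = f"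
proof -
  have XY: "X \<in> obj \<C>" "Y \<in> obj \<C>" using assms by auto
  interpret comm_group "Mor \<C> X Y" using Mor_group XY by blast
  have "f \<in> mor \<C> X Y" using assms XY by (simp add: mor_iff)
  from r_one[OF this] l_one[OF this] show "f \<boxplus> zer X Y = f" "zer X Y \<boxplus> f = f"
    by (simp_all only: add_def assms(2,3) arr_zer[OF XY])
qed

lemma add_neg [simp]:
  assumes "arr f"
  shows "f \<boxplus> neg f = zer (dm f) (cd f)" "neg f \<boxplus> f = zer (dm f) (cd f)"
proof -
  interpret comm_group "Mor \<C> (dm f) (cd f)" using Mor_comm_group assms by blast
  have "f \<in> mor \<C> (dm f) (cd f)" using assms unfolding arr_def by blast
  from r_inv[OF this] l_inv[OF this]
  show "f \<boxplus> neg f = zer (dm f) (cd f)" "neg f \<boxplus> f = zer (dm f) (cd f)"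
    by (simp_all only: add_def neg_def[symmetric] arr_neg[OF assms])
qed

lemma add_neg_cancel [simp]:
  assumes "arr f" "arr g" "dm g = dm f" "cd g = cd f"
  shows "f \<boxplus> (neg f \<boxplus> g) = g" "neg f \<boxplus> (f \<boxplus> g) = g"
  using assms by (simp_all add: add_assoc'[symmetric])

lemma add_left_cancel':
  assumes "arr f" "arr g" "arr h" "dm g = dm f" "cd g = cd f" "dm h = dm f" "cd h = cd f"
    and "f \<boxplus> g = f \<boxplus> h"
  shows "g = h"
  using assms add_neg_cancel(2) by metis

lemma neg_unique:
  assumes "arr f" "arr g" "dm g = dm f" "cd g = cd f" "f \<boxplus> g = zer (dm f) (cd f)"
  shows "g = neg f"
  by (rule add_left_cancel'[of f]) (use assms in simp_all)

lemma sub_zer_iff: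
  assumes "arr f" "arr g" "dm g = dm f" "cd g = cd f"
  shows "f \<boxplus> neg g = zer (dm f) (cd f) \<longleftrightarrow> f = g"
proof
  assume *: "f \<boxplus> neg g = zer (dm f) (cd f)"
  have "neg g \<boxplus> f = f \<boxplus> neg g" using assms by (intro add_comm) simp_all
  also have "\<dots> = neg g \<boxplus> g" using assms * by simp
  finally have e: "neg g \<boxplus> f = neg g \<boxplus> g" .
  show "f = g" by (rule add_left_cancel'[OF _ _ _ _ _ _ _ e]) (simp_all add: assms)
qed (use assms in simp)

lemma cmp_add [simp]:
  assumes "arr f" "arr g" "arr h" "dm g = dm f" "cd g = cd f"
  shows "dm h = cd f \<Longrightarrow> h \<cdot> (f \<boxplus> g) = h \<cdot> f \<boxplus> h \<cdot> g"
    and "dm f = cd h \<Longrightarrow> (f \<boxplus> g) \<cdot> h = f \<cdot> h \<boxplus> g \<cdot> h"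
  using assms cmp_add_right[of "dm f" "cd f" "cd h" f g h] cmp_add_left[of "dm h" "cd h" "cd f" h f g]
  unfolding add_def by (auto simp: mor_iff)

lemma add_self_zer:
  assumes "arr f" "f \<boxplus> f = f"
  shows "f = zer (dm f) (cd f)"
  by (rule add_left_cancel'[of f]) (use assms in simp_all)

lemma cmp_zer [simp]:
  assumes "arr h"
  shows "\<lbrakk>dm h = Y; X \<in> obj \<C>\<rbrakk> \<Longrightarrow> h \<cdot> zer X Y = zer X (cd h)"
    and "\<lbrakk>cd h = X; Y \<in> obj \<C>\<rbrakk> \<Longrightarrow> zer X Y \<cdot> h = zer (dm h) Y"
proof -
  assume *: "dm h = Y" "X \<in> obj \<C>"
  then have "h \<cdot> zer X Y \<boxplus> h \<cdot> zer X Y = h \<cdot> (zer X Y \<boxplus> zer X Y)"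
    using assms by (subst cmp_add) auto
  then show "h \<cdot> zer X Y = zer X (cd h)" using add_self_zer[of "h \<cdot> zer X Y"] assms * by auto
next
  assume *: "cd h = X" "Y \<in> obj \<C>"
  then have "zer X Y \<cdot> h \<boxplus> zer X Y \<cdot> h = (zer X Y \<boxplus> zer X Y) \<cdot> h"
    using assms by (subst cmp_add) auto
  then show "zer X Y \<cdot> h = zer (dm h) Y" using add_self_zer[of "zer X Y \<cdot> h"] assms * by auto
qed

lemma cmp_neg [simp]:
  assumes "arr f" "arr h"
  shows "dm h = cd f \<Longrightarrow> h \<cdot> neg f = neg (h \<cdot> f)"
    and "dm f = cd h \<Longrightarrow> neg f \<cdot> h = neg (f \<cdot> h)"
proof -
  assume *: "dm h = cd f"
  have "h \<cdot> (f \<boxplus> neg f) = h \<cdot> f \<boxplus> h \<cdot> neg f"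
    by (rule cmp_add(1)) (simp_all add: assms *)
  then have e: "h \<cdot> f \<boxplus> h \<cdot> neg f = zer (dm f) (cd h)"
    by (simp add: assms *)
  show "h \<cdot> neg f = neg (h \<cdot> f)"
    by (rule neg_unique) (simp_all add: assms * e)
next
  assume *: "dm f = cd h"
  have "(f \<boxplus> neg f) \<cdot> h = f \<cdot> h \<boxplus> neg f \<cdot> h"
    by (rule cmp_add(2)) (simp_all add: assms *)
  then have e: "f \<cdot> h \<boxplus> neg f \<cdot> h = zer (dm h) (cd f)"
    by (simp add: assms *)
  show "neg f \<cdot> h = neg (f \<cdot> h)"
    by (rule neg_unique) (simp_all add: assms * e)
qed

lemma neg_add [simp]:
  assumes "arr f" "arr g" "dm g = dm f" "cd g = cd f"
  shows "neg (f \<boxplus> g) = neg f \<boxplus> neg g"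
proof (rule neg_unique[symmetric])
  have "f \<boxplus> g \<boxplus> (neg f \<boxplus> neg g) = f \<boxplus> (neg f \<boxplus> (g \<boxplus> neg g))"
    using assms add_assoc'[of f g] add_left_comm[of g "neg f" "neg g"] by simp
  then show "f \<boxplus> g \<boxplus> (neg f \<boxplus> neg g) = zer (dm (f \<boxplus> g)) (cd (f \<boxplus> g))"
    using assms by simp
qed (use assms in simp_all)

lemma neg_neg [simp]: "arr f \<Longrightarrow> neg (neg f) = f"
  by (rule neg_unique[symmetric]) auto

lemma neg_zer [simp]: "\<lbrakk>X \<in> obj \<C>; Y \<in> obj \<C>\<rbrakk> \<Longrightarrow> neg (zer X Y) = zer X Y"
  by (rule neg_unique[symmetric]) simp_all

text \<open>Simplification associates composites to the right, which hides an equation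
  \<open>g \<cdot> f = h\<close> inside \<open>g \<cdot> (f \<cdot> k)\<close>. This form makes it
  applicable in front of any further arrow \<open>k\<close>.\<close>

lemma cmp_reduce:
  assumes "g \<cdot> f = h" "arr f" "arr g" "dm g = cd f" "arr k" "cd k = dm f"
  shows "g \<cdot> (f \<cdot> k) = h \<cdot> k"
  using assms cmp_assoc'[of k f g] by simp

section \<open>Biproducts and matrix calculus\<close>

lemma biprodD:
  assumes "is_biprod \<C> X Y P" "X \<in> obj \<C>" "Y \<in> obj \<C>"
  shows "bobj P \<in> obj \<C>"
    "arr (in1 P)" "dm (in1 P) = X" "cd (in1 P) = bobj P"
    "arr (in2 P)" "dm (in2 P) = Y" "cd (in2 P) = bobj P"
    "arr (pr1 P)" "dm (pr1 P) = bobj P" "cd (pr1 P) = X"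
    "arr (pr2 P)" "dm (pr2 P) = bobj P" "cd (pr2 P) = Y"
    "pr1 P \<cdot> in1 P = ide \<C> X" "pr2 P \<cdot> in2 P = ide \<C> Y"
    "pr2 P \<cdot> in1 P = zer X Y" "pr1 P \<cdot> in2 P = zer Y X"
    "\<lbrakk>arr k; cd k = X\<rbrakk> \<Longrightarrow> pr1 P \<cdot> (in1 P \<cdot> k) = k"
    "\<lbrakk>arr k; cd k = Y\<rbrakk> \<Longrightarrow> pr2 P \<cdot> (in2 P \<cdot> k) = k"
    "\<lbrakk>arr k; cd k = X\<rbrakk> \<Longrightarrow> pr2 P \<cdot> (in1 P \<cdot> k) = zer (dm k) Y"
    "\<lbrakk>arr k; cd k = Y\<rbrakk> \<Longrightarrow> pr1 P \<cdot> (in2 P \<cdot> k) = zer (dm k) X"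
    "in1 P \<cdot> pr1 P \<boxplus> in2 P \<cdot> pr2 P = ide \<C> (bobj P)"
proof -
  show b: "bobj P \<in> obj \<C>" using assms by (simp add: is_biprod_def)
  show a: "arr (in1 P)" "dm (in1 P) = X" "cd (in1 P) = bobj P"
    "arr (in2 P)" "dm (in2 P) = Y" "cd (in2 P) = bobj P"
    "arr (pr1 P)" "dm (pr1 P) = bobj P" "cd (pr1 P) = X"
    "arr (pr2 P)" "dm (pr2 P) = bobj P" "cd (pr2 P) = Y"
    using assms b unfolding is_biprod_def by (simp_all add: mor_iff)
  show c: "pr1 P \<cdot> in1 P = ide \<C> X" "pr2 P \<cdot> in2 P = ide \<C> Y"
    "pr2 P \<cdot> in1 P = zer X Y" "pr1 P \<cdot> in2 P = zer Y X"
    "in1 P \<cdot> pr1 P \<boxplus> in2 P \<cdot> pr2 P = ide \<C> (bobj P)"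
    using assms a unfolding is_biprod_def add_def by simp_all
  show "\<lbrakk>arr k; cd k = X\<rbrakk> \<Longrightarrow> pr1 P \<cdot> (in1 P \<cdot> k) = k"
    "\<lbrakk>arr k; cd k = Y\<rbrakk> \<Longrightarrow> pr2 P \<cdot> (in2 P \<cdot> k) = k"
    "\<lbrakk>arr k; cd k = X\<rbrakk> \<Longrightarrow> pr2 P \<cdot> (in1 P \<cdot> k) = zer (dm k) Y"
    "\<lbrakk>arr k; cd k = Y\<rbrakk> \<Longrightarrow> pr1 P \<cdot> (in2 P \<cdot> k) = zer (dm k) X"
    using a c b assms by (simp_all add: cmp_reduce[OF c(1)] cmp_reduce[OF c(2)] cmp_reduce[OF c(3)] cmp_reduce[OF c(4)])
qed

lemma biprodI:
  assumes "X \<in> obj \<C>" "Y \<in> obj \<C>" "bobj P \<in> obj \<C>"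
    "arr (in1 P)" "dm (in1 P) = X" "cd (in1 P) = bobj P"
    "arr (in2 P)" "dm (in2 P) = Y" "cd (in2 P) = bobj P"
    "arr (pr1 P)" "dm (pr1 P) = bobj P" "cd (pr1 P) = X"
    "arr (pr2 P)" "dm (pr2 P) = bobj P" "cd (pr2 P) = Y"
    "pr1 P \<cdot> in1 P = ide \<C> X" "pr2 P \<cdot> in2 P = ide \<C> Y"
    "pr2 P \<cdot> in1 P = zer X Y" "pr1 P \<cdot> in2 P = zer Y X"
    "in1 P \<cdot> pr1 P \<boxplus> in2 P \<cdot> pr2 P = ide \<C> (bobj P)"
  shows "is_biprod \<C> X Y P"
  using assms unfolding is_biprod_def add_def by (simp add: mor_iff)

lemma biprod_ext_to:
  assumes P: "is_biprod \<C> X Y P" "X \<in> obj \<C>" "Y \<in> obj \<C>"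
    and "arr f" "arr g" "dm g = dm f" "cd f = bobj P" "cd g = bobj P"
    and "pr1 P \<cdot> f = pr1 P \<cdot> g" "pr2 P \<cdot> f = pr2 P \<cdot> g"
  shows "f = g"
proof -
  note [simp] = biprodD[OF P]
  have "f = (in1 P \<cdot> pr1 P \<boxplus> in2 P \<cdot> pr2 P) \<cdot> f"
    by (simp add: assms(4-8))
  also have "\<dots> = (in1 P \<cdot> pr1 P \<boxplus> in2 P \<cdot> pr2 P) \<cdot> g"
    using assms(4-10) by (subst (1 2) cmp_add) (simp_all)
  finally show ?thesis using assms(4-8) by simp
qed

lemma biprod_ext_from:
  assumes P: "is_biprod \<C> X Y P" "X \<in> obj \<C>" "Y \<in> obj \<C>"
    and "arr f" "arr g" "cd g = cd f" "dm f = bobj P" "dm g = bobj P"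
    and "f \<cdot> in1 P = g \<cdot> in1 P" "f \<cdot> in2 P = g \<cdot> in2 P"
  shows "f = g"
proof -
  note [simp] = biprodD[OF P]
  have "f = f \<cdot> (in1 P \<cdot> pr1 P \<boxplus> in2 P \<cdot> pr2 P)"
    by (simp add: assms(4-8))
  also have "\<dots> = g \<cdot> (in1 P \<cdot> pr1 P \<boxplus> in2 P \<cdot> pr2 P)"
    using assms(4-8) cmp_reduce[OF assms(9), of "pr1 P"] cmp_reduce[OF assms(10), of "pr2 P"]
    by (subst (1 2) cmp_add) simp_all
  finally show ?thesis using assms(4-8) by simp
qed

lemma mor_sum_eq:
  assumes "is_biprod \<C> X Y P" "X \<in> obj \<C>" "Y \<in> obj \<C>"
    and "is_biprod \<C> X' Y' Q" "X' \<in> obj \<C>" "Y' \<in> obj \<C>"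
    and "arr f" "dm f = X" "cd f = X'" "arr g" "dm g = Y" "cd g = Y'"
  shows "mor_sum \<C> P Q f g = in1 Q \<cdot> (f \<cdot> pr1 P) \<boxplus> in2 Q \<cdot> (g \<cdot> pr2 P)"
proof -
  note [simp] = biprodD[OF assms(1-3)] biprodD[OF assms(4-6)]
  show ?thesis unfolding mor_sum_def add_def using assms(7-) by simp
qed

lemma mor_sum [simp]:
  assumes "is_biprod \<C> X Y P" "X \<in> obj \<C>" "Y \<in> obj \<C>"
    and "is_biprod \<C> X' Y' Q" "X' \<in> obj \<C>" "Y' \<in> obj \<C>"
    and "arr f" "dm f = X" "cd f = X'" "arr g" "dm g = Y" "cd g = Y'"
  shows "arr (mor_sum \<C> P Q f g)" "dm (mor_sum \<C> P Q f g) = bobj P" "cd (mor_sum \<C> P Q f g) = bobj Q"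
    and "mor_sum \<C> P Q f g \<cdot> in1 P = in1 Q \<cdot> f"
    and "mor_sum \<C> P Q f g \<cdot> in2 P = in2 Q \<cdot> g"
    and "pr1 Q \<cdot> mor_sum \<C> P Q f g = f \<cdot> pr1 P"
    and "pr2 Q \<cdot> mor_sum \<C> P Q f g = g \<cdot> pr2 P"
proof -
  note [simp] = biprodD[OF assms(1-3)] biprodD[OF assms(4-6)]
  note [simp] = mor_sum_eq[OF assms]
  show "arr (mor_sum \<C> P Q f g)" "dm (mor_sum \<C> P Q f g) = bobj P" "cd (mor_sum \<C> P Q f g) = bobj Q"
    "mor_sum \<C> P Q f g \<cdot> in1 P = in1 Q \<cdot> f"
    "mor_sum \<C> P Q f g \<cdot> in2 P = in2 Q \<cdot> g"
    "pr1 Q \<cdot> mor_sum \<C> P Q f g = f \<cdot> pr1 P"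
    "pr2 Q \<cdot> mor_sum \<C> P Q f g = g \<cdot> pr2 P"
    using assms(2,3,5-) by simp_all
qed

section \<open>Isomorphisms\<close>

lemma is_isoE:
  assumes "is_iso \<C> X Y f" "X \<in> obj \<C>" "Y \<in> obj \<C>"
  obtains g where "arr f" "dm f = X" "cd f = Y" "arr g" "dm g = Y" "cd g = X"
    "g \<cdot> f = ide \<C> X" "f \<cdot> g = ide \<C> Y"
  using assms unfolding is_iso_def by (auto simp: mor_iff)

lemma is_isoI:
  assumes "arr f" "arr g" "dm g = cd f" "cd g = dm f" "g \<cdot> f = ide \<C> (dm f)" "f \<cdot> g = ide \<C> (cd f)"
  shows "is_iso \<C> (dm f) (cd f) f"
  using assms unfolding is_iso_def by (auto simp: mor_iff)

lemma is_iso_ide: "X \<in> obj \<C> \<Longrightarrow> is_iso \<C> X X (ide \<C> X)"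
  using is_isoI[of "ide \<C> X" "ide \<C> X"] by simp

lemma is_iso_inv:
  assumes "is_iso \<C> X Y f" "X \<in> obj \<C>" "Y \<in> obj \<C>"
  obtains g where "is_iso \<C> Y X g" "arr g" "dm g = Y" "cd g = X" "g \<cdot> f = ide \<C> X" "f \<cdot> g = ide \<C> Y"
  using is_isoE[OF assms] is_isoI by metis

lemma is_iso_cmp:
  assumes f: "is_iso \<C> X Y f" and g: "is_iso \<C> Y Z g" and "X \<in> obj \<C>" "Y \<in> obj \<C>" "Z \<in> obj \<C>"
  shows "is_iso \<C> X Z (g \<cdot> f)"
proof -
  obtain f' where f' [simp]: "arr f" "dm f = X" "cd f = Y" "arr f'" "dm f' = Y" "cd f' = X"
    "f' \<cdot> f = ide \<C> X" "f \<cdot> f' = ide \<C> Y"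
    using is_isoE[OF f] assms by metis
  obtain g' where g' [simp]: "arr g" "dm g = Y" "cd g = Z" "arr g'" "dm g' = Z" "cd g' = Y"
    "g' \<cdot> g = ide \<C> Y" "g \<cdot> g' = ide \<C> Z"
    using is_isoE[OF g] assms by metis
  show ?thesis
    using is_isoI[of "g \<cdot> f" "f' \<cdot> g'"]
    by (simp add: cmp_reduce[OF f'(8)] cmp_reduce[OF g'(7)])
qed

text \<open>Inverting the two composites yields a left inverse \<open>u \<cdot> b'\<close> and a
  right inverse \<open>b' \<cdot> v\<close> of \<open>b\<close>, and these must coincide.\<close>

lemma is_iso_if_both:
  assumes [simp]: "arr b" "arr b'" "dm b' = cd b" "cd b' = dm b"
    and "is_iso \<C> (dm b) (dm b) (b' \<cdot> b)" "is_iso \<C> (cd b) (cd b) (b \<cdot> b')"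
  shows "is_iso \<C> (dm b) (cd b) b"
proof -
  obtain u where u [simp]: "arr u" "dm u = dm b" "cd u = dm b" "u \<cdot> (b' \<cdot> b) = ide \<C> (dm b)"
    using is_isoE[OF assms(5)] by auto
  obtain v where v [simp]: "arr v" "dm v = cd b" "cd v = cd b" "b \<cdot> (b' \<cdot> v) = ide \<C> (cd b)"
    using is_isoE[OF assms(6)] by auto
  have "u \<cdot> b' = (u \<cdot> (b' \<cdot> b)) \<cdot> (b' \<cdot> v)"
    using v(4) by (simp del: u(4))
  also have "\<dots> = b' \<cdot> v" by simp
  finally have "b' \<cdot> v = u \<cdot> b'" by simp
  then have "(b' \<cdot> v) \<cdot> b = ide \<C> (dm b)" using u(4) by (simp del: u(4) add: u(4))
  then show ?thesis using is_isoI[of b "b' \<cdot> v"] by simp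
qed

text \<open>The inverse is \<open>1 - n\<close>: the geometric series stops after the linear
  term.\<close>

lemma unipotent_is_iso:
  assumes [simp]: "arr n" "cd n = dm n" and n2: "n \<cdot> n = zer (dm n) (dm n)"
  shows "is_iso \<C> (dm n) (dm n) (ide \<C> (dm n) \<boxplus> n)"
proof -
  have "(ide \<C> (dm n) \<boxplus> neg n) \<cdot> (ide \<C> (dm n) \<boxplus> n) = ide \<C> (dm n)"
    "(ide \<C> (dm n) \<boxplus> n) \<cdot> (ide \<C> (dm n) \<boxplus> neg n) = ide \<C> (dm n)"
    using n2 by (simp_all add: add_assoc')
  then show ?thesis
    using is_isoI[of "ide \<C> (dm n) \<boxplus> n" "ide \<C> (dm n) \<boxplus> neg n"] by simp
qed

lemma biprodE:
  assumes "X \<in> obj \<C>" "Y \<in> obj \<C>"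
  obtains P where "is_biprod \<C> X Y P"
  using assms biproducts by blast

end

section \<open>Extriangulated categories\<close>

context extriangulated_category
begin

abbreviation ez where "ez C A \<equiv> \<one>\<^bsub>Ext \<C> C A\<^esub>"

section \<open>Typing of triangles and functoriality of extensions\<close>

lemma etriD:
  assumes "etri \<C> A B C x y \<delta>"
  shows "A \<in> obj \<C>" "B \<in> obj \<C>" "C \<in> obj \<C>"
    "arr x" "dm x = A" "cd x = B" "arr y" "dm y = B" "cd y = C" "\<delta> \<in> ext \<C> C A"
    "(x, y) \<in> realiz \<C> C A \<delta>"
  using assms unfolding etri_def by (auto simp: mor_iff)

lemma etriI:
  assumes "A \<in> obj \<C>" "C \<in> obj \<C>"
    "arr x" "dm x = A" "cd x = B" "arr y" "dm y = B" "cd y = C" "\<delta> \<in> ext \<C> C A"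
    "(x, y) \<in> realiz \<C> C A \<delta>"
  shows "etri \<C> A B C x y \<delta>"
  using assms unfolding etri_def by (auto simp: mor_iff)

lemma ez_closed [simp]: "\<lbrakk>A \<in> obj \<C>; C \<in> obj \<C>\<rbrakk> \<Longrightarrow> ez C A \<in> ext \<C> C A"
  using Ext_group comm_group.axioms(2) group.is_monoid monoid.one_closed by metis

lemma emap_closed:
  assumes "arr c" "arr a" "\<delta> \<in> ext \<C> (cd c) (dm a)"
  shows "emap \<C> c a \<delta> \<in> ext \<C> (dm c) (cd a)"
  using emap_hom[of "dm a" "cd a" "cd c" "dm c" c a] assms
  by (auto simp: mor_iff hom_def Pi_def)

lemma emap_emap:
  assumes "arr c" "arr c'" "arr a" "arr a'" "cd c' = dm c" "dm a' = cd a" "\<delta> \<in> ext \<C> (cd c) (dm a)"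
  shows "emap \<C> c' a' (emap \<C> c a \<delta>) = emap \<C> (c \<cdot> c') (a' \<cdot> a) \<delta>"
  using assms emap_cmp[of "dm a" "cd a" "cd a'" "cd c" "dm c" "dm c'" c c' a a' \<delta>]
  by (simp add: mor_iff)

lemma push_closed [simp]:
  "\<lbrakk>arr a; dm a = A; cd a = A'; C \<in> obj \<C>; \<delta> \<in> ext \<C> C A\<rbrakk> \<Longrightarrow> push \<C> C a \<delta> \<in> ext \<C> C A'"
  using emap_closed[of "ide \<C> C" a \<delta>] by (auto simp: push_def)

lemma pull_closed [simp]:
  "\<lbrakk>arr c; cd c = C; dm c = C'; A \<in> obj \<C>; \<delta> \<in> ext \<C> C A\<rbrakk> \<Longrightarrow> pull \<C> A c \<delta> \<in> ext \<C> C' A"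
  using emap_closed[of c "ide \<C> A" \<delta>] by (auto simp: pull_def)

lemma push_push:
  "\<lbrakk>arr a; arr a'; dm a' = cd a; C \<in> obj \<C>; \<delta> \<in> ext \<C> C (dm a)\<rbrakk>
    \<Longrightarrow> push \<C> C a' (push \<C> C a \<delta>) = push \<C> C (a' \<cdot> a) \<delta>"
  by (simp add: push_def emap_emap)

lemma pull_pull:
  "\<lbrakk>arr c; arr c'; cd c' = dm c; A \<in> obj \<C>; \<delta> \<in> ext \<C> (cd c) A\<rbrakk>
    \<Longrightarrow> pull \<C> A c' (pull \<C> A c \<delta>) = pull \<C> A (c \<cdot> c') \<delta>"
  by (simp add: pull_def emap_emap)

lemma pull_push:
  "\<lbrakk>arr c; arr a; A' = cd a; A = dm a; C = cd c; C' = dm c; \<delta> \<in> ext \<C> (cd c) (dm a)\<rbrakk>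
    \<Longrightarrow> pull \<C> A' c (push \<C> C a \<delta>) = push \<C> C' a (pull \<C> A c \<delta>)"
  by (simp add: pull_def push_def emap_emap)

lemma emap_pull_push:
  "\<lbrakk>arr c; arr a; \<delta> \<in> ext \<C> (cd c) (dm a)\<rbrakk>
    \<Longrightarrow> emap \<C> c a \<delta> = push \<C> (dm c) a (pull \<C> (dm a) c \<delta>)"
  by (simp add: pull_def push_def emap_emap)

lemma push_ide [simp]: "\<lbrakk>A \<in> obj \<C>; C \<in> obj \<C>; \<delta> \<in> ext \<C> C A\<rbrakk> \<Longrightarrow> push \<C> C (ide \<C> A) \<delta> = \<delta>"
  by (simp add: push_def emap_ide)

lemma pull_ide [simp]: "\<lbrakk>A \<in> obj \<C>; C \<in> obj \<C>; \<delta> \<in> ext \<C> C A\<rbrakk> \<Longrightarrow> pull \<C> A (ide \<C> C) \<delta> = \<delta>"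
  by (simp add: pull_def emap_ide)

lemma emap_ez:
  assumes "arr c" "arr a"
  shows "emap \<C> c a (ez (cd c) (dm a)) = ez (dm c) (cd a)"
proof (rule hom_one)
  show "emap \<C> c a \<in> hom (Ext \<C> (cd c) (dm a)) (Ext \<C> (dm c) (cd a))"
    using emap_hom[of "dm a" "cd a" "cd c" "dm c" c a] assms by (auto simp: mor_iff)
  show "Group.group (Ext \<C> (cd c) (dm a))" "Group.group (Ext \<C> (dm c) (cd a))"
    using assms Ext_group comm_group.axioms(2) arrD by blast+
qed

lemma push_ez [simp]:
  "\<lbrakk>arr a; dm a = A; C \<in> obj \<C>\<rbrakk> \<Longrightarrow> push \<C> C a (ez C A) = ez C (cd a)"
  using emap_ez[of "ide \<C> C" a] by (auto simp: push_def)

lemma pull_ez [simp]: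
  "\<lbrakk>arr c; cd c = C; A \<in> obj \<C>\<rbrakk> \<Longrightarrow> pull \<C> A c (ez C A) = ez (dm c) A"
  using emap_ez[of c "ide \<C> A"] by (auto simp: pull_def)

lemma ext_self_ez:
  assumes "A \<in> obj \<C>" "C \<in> obj \<C>" "\<delta> \<in> ext \<C> C A" "\<delta> \<otimes>\<^bsub>Ext \<C> C A\<^esub> \<delta> = \<delta>"
  shows "\<delta> = ez C A"
proof -
  interpret comm_group "Ext \<C> C A" using Ext_group assms by blast
  show ?thesis using assms by (metis l_cancel_one)
qed

lemma push_zer [simp]:
  assumes "A \<in> obj \<C>" "A' \<in> obj \<C>" "C \<in> obj \<C>" "\<delta> \<in> ext \<C> C A"
  shows "push \<C> C (zer A A') \<delta> = ez C A'"
proof (rule ext_self_ez)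
  have "push \<C> C (zer A A' \<boxplus> zer A A') \<delta> = push \<C> C (zer A A') \<delta> \<otimes>\<^bsub>Ext \<C> C A'\<^esub> push \<C> C (zer A A') \<delta>"
    unfolding push_def add_def
    using emap_add_right[of A A' C C "ide \<C> C" "zer A A'" "zer A A'" \<delta>] assms by (simp add: mor_iff)
  then show "push \<C> C (zer A A') \<delta> \<otimes>\<^bsub>Ext \<C> C A'\<^esub> push \<C> C (zer A A') \<delta> = push \<C> C (zer A A') \<delta>"
    using assms by simp
qed (use assms in simp_all)

lemma pull_zer [simp]:
  assumes "A \<in> obj \<C>" "C' \<in> obj \<C>" "C \<in> obj \<C>" "\<delta> \<in> ext \<C> C A"
  shows "pull \<C> A (zer C' C) \<delta> = ez C' A"
proof (rule ext_self_ez)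
  have "pull \<C> A (zer C' C \<boxplus> zer C' C) \<delta> = pull \<C> A (zer C' C) \<delta> \<otimes>\<^bsub>Ext \<C> C' A\<^esub> pull \<C> A (zer C' C) \<delta>"
    unfolding pull_def add_def
    using emap_add_left[of A A C C' "zer C' C" "zer C' C" "ide \<C> A" \<delta>] assms by (simp add: mor_iff)
  then show "pull \<C> A (zer C' C) \<delta> \<otimes>\<^bsub>Ext \<C> C' A\<^esub> pull \<C> A (zer C' C) \<delta> = pull \<C> A (zer C' C) \<delta>"
    using assms by simp
qed (use assms in simp_all)

section \<open>Equivalence of sequences and comparison of realizations\<close>

lemma seqs_iff:
  assumes "A \<in> obj \<C>" "C \<in> obj \<C>"
  shows "(x, y) \<in> seqs \<C> A C \<longleftrightarrow> arr x \<and> dm x = A \<and> arr y \<and> dm y = cd x \<and> cd y = C"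
  using assms unfolding seqs_def by (auto simp: mor_iff)

text \<open>Axiom (ET1) only places realizations in a quotient. That the relation is an equivalence
  must be checked before two realizations of one extension can be compared.\<close>

lemma seq_equiv_refl:
  assumes "A \<in> obj \<C>" "C \<in> obj \<C>" "(x, y) \<in> seqs \<C> A C"
  shows "((x, y), (x, y)) \<in> seq_equiv \<C> A C"
proof -
  have "arr x" "dm x = A" "arr y" "dm y = cd x" "cd y = C" using assms seqs_iff by auto
  then show ?thesis
    using assms is_iso_ide[of "cd x"] unfolding seq_equiv_def by auto
qed

lemma seq_equiv_sym:
  assumes "A \<in> obj \<C>" "C \<in> obj \<C>" "((x, y), (x', y')) \<in> seq_equiv \<C> A C"
  shows "((x', y'), (x, y)) \<in> seq_equiv \<C> A C"
proof -
  obtain b where b: "(x, y) \<in> seqs \<C> A C" "(x', y') \<in> seqs \<C> A C"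
    "is_iso \<C> (cd x) (cd x') b" "b \<cdot> x = x'" "y' \<cdot> b = y"
    using assms unfolding seq_equiv_def by auto
  have xy [simp]: "arr x" "dm x = A" "arr y" "dm y = cd x" "cd y = C"
    "arr x'" "dm x' = A" "arr y'" "dm y' = cd x'" "cd y' = C"
    using assms b(1,2) seqs_iff by auto
  obtain c where c: "is_iso \<C> (cd x') (cd x) c" and [simp]: "arr c" "dm c = cd x'" "cd c = cd x"
    and cb: "c \<cdot> b = ide \<C> (cd x)" "b \<cdot> c = ide \<C> (cd x')"
    using is_iso_inv[OF b(3)] by auto
  have [simp]: "arr b" "dm b = cd x" "cd b = cd x'"
    using is_isoE[OF b(3)] by auto
  have "c \<cdot> (b \<cdot> x) = x" "(y' \<cdot> b) \<cdot> c = y'" by (simp_all add: cmp_reduce[OF cb(1)] cb(2))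
  then have "c \<cdot> x' = x" "y \<cdot> c = y'" unfolding b(4,5) by -
  then show ?thesis using b(1,2) c unfolding seq_equiv_def by blast
qed

lemma seq_equiv_trans:
  assumes "A \<in> obj \<C>" "C \<in> obj \<C>" "((x, y), (x', y')) \<in> seq_equiv \<C> A C"
    "((x', y'), (x'', y'')) \<in> seq_equiv \<C> A C"
  shows "((x, y), (x'', y'')) \<in> seq_equiv \<C> A C"
proof -
  obtain b where b: "(x, y) \<in> seqs \<C> A C" "(x', y') \<in> seqs \<C> A C"
    "is_iso \<C> (cd x) (cd x') b" "b \<cdot> x = x'" "y' \<cdot> b = y"
    using assms unfolding seq_equiv_def by auto
  obtain c where c: "(x'', y'') \<in> seqs \<C> A C"
    "is_iso \<C> (cd x') (cd x'') c" "c \<cdot> x' = x''" "y'' \<cdot> c = y'"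
    using assms unfolding seq_equiv_def by auto
  have [simp]: "arr x" "dm x = A" "arr y" "dm y = cd x" "cd y = C"
    "arr x'" "dm x' = A" "arr y'" "dm y' = cd x'" "cd y' = C"
    "arr x''" "dm x'' = A" "arr y''" "dm y'' = cd x''" "cd y'' = C"
    using assms b(1,2) c(1) seqs_iff by auto
  have [simp]: "arr b" "dm b = cd x" "cd b = cd x'" "arr c" "dm c = cd x'" "cd c = cd x''"
    using is_isoE[OF b(3)] is_isoE[OF c(2)] by auto
  have "is_iso \<C> (cd x) (cd x'') (c \<cdot> b)" using is_iso_cmp[OF b(3) c(2)] by simp
  moreover have "c \<cdot> b \<cdot> x = x''" "y'' \<cdot> (c \<cdot> b) = y"
    using b c by (simp_all add: cmp_reduce[OF c(4)])
  ultimately show ?thesis using b(1) c(1) unfolding seq_equiv_def by blast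
qed

lemma realiz_obtain:
  assumes "A \<in> obj \<C>" "C \<in> obj \<C>" "\<delta> \<in> ext \<C> C A"
  obtains x y where "(x, y) \<in> seqs \<C> A C" "realiz \<C> C A \<delta> = seq_equiv \<C> A C `` {(x, y)}"
  using realiz_class[OF assms] unfolding quotient_def by auto

lemma realization_exists:
  assumes "A \<in> obj \<C>" "C \<in> obj \<C>" "\<delta> \<in> ext \<C> C A"
  obtains B x y where "etri \<C> A B C x y \<delta>"
proof -
  obtain x y where xy: "(x, y) \<in> seqs \<C> A C" "realiz \<C> C A \<delta> = seq_equiv \<C> A C `` {(x, y)}"
    using realiz_obtain[OF assms] .
  then have "(x, y) \<in> realiz \<C> C A \<delta>" using seq_equiv_refl assms by auto
  then have "etri \<C> A (cd x) C x y \<delta>"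
    using xy assms by (intro etriI) (auto simp: seqs_iff)
  then show ?thesis by (rule that)
qed

lemma realization_unique:
  assumes t: "etri \<C> A B C x y \<delta>" and t': "etri \<C> A B' C x' y' \<delta>"
  obtains b where "is_iso \<C> B B' b" "b \<cdot> x = x'" "y' \<cdot> b = y"
proof -
  note d = etriD[OF t] and d' = etriD[OF t']
  obtain x0 y0 where "realiz \<C> C A \<delta> = seq_equiv \<C> A C `` {(x0, y0)}"
    using realiz_obtain[OF d(1,3,10)] .
  then have "((x0, y0), (x, y)) \<in> seq_equiv \<C> A C" "((x0, y0), (x', y')) \<in> seq_equiv \<C> A C"
    using d(11) d'(11) by auto
  then have "((x, y), (x', y')) \<in> seq_equiv \<C> A C"
    using seq_equiv_sym seq_equiv_trans d(1,3) by metis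
  then show ?thesis using that d(6) d'(6) unfolding seq_equiv_def by auto
qed

lemma realization_transport:
  assumes t: "etri \<C> A B C x y \<delta>" and b: "is_iso \<C> B B' b" "B' \<in> obj \<C>" "b \<cdot> x = x'" "y' \<cdot> b = y"
    and y': "arr y'" "dm y' = B'" "cd y' = C"
  shows "etri \<C> A B' C x' y' \<delta>"
proof -
  note d [simp] = etriD[OF t] and y' [simp]
  have [simp]: "arr b" "dm b = B" "cd b = B'" using is_isoE[OF b(1)] b(2) by auto
  have [simp]: "arr x'" "dm x' = A" "cd x' = B'" using arr_cmp[of x b] by (simp_all add: b(3))
  obtain x0 y0 where e: "realiz \<C> C A \<delta> = seq_equiv \<C> A C `` {(x0, y0)}"
    using realiz_obtain[OF d(1,3,10)] .
  then have "((x0, y0), (x, y)) \<in> seq_equiv \<C> A C"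
    using d(11) by auto
  moreover have "((x, y), (x', y')) \<in> seq_equiv \<C> A C"
    unfolding seq_equiv_def using b by (auto simp: seqs_iff)
  ultimately have "((x0, y0), (x', y')) \<in> seq_equiv \<C> A C"
    using seq_equiv_trans d(1,3) by metis
  then show ?thesis using e by (intro etriI) auto
qed

section \<open>Morphisms of extensions in terms of typed arrows\<close>

lemma ext_mor_iff:
  assumes "etri \<C> A B C x y \<delta>" "etri \<C> A' B' C' x' y' \<delta>'"
  shows "ext_mor \<C> A C \<delta> A' C' \<delta>' a c \<longleftrightarrow>
    arr a \<and> dm a = A \<and> cd a = A' \<and> arr c \<and> dm c = C \<and> cd c = C' \<and> push \<C> C a \<delta> = pull \<C> A' c \<delta>'"
  using etriD[OF assms(1)] etriD[OF assms(2)] unfolding ext_mor_def by (auto simp: mor_iff)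

lemma ET2_arr:
  assumes "etri \<C> A B C x y \<delta>" "etri \<C> A' B' C' x' y' \<delta>'"
    "arr a" "dm a = A" "cd a = A'" "arr c" "dm c = C" "cd c = C'" "push \<C> C a \<delta> = pull \<C> A' c \<delta>'"
  obtains b where "arr b" "dm b = B" "cd b = B'" "b \<cdot> x = x' \<cdot> a" "y' \<cdot> b = c \<cdot> y"
  using realiz_mor[OF assms(1,2)] assms(3-) ext_mor_iff[OF assms(1,2)] etriD[OF assms(1)] etriD[OF assms(2)]
  by (metis mor_iff)

lemma ET3_arr:
  assumes "etri \<C> A B C x y \<delta>" "etri \<C> A' B' C' x' y' \<delta>'"
    "arr a" "dm a = A" "cd a = A'" "arr b" "dm b = B" "cd b = B'" "b \<cdot> x = x' \<cdot> a"
  obtains c where "arr c" "dm c = C" "cd c = C'" "c \<cdot> y = y' \<cdot> b" "push \<C> C a \<delta> = pull \<C> A' c \<delta>'"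
proof -
  have "a \<in> mor \<C> A A'" "b \<in> mor \<C> B B'"
    using assms(3-) etriD[OF assms(1)] etriD[OF assms(2)] by (simp_all add: mor_iff)
  from ET3[OF assms(1,2) this assms(9)] show ?thesis
    using that ext_mor_iff[OF assms(1,2)] by blast
qed

lemma ET3_op_arr:
  assumes "etri \<C> A B C x y \<delta>" "etri \<C> A' B' C' x' y' \<delta>'"
    "arr c" "dm c = C" "cd c = C'" "arr b" "dm b = B" "cd b = B'" "c \<cdot> y = y' \<cdot> b"
  obtains a where "arr a" "dm a = A" "cd a = A'" "b \<cdot> x = x' \<cdot> a" "push \<C> C a \<delta> = pull \<C> A' c \<delta>'"
proof -
  have "c \<in> mor \<C> C C'" "b \<in> mor \<C> B B'"
    using assms(3-) etriD[OF assms(1)] etriD[OF assms(2)] by (simp_all add: mor_iff)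
  from ET3_op[OF assms(1,2) this(2,1) assms(9)] show ?thesis
    using that ext_mor_iff[OF assms(1,2)] by blast
qed

section \<open>Split triangles, trivial triangles and their consequences\<close>

lemma split_etri:
  assumes "is_biprod \<C> A C P" "A \<in> obj \<C>" "C \<in> obj \<C>"
  shows "etri \<C> A (bobj P) C (in1 P) (pr2 P) (ez C A)"
  using realiz_zero[OF assms(2,3,1)] biprodD[OF assms] assms by (intro etriI) auto

text \<open>Stated as an equation rather than by the universal property, so that arrows through
  \<open>Z\<close> simplify to zero.\<close>

definition is_zero where
  "is_zero Z \<longleftrightarrow> Z \<in> obj \<C> \<and> ide \<C> Z = zer Z Z"

lemma zero_exists: obtains Z where "is_zero Z"
proof -
  obtain Z where Z: "Z \<in> obj \<C>" "\<forall>A \<in> obj \<C>. (\<exists>!f. f \<in> mor \<C> Z A) \<and> (\<exists>!f. f \<in> mor \<C> A Z)"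
    using zero_object by blast
  have "ide \<C> Z \<in> mor \<C> Z Z" "zer Z Z \<in> mor \<C> Z Z" using Z(1) by (simp_all add: mor_iff)
  then have "ide \<C> Z = zer Z Z" using Z by blast
  then show ?thesis using that Z(1) by (simp add: is_zero_def)
qed

lemma is_zeroD [simp]:
  assumes "is_zero Z"
  shows "Z \<in> obj \<C>" "ide \<C> Z = zer Z Z"
  using assms by (simp_all add: is_zero_def)

text \<open>With \<open>B\<close> itself as the underlying object, a sum with a trivial triangle
  leaves the other objects literally unchanged instead of up to isomorphism.\<close>

lemma zero_biprod:
  assumes "is_zero Z" "B \<in> obj \<C>"
  shows "is_biprod \<C> Z B \<lparr>bobj = B, in1 = zer Z B, in2 = ide \<C> B, pr1 = zer B Z, pr2 = ide \<C> B\<rparr>"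
    "is_biprod \<C> B Z \<lparr>bobj = B, in1 = ide \<C> B, in2 = zer Z B, pr1 = ide \<C> B, pr2 = zer B Z\<rparr>"
  using assms by (auto intro!: biprodI)

lemma zero_etri:
  assumes "is_zero Z" "B \<in> obj \<C>"
  shows "etri \<C> Z B B (zer Z B) (ide \<C> B) (ez B Z)"
    "etri \<C> B B Z (ide \<C> B) (zer B Z) (ez Z B)"
  using split_etri[OF zero_biprod(1)[OF assms]] split_etri[OF zero_biprod(2)[OF assms]] assms by simp_all

text \<open>The identity of \<open>A\<close> and \<open>x\<close> start a morphism from the trivial
  triangle \<open>A \<rightarrow> A \<rightarrow> Z\<close>; by (ET3) the composite
  \<open>y \<cdot> x\<close> passes through \<open>Z\<close>.\<close>

lemma etri_cmp_zer:
  assumes t: "etri \<C> A B C x y \<delta>"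
  shows "y \<cdot> x = zer A C"
proof -
  note [simp] = etriD[OF t]
  obtain Z where Z: "is_zero Z" using zero_exists .
  obtain c where "arr c" "dm c = Z" "cd c = C" "c \<cdot> zer A Z = y \<cdot> x"
    by (rule ET3_arr[OF zero_etri(2)[OF Z etriD(1)[OF t]] t, of "ide \<C> A" x]) simp_all
  then show ?thesis by simp
qed

text \<open>Compare with the trivial triangle \<open>Z \<rightarrow> W \<rightarrow> W\<close>,
  where \<open>W\<close> is the codomain of \<open>h\<close>: the third component supplied by (ET3)
  is the factor. Nothing makes it unique.\<close>

lemma weak_cokernel:
  assumes t: "etri \<C> A B C x y \<delta>" and h: "arr h" "dm h = B" "h \<cdot> x = zer A (cd h)"
  obtains k where "arr k" "dm k = C" "cd k = cd h" "k \<cdot> y = h"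
proof -
  note [simp] = etriD[OF t] h
  obtain Z where Z: "is_zero Z" using zero_exists .
  obtain c where "arr c" "dm c = C" "cd c = cd h" "c \<cdot> y = ide \<C> (cd h) \<cdot> h"
    by (rule ET3_arr[OF t zero_etri(1)[OF Z arrD(2)[OF h(1)]], of "zer A Z" h]) (simp_all add: Z)
  then show ?thesis using that by simp
qed

lemma weak_kernel:
  assumes t: "etri \<C> A B C x y \<delta>" and h: "arr h" "cd h = B" "y \<cdot> h = zer (dm h) C"
  obtains k where "arr k" "dm k = dm h" "cd k = A" "x \<cdot> k = h"
proof -
  note [simp] = etriD[OF t] h
  obtain Z where Z: "is_zero Z" using zero_exists .
  have "\<exists>k. arr k \<and> dm k = dm h \<and> cd k = A \<and> h \<cdot> ide \<C> (dm h) = x \<cdot> k"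
    by (rule ET3_op_arr[OF zero_etri(2)[OF Z arrD(1)[OF h(1)]] t, of "zer Z C" h])
       (blast | simp add: Z)+
  then obtain k where "arr k" "dm k = dm h" "cd k = A" "h \<cdot> ide \<C> (dm h) = x \<cdot> k"
    by blast
  moreover have "h \<cdot> ide \<C> (dm h) = h" by simp
  ultimately show ?thesis using that by metis
qed

text \<open>The arrows \<open>ide B\<close> and \<open>y\<close> end a morphism from the trivial
  triangle \<open>Z \<rightarrow> B \<rightarrow> B\<close>. By the dual of (ET3) the pullback of
  \<delta> along \<open>y\<close> is a pushout of the zero extension.\<close>

lemma pull_deflation:
  assumes t: "etri \<C> A B C x y \<delta>"
  shows "pull \<C> A y \<delta> = ez B A"
proof -
  note [simp] = etriD[OF t]
  obtain Z where Z: "is_zero Z" using zero_exists .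
  obtain c where "arr c" "dm c = Z" "cd c = A" "push \<C> B c (ez B Z) = pull \<C> A y \<delta>"
    by (rule ET3_op_arr[OF zero_etri(1)[OF Z etriD(2)[OF t]] t, of y "ide \<C> B"]) simp_all
  then show ?thesis by simp
qed

text \<open>This is exactness of \<open>\<C>(P,C) \<rightarrow> E(P,A) \<rightarrow> E(P,B)\<close>
  in the middle. Since the pushout splits, the realization of \<theta> maps to a split triangle over
  \<open>x\<close>; the \<open>B\<close>-component of that map starts a morphism of triangles that
  is the identity on \<open>A\<close>, and its third component is \<open>h\<close>.\<close>

lemma push_inflation_kernel:
  assumes t: "etri \<C> A B C x y \<delta>" and th: "\<theta> \<in> ext \<C> P A" "P \<in> obj \<C>" "push \<C> P x \<theta> = ez P B"
  obtains h where "arr h" "dm h = P" "cd h = C" "\<theta> = pull \<C> A h \<delta>"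
proof -
  note [simp] = etriD[OF t] th
  obtain N i p where s: "etri \<C> A N P i p \<theta>" using realization_exists[of A P \<theta>] by auto
  obtain Q where Q: "is_biprod \<C> B P Q" using biprodE[of B P] by auto
  note [simp] = etriD[OF s] biprodD[OF Q etriD(2)[OF t] th(2)]
  obtain b where b [simp]: "arr b" "dm b = N" "cd b = bobj Q" "b \<cdot> i = in1 Q \<cdot> x"
    by (rule ET2_arr[OF s split_etri[OF Q], of x "ide \<C> P"]) simp_all
  obtain h where "arr h" "dm h = P" "cd h = C" "push \<C> P (ide \<C> A) \<theta> = pull \<C> A h \<delta>"
    by (rule ET3_arr[OF s t, of "ide \<C> A" "pr1 Q \<cdot> b"]) simp_all
  then show ?thesis using that by simp
qed

text \<open>The difference \<open>b - 1\<close> factors through \<open>y\<close> and is killed by \<open>y\<close>, so it squares to zero.\<close>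

lemma etri_endo_is_iso:
  assumes t: "etri \<C> A B C x y \<delta>" and b: "arr b" "dm b = B" "cd b = B" "b \<cdot> x = x" "y \<cdot> b = y"
  shows "is_iso \<C> B B b"
proof -
  note [simp] = etriD[OF t] b
  let ?n = "b \<boxplus> neg (ide \<C> B)"
  obtain m where m: "arr m" "dm m = C" "cd m = B" "m \<cdot> y = ?n"
    by (rule weak_cokernel[OF t, of ?n]) simp_all
  have "?n \<cdot> ?n = m \<cdot> (y \<cdot> ?n)" using m cmp_assoc'[of ?n y m] by (simp del: cmp_add)
  also have "\<dots> = zer B B" using m by simp
  finally have "is_iso \<C> B B (ide \<C> B \<boxplus> ?n)" using unipotent_is_iso[of ?n] by (simp del: cmp_add)
  moreover have "ide \<C> B \<boxplus> ?n = b" using add_left_comm[of "ide \<C> B" b "neg (ide \<C> B)"] by simp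
  ultimately show ?thesis by simp
qed

text \<open>Equivalence of sequences fixes both end terms, so exchanging \<open>A\<close> for an
  isomorphic object needs an argument. (ET2) gives comparison maps both ways; their composites are
  endomorphisms of triangles fixing the ends, hence invertible.\<close>

lemma etri_iso_left:
  assumes t: "etri \<C> A B C x y \<delta>"
    and a: "arr a" "dm a = A'" "cd a = A" "arr a'" "dm a' = A" "cd a' = A'"
      "a \<cdot> a' = ide \<C> A" "a' \<cdot> a = ide \<C> A'"
  shows "etri \<C> A' B C (x \<cdot> a) y (push \<C> C a' \<delta>)"
proof -
  have A': "A' \<in> obj \<C>" using a by auto
  note [simp] = etriD[OF t] a A'
  obtain B' x' y' where s: "etri \<C> A' B' C x' y' (push \<C> C a' \<delta>)"
    using realization_exists[of A' C "push \<C> C a' \<delta>"] by auto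
  note [simp] = etriD[OF s]
  obtain b where b: "arr b" "dm b = B" "cd b = B'" "b \<cdot> x = x' \<cdot> a'" "y' \<cdot> b = ide \<C> C \<cdot> y"
    by (rule ET2_arr[OF t s, of a' "ide \<C> C"]) simp_all
  obtain b' where b': "arr b'" "dm b' = B'" "cd b' = B" "b' \<cdot> x' = x \<cdot> a" "y \<cdot> b' = ide \<C> C \<cdot> y'"
    by (rule ET2_arr[OF s t, of a "ide \<C> C"]) (simp_all add: push_push)
  note [simp] = b(1-3) b'(1-3)
  have b5: "y' \<cdot> b = y" and b5': "y \<cdot> b' = y'" using b b' by simp_all
  have "is_iso \<C> B B (b' \<cdot> b)"
    by (rule etri_endo_is_iso[OF t]) (simp_all add: b(4) b5 cmp_reduce[OF b'(4)] cmp_reduce[OF b5'])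
  moreover have "is_iso \<C> B' B' (b \<cdot> b')"
    by (rule etri_endo_is_iso[OF s]) (simp_all add: b'(4) b5' cmp_reduce[OF b(4)] cmp_reduce[OF b5])
  ultimately have "is_iso \<C> B' B b'" using is_iso_if_both[of b' b] by simp
  then show ?thesis
    by (rule realization_transport[OF s]) (simp_all add: b' b5')
qed

end

section \<open>Exactness of morphism groups\<close>

context additive_category
begin

lemma precomp_hom:
  assumes "arr u" "W \<in> obj \<C>"
  shows "group_hom (Mor \<C> (cd u) W) (Mor \<C> (dm u) W) (\<lambda>f. f \<cdot> u)"
proof -
  have "(\<lambda>f. f \<cdot> u) \<in> hom (Mor \<C> (cd u) W) (Mor \<C> (dm u) W)"
    using assms cmp_add_left[of "dm u" "cd u" W u] by (auto simp: hom_def mor_iff)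
  then show ?thesis
    using assms Mor_group comm_group.axioms(2) arrD unfolding group_hom_def group_hom_axioms_def by blast
qed

lemma postcomp_hom:
  assumes "arr u" "W \<in> obj \<C>"
  shows "group_hom (Mor \<C> W (dm u)) (Mor \<C> W (cd u)) (\<lambda>f. u \<cdot> f)"
proof -
  have "(\<lambda>f. u \<cdot> f) \<in> hom (Mor \<C> W (dm u)) (Mor \<C> W (cd u))"
    using assms cmp_add_right[of W "dm u" "cd u"] by (auto simp: hom_def mor_iff)
  then show ?thesis
    using assms Mor_group comm_group.axioms(2) arrD unfolding group_hom_def group_hom_axioms_def by blast
qed

text \<open>For an \<open>\<bbbE>\<close>-triangle the sequences of morphism groups are always exact in the middle, so
  \<open>contra_exact\<close> and \<open>cov_exact\<close> reduce to conditions at the two ends.\<close>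

definition cexact where
  "cexact W x y \<longleftrightarrow>
     (\<forall>h. arr h \<and> dm h = dm x \<and> cd h = W \<longrightarrow> (\<exists>k. arr k \<and> dm k = cd x \<and> cd k = W \<and> k \<cdot> x = h)) \<and>
     (\<forall>w. arr w \<and> dm w = cd y \<and> cd w = W \<and> w \<cdot> y = zer (dm y) W \<longrightarrow> w = zer (cd y) W)"

definition vexact where
  "vexact W x y \<longleftrightarrow>
     (\<forall>h. arr h \<and> dm h = W \<and> cd h = cd y \<longrightarrow> (\<exists>k. arr k \<and> dm k = W \<and> cd k = dm y \<and> y \<cdot> k = h)) \<and>
     (\<forall>w. arr w \<and> dm w = W \<and> cd w = dm x \<and> x \<cdot> w = zer W (cd x) \<longrightarrow> w = zer W (dm x))"

lemma cexactI:
  assumes "\<And>h. \<lbrakk>arr h; dm h = dm x; cd h = W\<rbrakk> \<Longrightarrow> \<exists>k. arr k \<and> dm k = cd x \<and> cd k = W \<and> k \<cdot> x = h"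
    and "\<And>w. \<lbrakk>arr w; dm w = cd y; cd w = W; w \<cdot> y = zer (dm y) W\<rbrakk> \<Longrightarrow> w = zer (cd y) W"
  shows "cexact W x y"
  using assms unfolding cexact_def by blast

lemma cexact_extend:
  assumes "cexact W x y" "arr h" "dm h = dm x" "cd h = W"
  obtains k where "arr k" "dm k = cd x" "cd k = W" "k \<cdot> x = h"
  using assms unfolding cexact_def by blast

lemma cexact_mono:
  assumes "cexact W x y" "arr w" "dm w = cd y" "cd w = W" "w \<cdot> y = zer (dm y) W"
  shows "w = zer (cd y) W"
  using assms unfolding cexact_def by blast

lemma vexactI:
  assumes "\<And>h. \<lbrakk>arr h; dm h = W; cd h = cd y\<rbrakk> \<Longrightarrow> \<exists>k. arr k \<and> dm k = W \<and> cd k = dm y \<and> y \<cdot> k = h"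
    and "\<And>w. \<lbrakk>arr w; dm w = W; cd w = dm x; x \<cdot> w = zer W (cd x)\<rbrakk> \<Longrightarrow> w = zer W (dm x)"
  shows "vexact W x y"
  using assms unfolding vexact_def by blast

lemma vexact_lift:
  assumes "vexact W x y" "arr h" "dm h = W" "cd h = cd y"
  obtains k where "arr k" "dm k = W" "cd k = dm y" "y \<cdot> k = h"
  using assms unfolding vexact_def by blast

lemma vexact_mono:
  assumes "vexact W x y" "arr w" "dm w = W" "cd w = dm x" "x \<cdot> w = zer W (cd x)"
  shows "w = zer W (dm x)"
  using assms unfolding vexact_def by blast

text \<open>Both conditions can be tested after the projections \<open>pr1\<close> and
  \<open>pr2\<close>.\<close>

lemma cexact_biprod:
  assumes 1: "cexact W x y" and 2: "cexact W' x y"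
    and Q: "is_biprod \<C> W W' Q" "W \<in> obj \<C>" "W' \<in> obj \<C>"
    and xy: "arr x" "arr y"
  shows "cexact (bobj Q) x y"
proof (rule cexactI)
  note [simp] = biprodD[OF Q] xy
  fix h assume h [simp]: "arr h" "dm h = dm x" "cd h = bobj Q"
  obtain k where k [simp]: "arr k" "dm k = cd x" "cd k = W" "k \<cdot> x = pr1 Q \<cdot> h"
    by (rule cexact_extend[OF 1, of "pr1 Q \<cdot> h"]) simp_all
  obtain k' where k' [simp]: "arr k'" "dm k' = cd x" "cd k' = W'" "k' \<cdot> x = pr2 Q \<cdot> h"
    by (rule cexact_extend[OF 2, of "pr2 Q \<cdot> h"]) simp_all
  have "(in1 Q \<cdot> k \<boxplus> in2 Q \<cdot> k') \<cdot> x = h"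
    by (rule biprod_ext_to[OF Q]) simp_all
  moreover have "arr (in1 Q \<cdot> k \<boxplus> in2 Q \<cdot> k')" "dm (in1 Q \<cdot> k \<boxplus> in2 Q \<cdot> k') = cd x"
    "cd (in1 Q \<cdot> k \<boxplus> in2 Q \<cdot> k') = bobj Q" by simp_all
  ultimately show "\<exists>k. arr k \<and> dm k = cd x \<and> cd k = bobj Q \<and> k \<cdot> x = h" by blast
next
  note [simp] = biprodD[OF Q] xy
  fix w assume w [simp]: "arr w" "dm w = cd y" "cd w = bobj Q" "w \<cdot> y = zer (dm y) (bobj Q)"
  have p: "pr1 Q \<cdot> w = zer (cd y) W" "pr2 Q \<cdot> w = zer (cd y) W'"
    by (rule cexact_mono[OF 1] cexact_mono[OF 2]; simp)+
  show "w = zer (cd y) (bobj Q)"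
    by (rule biprod_ext_to[OF Q]) (simp_all add: p)
qed

lemma vexact_sum:
  assumes 1: "vexact W x y" and 2: "vexact W x' y'" and W: "W \<in> obj \<C>"
    and xy: "arr x" "dm x = A" "cd x = B" "arr y" "dm y = B" "cd y = C"
    and xy': "arr x'" "dm x' = A'" "cd x' = B'" "arr y'" "dm y' = B'" "cd y' = C'"
    and P: "is_biprod \<C> A A' P" and Q: "is_biprod \<C> B B' Q" and R: "is_biprod \<C> C C' R"
  shows "vexact W (mor_sum \<C> P Q x x') (mor_sum \<C> Q R y y')"
proof -
  have obs [simp]: "A \<in> obj \<C>" "B \<in> obj \<C>" "C \<in> obj \<C>" "A' \<in> obj \<C>" "B' \<in> obj \<C>" "C' \<in> obj \<C>"
    using xy xy' by auto
  note [simp] = W xy xy' biprodD[OF P obs(1,4)] biprodD[OF Q obs(2,5)] biprodD[OF R obs(3,6)]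
  note sx = mor_sum[OF P obs(1,4) Q obs(2,5) xy(1-3) xy'(1-3)]
  note sy = mor_sum[OF Q obs(2,5) R obs(3,6) xy(4-6) xy'(4-6)]
  note [simp] = sx sy
  show ?thesis
  proof (rule vexactI)
    fix h assume h [simp]: "arr h" "dm h = W" "cd h = cd (mor_sum \<C> Q R y y')"
    obtain k where k [simp]: "arr k" "dm k = W" "cd k = B" "y \<cdot> k = pr1 R \<cdot> h"
      by (rule vexact_lift[OF 1, of "pr1 R \<cdot> h"]) simp_all
    obtain k' where k' [simp]: "arr k'" "dm k' = W" "cd k' = B'" "y' \<cdot> k' = pr2 R \<cdot> h"
      by (rule vexact_lift[OF 2, of "pr2 R \<cdot> h"]) simp_all
    have "mor_sum \<C> Q R y y' \<cdot> (in1 Q \<cdot> k \<boxplus> in2 Q \<cdot> k') = h"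
      by (rule biprod_ext_to[OF R])
         (simp_all add: cmp_reduce[OF sy(4)] cmp_reduce[OF sy(5)])
    moreover have "arr (in1 Q \<cdot> k \<boxplus> in2 Q \<cdot> k')" "dm (in1 Q \<cdot> k \<boxplus> in2 Q \<cdot> k') = W"
      "cd (in1 Q \<cdot> k \<boxplus> in2 Q \<cdot> k') = dm (mor_sum \<C> Q R y y')" by simp_all
    ultimately show "\<exists>k. arr k \<and> dm k = W \<and> cd k = dm (mor_sum \<C> Q R y y') \<and> mor_sum \<C> Q R y y' \<cdot> k = h"
      by blast
  next
    fix w assume w: "arr w" "dm w = W" "cd w = dm (mor_sum \<C> P Q x x')"
      "mor_sum \<C> P Q x x' \<cdot> w = zer W (cd (mor_sum \<C> P Q x x'))"
    note [simp] = w
    have "x \<cdot> (pr1 P \<cdot> w) = pr1 Q \<cdot> (mor_sum \<C> P Q x x' \<cdot> w)"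
      by (subst cmp_reduce[OF sx(6)]) simp_all
    then have p1: "pr1 P \<cdot> w = zer W A" using vexact_mono[OF 1, of "pr1 P \<cdot> w"] by simp
    have "x' \<cdot> (pr2 P \<cdot> w) = pr2 Q \<cdot> (mor_sum \<C> P Q x x' \<cdot> w)"
      by (subst cmp_reduce[OF sx(7)]) simp_all
    then have p2: "pr2 P \<cdot> w = zer W A'" using vexact_mono[OF 2, of "pr2 P \<cdot> w"] by simp
    show "w = zer W (dm (mor_sum \<C> P Q x x'))"
      by (rule biprod_ext_to[OF P]) (simp_all add: p1 p2)
  qed
qed

end

context extriangulated_category
begin

section \<open>Translation of short exact sequences into conditions on arrows\<close>

lemma group_hom_mon_iff:
  assumes "group_hom G H f"
  shows "f \<in> mon G H \<longleftrightarrow> (\<forall>a \<in> carrier G. f a = \<one>\<^bsub>H\<^esub> \<longrightarrow> a = \<one>\<^bsub>G\<^esub>)"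
  using group_hom.inj_on_one_iff[OF assms] assms
  unfolding mon_def group_hom_def group_hom_axioms_def by auto

lemma contra_exact_iff:
  assumes t: "etri \<C> A B C x y \<delta>" and WW: "\<W> \<subseteq> obj \<C>"
  shows "contra_exact \<C> \<W> A B C x y \<longleftrightarrow> (\<forall>W \<in> \<W>. cexact W x y)"
proof -
  note [simp] = etriD[OF t]
  have "short_exact_sequence (Mor \<C> A W) (Mor \<C> B W) (Mor \<C> C W) (\<lambda>f. f \<cdot> x) (\<lambda>f. f \<cdot> y)
    \<longleftrightarrow> cexact W x y" if W [simp]: "W \<in> obj \<C>" for W
  proof -
    have hx: "group_hom (Mor \<C> B W) (Mor \<C> A W) (\<lambda>f. f \<cdot> x)" using precomp_hom[of x W] by simp
    have hy: "group_hom (Mor \<C> C W) (Mor \<C> B W) (\<lambda>f. f \<cdot> y)" using precomp_hom[of y W] by simp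
    \<comment> \<open>Middle exactness comes from the triangle alone: weak cokernels give one
      inclusion, \<open>y \<cdot> x = 0\<close> the other.\<close>
    have "kernel (Mor \<C> B W) (Mor \<C> A W) (\<lambda>f. f \<cdot> x) = (\<lambda>f. f \<cdot> y) ` mor \<C> C W"
    proof (rule subset_antisym; rule subsetI)
      fix f assume "f \<in> kernel (Mor \<C> B W) (Mor \<C> A W) (\<lambda>f. f \<cdot> x)"
      then have f: "arr f" "dm f = B" "cd f = W" "f \<cdot> x = zer A W" by (auto simp: kernel_def mor_iff)
      obtain k where "arr k" "dm k = C" "cd k = W" "k \<cdot> y = f"
        using weak_cokernel[OF t f(1,2)] f(3,4) by metis
      then show "f \<in> (\<lambda>f. f \<cdot> y) ` mor \<C> C W" by (auto simp: mor_iff)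
    next
      fix f assume "f \<in> (\<lambda>f. f \<cdot> y) ` mor \<C> C W"
      then show "f \<in> kernel (Mor \<C> B W) (Mor \<C> A W) (\<lambda>f. f \<cdot> x)"
        by (auto simp: kernel_def mor_iff etri_cmp_zer[OF t])
    qed
    moreover have "(\<lambda>f. f \<cdot> y) \<in> mon (Mor \<C> C W) (Mor \<C> B W) \<longleftrightarrow>
      (\<forall>w. arr w \<and> dm w = cd y \<and> cd w = W \<and> w \<cdot> y = zer (dm y) W \<longrightarrow> w = zer (cd y) W)"
      unfolding group_hom_mon_iff[OF hy] by (auto simp: mor_iff)
    moreover have "(\<lambda>f. f \<cdot> x) \<in> epi (Mor \<C> B W) (Mor \<C> A W) \<longleftrightarrow>
      (\<forall>h. arr h \<and> dm h = dm x \<and> cd h = W \<longrightarrow> (\<exists>k. arr k \<and> dm k = cd x \<and> cd k = W \<and> k \<cdot> x = h))"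
      unfolding epi_iff_subset using hx
      by (auto simp: group_hom_def group_hom_axioms_def mor_iff subset_iff image_iff Bex_def
          intro: sym)
    ultimately show ?thesis
      using hx hy unfolding short_exact_sequence_iff cexact_def
      by (auto simp: group_hom_def group_hom_axioms_def)
  qed
  then show ?thesis using WW unfolding contra_exact_def by blast
qed

lemma cov_exact_iff:
  assumes t: "etri \<C> A B C x y \<delta>" and WW: "\<W> \<subseteq> obj \<C>"
  shows "cov_exact \<C> \<W> A B C x y \<longleftrightarrow> (\<forall>W \<in> \<W>. vexact W x y)"
proof -
  note [simp] = etriD[OF t]
  have "short_exact_sequence (Mor \<C> W C) (Mor \<C> W B) (Mor \<C> W A) (\<lambda>f. y \<cdot> f) (\<lambda>f. x \<cdot> f)
    \<longleftrightarrow> vexact W x y" if W [simp]: "W \<in> obj \<C>" for W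
  proof -
    have hx: "group_hom (Mor \<C> W A) (Mor \<C> W B) (\<lambda>f. x \<cdot> f)" using postcomp_hom[of x W] by simp
    have hy: "group_hom (Mor \<C> W B) (Mor \<C> W C) (\<lambda>f. y \<cdot> f)" using postcomp_hom[of y W] by simp
    have "kernel (Mor \<C> W B) (Mor \<C> W C) (\<lambda>f. y \<cdot> f) = (\<lambda>f. x \<cdot> f) ` mor \<C> W A"
    proof (rule subset_antisym; rule subsetI)
      fix f assume "f \<in> kernel (Mor \<C> W B) (Mor \<C> W C) (\<lambda>f. y \<cdot> f)"
      then have f: "arr f" "dm f = W" "cd f = B" "y \<cdot> f = zer W C" by (auto simp: kernel_def mor_iff)
      obtain k where "arr k" "dm k = W" "cd k = A" "x \<cdot> k = f"
        using weak_kernel[OF t f(1,3)] f(2,4) by metis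
      then show "f \<in> (\<lambda>f. x \<cdot> f) ` mor \<C> W A" by (auto simp: mor_iff)
    next
      fix f assume "f \<in> (\<lambda>f. x \<cdot> f) ` mor \<C> W A"
      then show "f \<in> kernel (Mor \<C> W B) (Mor \<C> W C) (\<lambda>f. y \<cdot> f)"
        using etri_cmp_zer[OF t] by (auto simp: kernel_def mor_iff cmp_reduce[OF etri_cmp_zer[OF t]])
    qed
    moreover have "(\<lambda>f. x \<cdot> f) \<in> mon (Mor \<C> W A) (Mor \<C> W B) \<longleftrightarrow>
      (\<forall>w. arr w \<and> dm w = W \<and> cd w = dm x \<and> x \<cdot> w = zer W (cd x) \<longrightarrow> w = zer W (dm x))"
      unfolding group_hom_mon_iff[OF hx] by (auto simp: mor_iff)
    moreover have "(\<lambda>f. y \<cdot> f) \<in> epi (Mor \<C> W B) (Mor \<C> W C) \<longleftrightarrow>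
      (\<forall>h. arr h \<and> dm h = W \<and> cd h = cd y \<longrightarrow> (\<exists>k. arr k \<and> dm k = W \<and> cd k = dm y \<and> y \<cdot> k = h))"
      unfolding epi_iff_subset using hy
      by (auto simp: group_hom_def group_hom_axioms_def mor_iff subset_iff image_iff Bex_def
          intro: sym)
    ultimately show ?thesis
      using hx hy unfolding short_exact_sequence_iff vexact_def
      by (auto simp: group_hom_def group_hom_axioms_def)
  qed
  then show ?thesis using WW unfolding cov_exact_def by blast
qed

lemma ext_sum_closed:
  assumes "\<delta> \<in> ext \<C> C A" "\<delta>' \<in> ext \<C> C' A'"
    "is_biprod \<C> A A' P" "A \<in> obj \<C>" "A' \<in> obj \<C>" "is_biprod \<C> C C' R" "C \<in> obj \<C>" "C' \<in> obj \<C>"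
  shows "ext_sum \<C> P R \<delta> \<delta>' \<in> ext \<C> (bobj R) (bobj P)"
proof -
  note [simp] = biprodD[OF assms(3-5)] biprodD[OF assms(6-8)]
  interpret comm_group "Ext \<C> (bobj R) (bobj P)" using Ext_group by simp
  have "emap \<C> (pr1 R) (in1 P) \<delta> \<in> ext \<C> (bobj R) (bobj P)"
    "emap \<C> (pr2 R) (in2 P) \<delta>' \<in> ext \<C> (bobj R) (bobj P)"
    using emap_closed[of "pr1 R" "in1 P" \<delta>] emap_closed[of "pr2 R" "in2 P" \<delta>'] assms(1,2) by simp_all
  then show ?thesis unfolding ext_sum_def by simp
qed

lemma etri_sum:
  assumes t: "etri \<C> A B C x y \<delta>" and t': "etri \<C> A' B' C' x' y' \<delta>'"
    and "is_biprod \<C> A A' P" "is_biprod \<C> B B' Q" "is_biprod \<C> C C' R"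
  shows "etri \<C> (bobj P) (bobj Q) (bobj R) (mor_sum \<C> P Q x x') (mor_sum \<C> Q R y y') (ext_sum \<C> P R \<delta> \<delta>')"
proof -
  note d = etriD[OF t] and d' = etriD[OF t']
  note [simp] = biprodD[OF assms(3) d(1) d'(1)] biprodD[OF assms(4) d(2) d'(2)] biprodD[OF assms(5) d(3) d'(3)]
  show ?thesis
    using realiz_sum[OF assms] ext_sum_closed[OF d(10) d'(10) assms(3) d(1) d'(1) assms(5) d(3) d'(3)]
      mor_sum[OF assms(3) d(1) d'(1) assms(4) d(2) d'(2) d(4-6) d'(4-6)]
      mor_sum[OF assms(4) d(2) d'(2) assms(5) d(3) d'(3) d(7-9) d'(7-9)]
    by (intro etriI) simp_all
qed

end

context additive_category
begin

text \<open>In these coordinates \<open>C\<close> sits in \<open>L \<oplus> C\<close> as the graph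
  of \<open>c\<close>, and the complementary projection is \<open>(1,-c)\<close>. The split triangle
  of this biproduct therefore has \<open>(1,-c)\<close> as its deflation.\<close>

lemma biprod_twist:
  assumes R: "is_biprod \<C> L C R" "L \<in> obj \<C>" "C \<in> obj \<C>"
    and c: "arr c" "dm c = C" "cd c = L"
  shows "is_biprod \<C> C L \<lparr>bobj = bobj R, in1 = in1 R \<cdot> c \<boxplus> in2 R, in2 = in1 R,
    pr1 = pr2 R, pr2 = pr1 R \<boxplus> neg (c \<cdot> pr2 R)\<rparr>"
proof (rule biprodI)
  note [simp] = biprodD[OF R] R(2,3) c
  have "(u \<boxplus> b) \<boxplus> (a \<boxplus> neg u) = a \<boxplus> b"
    if [simp]: "arr u" "arr a" "arr b" "dm a = dm u" "cd a = cd u" "dm b = dm u" "cd b = cd u" for u a b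
  proof -
    have "(u \<boxplus> b) \<boxplus> (a \<boxplus> neg u) = (a \<boxplus> neg u) \<boxplus> (u \<boxplus> b)"
      by (rule add_comm) simp_all
    also have "\<dots> = a \<boxplus> b" by (simp add: add_assoc')
    finally show ?thesis .
  qed
  note cancel = this
  show "in1 \<lparr>bobj = bobj R, in1 = in1 R \<cdot> c \<boxplus> in2 R, in2 = in1 R, pr1 = pr2 R, pr2 = pr1 R \<boxplus> neg (c \<cdot> pr2 R)\<rparr> \<cdot>
      pr1 \<lparr>bobj = bobj R, in1 = in1 R \<cdot> c \<boxplus> in2 R, in2 = in1 R, pr1 = pr2 R, pr2 = pr1 R \<boxplus> neg (c \<cdot> pr2 R)\<rparr> \<boxplus>
      in2 \<lparr>bobj = bobj R, in1 = in1 R \<cdot> c \<boxplus> in2 R, in2 = in1 R, pr1 = pr2 R, pr2 = pr1 R \<boxplus> neg (c \<cdot> pr2 R)\<rparr> \<cdot>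
      pr2 \<lparr>bobj = bobj R, in1 = in1 R \<cdot> c \<boxplus> in2 R, in2 = in1 R, pr1 = pr2 R, pr2 = pr1 R \<boxplus> neg (c \<cdot> pr2 R)\<rparr> =
      ide \<C> (bobj \<lparr>bobj = bobj R, in1 = in1 R \<cdot> c \<boxplus> in2 R, in2 = in1 R, pr1 = pr2 R, pr2 = pr1 R \<boxplus> neg (c \<cdot> pr2 R)\<rparr>)"
    using cancel[of "in1 R \<cdot> (c \<cdot> pr2 R)" "in1 R \<cdot> pr1 R" "in2 R \<cdot> pr2 R"] by simp
qed (use biprodD[OF R] R(2,3) c in simp_all)

end

context extriangulated_category
begin

section \<open>Composition of inflations and exactness after (ET4)\<close>

lemma ET4_arr:
  assumes "etri \<C> A B D f f' \<delta>" "etri \<C> B C F g g' \<delta>'"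
  obtains E h' d e \<delta>'' where "etri \<C> A C E (g \<cdot> f) h' \<delta>''" "etri \<C> D E F d e (push \<C> F f' \<delta>')"
    "h' \<cdot> g = d \<cdot> f'" "e \<cdot> h' = g'" "pull \<C> A d \<delta>'' = \<delta>" "push \<C> E f \<delta>'' = pull \<C> B e \<delta>'"
  using ET4[OF assms] by metis

lemma ET4_op_arr:
  assumes "etri \<C> D B A f' f \<delta>" "etri \<C> F C B g' g \<delta>'"
  obtains E h' d e \<delta>'' where "etri \<C> E C A h' (f \<cdot> g) \<delta>''" "etri \<C> F E D e d (pull \<C> F f' \<delta>')"
    "g \<cdot> h' = f' \<cdot> d" "h' \<cdot> e = g'" "push \<C> A d \<delta>'' = \<delta>" "pull \<C> E f \<delta>'' = push \<C> B e \<delta>'"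
  using ET4_op[OF assms] by metis

text \<open>The four equations linking the triangles suffice for a diagram chase. The injectivity
  clauses for \<open>f'\<close> and \<open>g'\<close> stand in for these deflations being
  epic.\<close>

lemma ET4_cexact:
  assumes t: "etri \<C> A B D f f' \<delta>" and u: "etri \<C> B C F g g' \<delta>'"
    and s: "etri \<C> A C E (g \<cdot> f) h' \<delta>''" and v: "etri \<C> D E F d e \<theta>"
    and eq: "h' \<cdot> g = d \<cdot> f'" "e \<cdot> h' = g'"
    and W: "W \<in> obj \<C>" and ce: "cexact W f f'" "cexact W g g'"
  shows "cexact W (g \<cdot> f) h'" "cexact W d e"
proof -
  note [simp] = etriD(1-9)[OF t] etriD(1-9)[OF u] etriD(1-9)[OF s] etriD(1-9)[OF v] W
  \<comment> \<open>From \<open>w \<cdot> d \<cdot> f' = w \<cdot> h' \<cdot> g = 0\<close> it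
    follows that \<open>w\<close> kills \<open>d\<close> and hence factors through \<open>e\<close>.
    The factor kills \<open>g'\<close>, so it is zero.\<close>
  have mono_d: "w = zer E W" if [simp]: "arr w" "dm w = E" "cd w = W" "w \<cdot> h' = zer C W" for w
  proof -
    have "w \<cdot> (d \<cdot> f') = zer B W"
      using cmp_reduce[OF that(4), of g] by (simp flip: eq(1))
    then have "w \<cdot> d = zer D W" by (intro cexact_mono[OF ce(1), simplified]) simp_all
    then obtain w' where w' [simp]: "arr w'" "dm w' = F" "cd w' = W" "w' \<cdot> e = w"
      using weak_cokernel[OF v, of w] by auto
    have "w' \<cdot> g' = w \<cdot> h'" using cmp_reduce[OF w'(4), of h'] by (simp flip: eq(2))
    then have "w' = zer F W" by (intro cexact_mono[OF ce(2), simplified]) simp_all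
    then show ?thesis using w'(4) by (simp del: w'(4))
  qed
  show "cexact W (g \<cdot> f) h'"
  proof (rule cexactI)
    fix h assume h [simp]: "arr h" "dm h = dm (g \<cdot> f)" "cd h = W"
    obtain k where k [simp]: "arr k" "dm k = B" "cd k = W" "k \<cdot> f = h"
      using cexact_extend[OF ce(1), of h] by auto
    obtain l where l [simp]: "arr l" "dm l = C" "cd l = W" "l \<cdot> g = k"
      using cexact_extend[OF ce(2), of k] by auto
    have "l \<cdot> (g \<cdot> f) = h" using cmp_reduce[OF l(4), of f] by simp
    then show "\<exists>k. arr k \<and> dm k = cd (g \<cdot> f) \<and> cd k = W \<and> k \<cdot> (g \<cdot> f) = h"
      by (intro exI[of _ l]) simp
  qed (use mono_d in simp)
  show "cexact W d e"
  proof (rule cexactI)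
    fix l assume l [simp]: "arr l" "dm l = dm d" "cd l = W"
    \<comment> \<open>To extend \<open>l\<close> along \<open>d\<close>, extend
      \<open>l \<cdot> f'\<close> along \<open>g\<close> first. The result kills
      \<open>g \<cdot> f\<close> because \<open>f' \<cdot> f = 0\<close>, so it descends along
      \<open>h'\<close> to \<open>E\<close>; that the descent restricts to \<open>l\<close> is
      checked after \<open>f'\<close>.\<close>
    obtain t0 where t0 [simp]: "arr t0" "dm t0 = C" "cd t0 = W" "t0 \<cdot> g = l \<cdot> f'"
      using cexact_extend[OF ce(2), of "l \<cdot> f'"] by auto
    have "t0 \<cdot> (g \<cdot> f) = zer A W"
      using cmp_reduce[OF t0(4), of f] etri_cmp_zer[OF t] by simp
    then obtain m where m [simp]: "arr m" "dm m = E" "cd m = W" "m \<cdot> h' = t0"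
      using weak_cokernel[OF s, of t0] by auto
    have "(m \<cdot> d) \<cdot> f' = l \<cdot> f'"
      using cmp_reduce[OF m(4), of g] by (simp add: eq(1))
    then have "(m \<cdot> d \<boxplus> neg l) \<cdot> f' = zer B W" by simp
    then have "m \<cdot> d \<boxplus> neg l = zer D W"
      by (intro cexact_mono[OF ce(1), simplified]) (simp_all del: cmp_add)
    then have "m \<cdot> d = l" using sub_zer_iff[of "m \<cdot> d" l] by simp
    then show "\<exists>k. arr k \<and> dm k = cd d \<and> cd k = W \<and> k \<cdot> d = l"
      by (intro exI[of _ m]) simp
  next
    fix w assume w: "arr w" "dm w = cd e" "cd w = W" "w \<cdot> e = zer (dm e) W"
    note w' [simp] = w(1-3)
    have "w \<cdot> (e \<cdot> h') = zer C W"
      using cmp_reduce[OF w(4), of h'] by (simp)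
    then have "w \<cdot> g' = zer C W" by (simp only: eq(2))
    then show "w = zer (cd e) W" using cexact_mono[OF ce(2), of w] by simp
  qed
qed

end

section \<open>Proper classes and the horseshoe construction\<close>

locale proper_extri = extriangulated_category \<C> + proper_class \<C> \<xi>
  for \<C> :: "('o, 'm, 'e) extri" (structure) and \<xi> +
  assumes enough_proj: "enough_xproj \<C> \<xi>"
begin

abbreviation xt3 where "xt3 \<equiv> xtri \<C> \<xi>"
abbreviation GIs where "GIs \<equiv> GI \<C> \<xi>"

lemma xtri_etri: "xt3 A B C x y \<delta> \<Longrightarrow> etri \<C> A B C x y \<delta>"
  by (simp add: xtri_def)

lemma xproj_lift:
  assumes "P \<in> xproj \<C> \<xi>" "xt3 A B C x y \<delta>" "arr h" "dm h = P" "cd h = C"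
  obtains k where "arr k" "dm k = P" "cd k = B" "y \<cdot> k = h"
proof -
  note t = xtri_etri[OF assms(2)]
  have "P \<in> obj \<C>" "cov_exact \<C> {P} A B C x y" using assms(1,2) unfolding xproj_def by blast+
  then have "vexact P x y" using cov_exact_iff[OF t, of "{P}"] by simp
  then show ?thesis using vexact_lift[of P x y h] that etriD[OF t] assms(3-5) by metis
qed

text \<open>Detecting \<open>\<xi>\<close> on \<open>\<xi>\<close>-projectives yields the dual of the axiom of saturation, which is what
  makes \<open>\<xi>\<close>-inflations closed under composition.\<close>

lemma xtri_iff:
  assumes t: "etri \<C> A B C x y \<delta>"
  shows "xt3 A B C x y \<delta> \<longleftrightarrow>
    (\<forall>h. arr h \<and> dm h \<in> xproj \<C> \<xi> \<and> cd h = C \<longrightarrow> pull \<C> A h \<delta> = ez (dm h) A)"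
proof (intro iffI allI impI)
  note [simp] = etriD[OF t]
  fix h assume xi: "xt3 A B C x y \<delta>" and h: "arr h \<and> dm h \<in> xproj \<C> \<xi> \<and> cd h = C"
  then have [simp]: "arr h" "cd h = C" by auto
  obtain k where [simp]: "arr k" "dm k = dm h" "cd k = B" and k: "y \<cdot> k = h"
    using xproj_lift[OF _ xi, of "dm h" h] h by metis
  \<comment> \<open>\<open>h\<close> lifts through \<open>y\<close>, and the pullback of \<delta>
    along \<open>y\<close> is already zero.\<close>
  have "pull \<C> A h \<delta> = pull \<C> A k (pull \<C> A y \<delta>)"
    by (simp add: pull_pull k)
  then show "pull \<C> A h \<delta> = ez (dm h) A" by (simp add: pull_deflation[OF t])
next
  note [simp] = etriD[OF t]
  assume h: "\<forall>h. arr h \<and> dm h \<in> xproj \<C> \<xi> \<and> cd h = C \<longrightarrow> pull \<C> A h \<delta> = ez (dm h) A"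
  obtain K P i p \<kappa> where P: "P \<in> xproj \<C> \<xi>" "xt3 K P C i p \<kappa>"
    using enough_proj unfolding enough_xproj_def by (metis etriD(3) t)
  note [simp] = etriD[OF xtri_etri[OF P(2)]]
  have e: "pull \<C> A p \<delta> = ez P A" using h[rule_format, of p] P(1) by simp
  obtain M m n where M: "etri \<C> A M P m n (ez P A)"
    using realization_exists[of A P "ez P A"] by auto
  \<comment> \<open>Pulled back to the projective \<open>P\<close> the extension splits, so it lies
    in \<xi>; saturation against \<open>K \<rightarrow> P \<rightarrow> C\<close> passes this on to
    \<delta>.\<close>
  then have "xt3 A M P m n (pull \<C> A p \<delta>)" using split[OF M] M by (simp add: xtri_def e)
  then show "xt3 A B C x y \<delta>" using saturated[OF t P(2)] t by (simp add: xtri_def)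
qed

text \<open>The triangle \<open>D \<rightarrow> E \<rightarrow> F\<close> is a cobase change of the
  second one. For the composite, test on a projective: the pullback of \<delta>'' along
  \<open>h\<close> is killed by pushing along \<open>f\<close>, because that push comes from
  \<delta>'. Hence it is a pullback of \<delta> from a projective, and vanishes.\<close>

lemma xtri_compose:
  assumes xi: "xt3 A B D f f' \<delta>" "xt3 B C F g g' \<delta>'"
  obtains E h' d e \<delta>'' \<theta> where "xt3 A C E (g \<cdot> f) h' \<delta>''" "xt3 D E F d e \<theta>"
    "h' \<cdot> g = d \<cdot> f'" "e \<cdot> h' = g'"
    "\<And>W. \<lbrakk>W \<in> obj \<C>; cexact W f f'; cexact W g g'\<rbrakk> \<Longrightarrow> cexact W (g \<cdot> f) h' \<and> cexact W d e"
proof -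
  note t = xtri_etri[OF xi(1)] and u = xtri_etri[OF xi(2)]
  obtain E h' d e \<delta>'' where s: "etri \<C> A C E (g \<cdot> f) h' \<delta>''"
    and v: "etri \<C> D E F d e (push \<C> F f' \<delta>')"
    and eq: "h' \<cdot> g = d \<cdot> f'" "e \<cdot> h' = g'"
    and q: "pull \<C> A d \<delta>'' = \<delta>" "push \<C> E f \<delta>'' = pull \<C> B e \<delta>'"
    by (rule ET4_arr[OF t u])
  note [simp] = etriD[OF t] etriD[OF u] etriD[OF s] etriD[OF v]
  have f': "f' \<in> mor \<C> B D" by (simp add: mor_iff)
  have "xt3 D E F d e (push \<C> F f' \<delta>')"
    using cobase_change[OF xi(2) f' v] v by (simp add: xtri_def)
  moreover have "xt3 A C E (g \<cdot> f) h' \<delta>''"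
    unfolding xtri_iff[OF s]
  proof (intro allI impI)
    fix h assume h: "arr h \<and> dm h \<in> xproj \<C> \<xi> \<and> cd h = E"
    then have [simp]: "arr h" "cd h = E" by auto
    have "push \<C> (dm h) f (pull \<C> A h \<delta>'') = pull \<C> B h (push \<C> E f \<delta>'')"
      by (simp add: pull_push)
    also have "\<dots> = pull \<C> B (e \<cdot> h) \<delta>'" by (simp add: q(2) pull_pull)
    also have "\<dots> = ez (dm h) B" using xi(2)[unfolded xtri_iff[OF u], rule_format, of "e \<cdot> h"] h by simp
    finally obtain k where k: "arr k" "dm k = dm h" "cd k = D" "pull \<C> A h \<delta>'' = pull \<C> A k \<delta>"
      using push_inflation_kernel[OF t, of "pull \<C> A h \<delta>''" "dm h"] by auto
    then show "pull \<C> A h \<delta>'' = ez (dm h) A"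
      using xi(1)[unfolded xtri_iff[OF t], rule_format, of k] h by simp
  qed
  ultimately show ?thesis
    using that[OF _ _ eq] ET4_cexact[OF t u s v eq] by blast
qed

section \<open>Sums of triangles and one step of the horseshoe\<close>

lemma xtri_sum:
  assumes "xt3 A B C x y \<delta>" "xt3 A' B' C' x' y' \<delta>'"
    and "is_biprod \<C> A A' P" "is_biprod \<C> B B' Q" "is_biprod \<C> C C' R"
  shows "xt3 (bobj P) (bobj Q) (bobj R) (mor_sum \<C> P Q x x') (mor_sum \<C> Q R y y') (ext_sum \<C> P R \<delta> \<delta>')"
  using coproducts[OF assms] etri_sum[OF xtri_etri xtri_etri, OF assms] unfolding xtri_def by simp

lemma xtri_split: "etri \<C> A B C x y (ez C A) \<Longrightarrow> xt3 A B C x y (ez C A)"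
  using split unfolding xtri_def by simp

text \<open>This provides the second leg \<open>H \<oplus> C \<rightarrow> H \<oplus> H'\<close> of
  the composite, as the sum of \<open>H \<rightarrow> H \<rightarrow> 0\<close> with the resolution
  triangle of \<open>C\<close>.\<close>

lemma xtri_add_id:
  assumes xi: "xt3 C H' L' g' f' \<rho>'" and H: "H \<in> obj \<C>"
    and Q: "is_biprod \<C> H C Q" and Q': "is_biprod \<C> H H' Q'"
  obtains \<theta> where "xt3 (bobj Q) (bobj Q') L' (mor_sum \<C> Q Q' (ide \<C> H) g') (f' \<cdot> pr2 Q') \<theta>"
    "\<And>W. \<lbrakk>W \<in> obj \<C>; cexact W g' f'\<rbrakk> \<Longrightarrow> cexact W (mor_sum \<C> Q Q' (ide \<C> H) g') (f' \<cdot> pr2 Q')"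
proof -
  note t = xtri_etri[OF xi]
  note d [simp] = etriD[OF t] H
  note [simp] = biprodD[OF Q H d(1)] biprodD[OF Q' H d(2)]
  obtain Z where Z: "is_zero Z" using zero_exists .
  note [simp] = is_zeroD[OF Z]
  \<comment> \<open>This exhibits \<open>L'\<close> itself as the sum of \<open>0\<close> and
    \<open>L'\<close>, so the new triangle ends in \<open>L'\<close> exactly.\<close>
  let ?R = "\<lparr>bobj = L', in1 = zer Z L', in2 = ide \<C> L', pr1 = zer L' Z, pr2 = ide \<C> L'\<rparr>"
  note R = zero_biprod(1)[OF Z d(3)]
  note ms = mor_sum[OF Q H d(1) Q' H d(2), of "ide \<C> H" g', simplified]
  note [simp] = ms
  have "mor_sum \<C> Q' ?R (zer H Z) f' = f' \<cdot> pr2 Q'"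
    by (subst mor_sum_eq[OF Q' H d(2) R]) simp_all
  with xtri_sum[OF xtri_split[OF zero_etri(2)[OF Z H]] xi Q Q' R]
  have x: "xt3 (bobj Q) (bobj Q') L' (mor_sum \<C> Q Q' (ide \<C> H) g') (f' \<cdot> pr2 Q') (ext_sum \<C> Q ?R (ez Z H) \<rho>')"
    by simp
  have "cexact W (mor_sum \<C> Q Q' (ide \<C> H) g') (f' \<cdot> pr2 Q')"
    if W [simp]: "W \<in> obj \<C>" and ce: "cexact W g' f'" for W
  proof (rule cexactI)
    fix h assume h [simp]: "arr h" "dm h = dm (mor_sum \<C> Q Q' (ide \<C> H) g')" "cd h = W"
    obtain k where k [simp]: "arr k" "dm k = H'" "cd k = W" "k \<cdot> g' = h \<cdot> in2 Q"
      using cexact_extend[OF ce, of "h \<cdot> in2 Q"] by auto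
    \<comment> \<open>On \<open>H\<close> the map is unchanged; on \<open>H'\<close> it is the
      extension of its \<open>C\<close>-component along \<open>g'\<close>.\<close>
    let ?k = "h \<cdot> (in1 Q \<cdot> pr1 Q') \<boxplus> k \<cdot> pr2 Q'"
    have "?k \<cdot> mor_sum \<C> Q Q' (ide \<C> H) g' = h"
      by (rule biprod_ext_from[OF Q]) simp_all
    then show "\<exists>k. arr k \<and> dm k = cd (mor_sum \<C> Q Q' (ide \<C> H) g') \<and> cd k = W \<and>
        k \<cdot> mor_sum \<C> Q Q' (ide \<C> H) g' = h"
      by (intro exI[of _ ?k]) (simp del: cmp_add)
  next
    fix w assume w: "arr w" "dm w = cd (f' \<cdot> pr2 Q')" "cd w = W"
      "w \<cdot> (f' \<cdot> pr2 Q') = zer (dm (f' \<cdot> pr2 Q')) W"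
    note [simp] = w(1-3)
    have "w \<cdot> f' = (w \<cdot> (f' \<cdot> pr2 Q')) \<cdot> in2 Q'" by simp
    also have "\<dots> = zer H' W" by (subst w(4)) simp
    finally show "w = zer (cd (f' \<cdot> pr2 Q')) W"
      using cexact_mono[OF ce, of w] by simp
  qed
  with x show ?thesis using that by blast
qed

text \<open>The factorization \<open>g = k x\<close> exhibits \<open>\<delta>\<close> as \<open>c\<^sup>*\<rho>\<close>, hence \<open>B\<close> as a homotopy pullback of
  \<open>H \<rightarrow> L \<leftarrow> C\<close>. It is obtained by applying (ET4)op to the composite
  \<open>H \<oplus> C \<rightarrow> L \<oplus> C \<rightarrow> L\<close>, where the second map is \<open>(1, -c)\<close>.\<close>

lemma homotopy_pullback:
  assumes xi: "xt3 A B C x y \<delta>" "xt3 A H L g f \<rho>"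
    and k: "arr k" "dm k = B" "cd k = H" "k \<cdot> x = g"
    and Q: "is_biprod \<C> H C Q"
  obtains \<gamma> \<phi> \<theta> where "xt3 B (bobj Q) L \<gamma> \<phi> \<theta>" "\<gamma> \<cdot> x = in1 Q \<cdot> g" "pr2 Q \<cdot> \<gamma> = y" "\<phi> \<cdot> in1 Q = f"
proof -
  note t = xtri_etri[OF xi(1)] and u = xtri_etri[OF xi(2)]
  note dt [simp] = etriD[OF t] and du [simp] = etriD[OF u] and [simp] = k(1-3)
  note [simp] = biprodD[OF Q du(2) dt(3)]
  \<comment> \<open>Since \<open>k \<cdot> x = g\<close>, the identity of \<open>A\<close> and
    \<open>k\<close> start a morphism of triangles. Its third component \<open>c\<close> pulls
    \<rho> back to \<delta>.\<close>
  obtain c where c [simp]: "arr c" "dm c = C" "cd c = L" and cc: "push \<C> C (ide \<C> A) \<delta> = pull \<C> A c \<rho>"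
    by (rule ET3_arr[OF t u, of "ide \<C> A" k]) (simp_all add: k)
  have c\<delta>: "pull \<C> A c \<rho> = \<delta>" using cc by simp
  obtain R where R: "is_biprod \<C> L C R" using biprodE[of L C] by auto
  note [simp] = biprodD[OF R du(3) dt(3)]
  define S where "S = \<lparr>bobj = bobj R, in1 = in1 R \<cdot> c \<boxplus> in2 R, in2 = in1 R,
    pr1 = pr2 R, pr2 = pr1 R \<boxplus> neg (c \<cdot> pr2 R)\<rparr>"
  have S: "is_biprod \<C> C L S" unfolding S_def by (rule biprod_twist[OF R du(3) dt(3) c])
  have Ss [simp]: "bobj S = bobj R" "in2 S = in1 R" "pr1 S = pr2 R" by (simp_all add: S_def)
  have Si: "in1 S = in1 R \<cdot> c \<boxplus> in2 R" by (simp add: S_def)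
  note [simp] = biprodD[OF S dt(3) du(3), simplified]
  obtain Z where Z: "is_zero Z" using zero_exists .
  note [simp] = is_zeroD[OF Z]
  let ?P = "\<lparr>bobj = A, in1 = ide \<C> A, in2 = zer Z A, pr1 = ide \<C> A, pr2 = zer A Z\<rparr>"
  note P = zero_biprod(2)[OF Z dt(1)]
  \<comment> \<open>\<open>g2\<close> and \<open>f2\<close> are the maps of the sum of
    \<open>A \<rightarrow> H \<rightarrow> L\<close> with
    \<open>0 \<rightarrow> C \<rightarrow> C\<close>; its extension is the pullback of \<rho> along
    \<open>pr1 R\<close>.\<close>
  define g2 where "g2 = in1 Q \<cdot> g"
  define f2 where "f2 = mor_sum \<C> Q R f (ide \<C> C)"
  have "mor_sum \<C> ?P Q g (zer Z C) = g2"
    unfolding g2_def by (subst mor_sum_eq[OF P dt(1) is_zeroD(1)[OF Z] Q]) simp_all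
  moreover have "ext_sum \<C> ?P R \<rho> (ez C Z) = pull \<C> A (pr1 R) \<rho>"
  proof -
    interpret comm_group "Ext \<C> (bobj R) A" using Ext_group by simp
    show ?thesis unfolding ext_sum_def by (simp add: emap_pull_push)
  qed
  ultimately have v: "etri \<C> A (bobj Q) (bobj R) g2 f2 (pull \<C> A (pr1 R) \<rho>)"
    using etri_sum[OF u zero_etri(1)[OF Z dt(3)] P Q R] by (simp add: f2_def)
  note f2 = mor_sum[OF Q du(2) dt(3) R du(3) dt(3), of f "ide \<C> C", simplified, folded f2_def]
  note [simp] = f2
  have spl: "etri \<C> C (bobj R) L (in1 S) (pr2 S) (ez L C)" using split_etri[OF S] by simp
  obtain E h' d e \<delta>'' where s: "etri \<C> E (bobj Q) L h' (pr2 S \<cdot> f2) \<delta>''"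
    and w: "etri \<C> A E C e d (pull \<C> A (in1 S) (pull \<C> A (pr1 R) \<rho>))"
    and eq: "f2 \<cdot> h' = in1 S \<cdot> d" "h' \<cdot> e = g2"
    and q: "pull \<C> E (pr2 S) \<delta>'' = push \<C> (bobj R) e (pull \<C> A (pr1 R) \<rho>)"
    by (rule ET4_op_arr[OF spl v])
  note [simp] = etriD[OF s] etriD(1-9)[OF w]
  have "pr1 R \<cdot> in1 S = c" by (simp add: Si)
  \<comment> \<open>The first term \<open>E\<close> of the composite deflation realizes the pullback
    of \<rho> along \<open>c\<close>. That is \<delta>, so \<open>E\<close> is a copy of
    \<open>B\<close>.\<close>
  then have w': "etri \<C> A E C e d \<delta>" using w by (simp add: pull_pull c\<delta>)
  obtain b where b: "is_iso \<C> B E b" "b \<cdot> x = e" "d \<cdot> b = y" by (rule realization_unique[OF t w'])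
  obtain b' where b' [simp]: "arr b" "dm b = B" "cd b = E" "arr b'" "dm b' = E" "cd b' = B"
    "b' \<cdot> b = ide \<C> B" "b \<cdot> b' = ide \<C> E"
    using is_isoE[OF b(1)] by auto
  have r: "etri \<C> B (bobj Q) L (h' \<cdot> b) (pr2 S \<cdot> f2) (push \<C> L b' \<delta>'')"
    by (rule etri_iso_left[OF s]) simp_all
  \<comment> \<open>\<open>in1 R\<close> is a section of \<open>pr2 S\<close>, so \<delta>'' is
    recovered from its pullback along \<open>pr2 S\<close>, which the dual of (ET4) describes. It
    turns out to be a pushout of \<rho>, and this is what puts the triangle in \<xi>.\<close>
  have "\<delta>'' = pull \<C> E (in1 R) (pull \<C> E (pr2 S) \<delta>'')"
    by (simp add: pull_pull)
  also have "\<dots> = push \<C> L e \<rho>" unfolding q by (simp add: pull_push pull_pull)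
  finally have "push \<C> L b' \<delta>'' = push \<C> L (b' \<cdot> e) \<rho>" by (simp add: push_push)
  moreover have "b' \<cdot> e = x" using cmp_reduce[OF b'(7), of x] b(2) by simp
  ultimately have \<theta>: "push \<C> L b' \<delta>'' = push \<C> L x \<rho>" by simp
  have "xt3 B (bobj Q) L (h' \<cdot> b) (pr2 S \<cdot> f2) (push \<C> L x \<rho>)"
    using cobase_change[OF xi(2), of x B "bobj Q" "h' \<cdot> b" "pr2 S \<cdot> f2"] r
    by (simp add: xtri_def \<theta> mor_iff)
  moreover have "(h' \<cdot> b) \<cdot> x = in1 Q \<cdot> g" by (simp add: b(2) eq(2) g2_def)
  moreover have "pr2 Q \<cdot> h' = d"
  proof -
    have "pr2 R \<cdot> (f2 \<cdot> h') = pr2 Q \<cdot> h'" by (subst cmp_reduce[OF f2(7)]) simp_all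
    moreover have "pr2 R \<cdot> (in1 S \<cdot> d) = d" by simp
    ultimately show ?thesis by (simp add: eq(1))
  qed
  then have "pr2 Q \<cdot> (h' \<cdot> b) = y" using cmp_reduce[of "pr2 Q" h' d b] b(3) by simp
  moreover have "(pr2 S \<cdot> f2) \<cdot> in1 Q = f" by simp
  ultimately show ?thesis using that by blast
qed

lemma horseshoe_step:
  assumes xi: "xt3 A B C x y \<delta>" "xt3 A H L g f \<rho>" "xt3 C H' L' g' f' \<rho>'"
    and WW: "\<W> \<subseteq> obj \<C>" "H \<in> \<W>"
    and ce: "\<And>W. W \<in> \<W> \<Longrightarrow> cexact W x y" "\<And>W. W \<in> \<W> \<Longrightarrow> cexact W g f" "\<And>W. W \<in> \<W> \<Longrightarrow> cexact W g' f'"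
    and Q: "is_biprod \<C> H H' Q"
  obtains M \<gamma> \<eta> \<theta> d e \<epsilon> where
    "xt3 B (bobj Q) M \<gamma> \<eta> \<theta>" "\<And>W. W \<in> \<W> \<Longrightarrow> cexact W \<gamma> \<eta>"
    "xt3 L M L' d e \<epsilon>" "\<And>W. W \<in> \<W> \<Longrightarrow> cexact W d e"
    "\<gamma> \<cdot> x = in1 Q \<cdot> g" "pr2 Q \<cdot> \<gamma> = g' \<cdot> y" "\<eta> \<cdot> in1 Q = d \<cdot> f" "e \<cdot> \<eta> = f' \<cdot> pr2 Q"
proof -
  note t = xtri_etri[OF xi(1)] and u = xtri_etri[OF xi(2)] and v = xtri_etri[OF xi(3)]
  note dt [simp] = etriD[OF t] and du [simp] = etriD[OF u] and dv [simp] = etriD[OF v]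
  note [simp] = biprodD[OF Q du(2) dv(2)]
  obtain k where k: "arr k" "dm k = B" "cd k = H" "k \<cdot> x = g"
    using cexact_extend[OF ce(1)[OF WW(2)], of g] by auto
  obtain Q0 where Q0: "is_biprod \<C> H C Q0" using biprodE[of H C] by auto
  note [simp] = biprodD[OF Q0 du(2) dt(3)]
  obtain \<gamma>0 \<phi> \<theta>0 where p: "xt3 B (bobj Q0) L \<gamma>0 \<phi> \<theta>0"
    and pe: "\<gamma>0 \<cdot> x = in1 Q0 \<cdot> g" "pr2 Q0 \<cdot> \<gamma>0 = y" "\<phi> \<cdot> in1 Q0 = f"
    by (rule homotopy_pullback[OF xi(1,2) k Q0])
  note [simp] = etriD[OF xtri_etri[OF p]]
  have ce0: "cexact W \<gamma>0 \<phi>" if W: "W \<in> \<W>" for W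
  proof (rule cexactI)
    have [simp]: "W \<in> obj \<C>" using W WW by blast
    fix b assume b [simp]: "arr b" "dm b = dm \<gamma>0" "cd b = W"
    obtain h1 where h1 [simp]: "arr h1" "dm h1 = H" "cd h1 = W" "h1 \<cdot> g = b \<cdot> x"
      using cexact_extend[OF ce(2)[OF W], of "b \<cdot> x"] by auto
    \<comment> \<open>By the choice of \<open>h1\<close>, the difference \<open>b - ?r\<close>
      vanishes on \<open>x\<close> and factors through \<open>y\<close>, the
      \<open>C\<close>-component of \<open>\<gamma>0\<close>. Adding back \<open>h1\<close> on the
      \<open>H\<close>-component gives the extension \<open>?k\<close>.\<close>
    let ?r = "h1 \<cdot> (pr1 Q0 \<cdot> \<gamma>0)"
    have "(b \<boxplus> neg ?r) \<cdot> x = zer A W" by (simp add: pe(1))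
    then obtain m where m [simp]: "arr m" "dm m = C" "cd m = W" "m \<cdot> y = b \<boxplus> neg ?r"
      using weak_cokernel[OF t, of "b \<boxplus> neg ?r"] by (auto simp del: cmp_add)
    let ?k = "h1 \<cdot> pr1 Q0 \<boxplus> m \<cdot> pr2 Q0"
    have "?k \<cdot> \<gamma>0 = ?r \<boxplus> (b \<boxplus> neg ?r)" by (simp add: pe(2))
    also have "\<dots> = b" using add_left_comm[of ?r b "neg ?r"] by simp
    finally show "\<exists>k. arr k \<and> dm k = cd \<gamma>0 \<and> cd k = W \<and> k \<cdot> \<gamma>0 = b"
      by (intro exI[of _ ?k]) (simp del: cmp_add)
  next
    have [simp]: "W \<in> obj \<C>" using W WW by blast
    fix w assume w: "arr w" "dm w = cd \<phi>" "cd w = W" "w \<cdot> \<phi> = zer (dm \<phi>) W"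
    note [simp] = w(1-3)
    \<comment> \<open>Restricting to the summand \<open>H\<close> turns \<phi> into
      \<open>f\<close>, for which injectivity is known.\<close>
    have "w \<cdot> (\<phi> \<cdot> in1 Q0) = zer H W" using cmp_reduce[OF w(4), of "in1 Q0"] by simp
    then show "w = zer (cd \<phi>) W" using cexact_mono[OF ce(2)[OF W], of w] by (simp add: pe(3))
  qed
  obtain \<theta>1 where a: "xt3 (bobj Q0) (bobj Q) L' (mor_sum \<C> Q0 Q (ide \<C> H) g') (f' \<cdot> pr2 Q) \<theta>1"
    "\<And>W. \<lbrakk>W \<in> obj \<C>; cexact W g' f'\<rbrakk> \<Longrightarrow> cexact W (mor_sum \<C> Q0 Q (ide \<C> H) g') (f' \<cdot> pr2 Q)"
    by (rule xtri_add_id[OF xi(3) du(2) Q0 Q]) blast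
  define j where "j = mor_sum \<C> Q0 Q (ide \<C> H) g'"
  note j = mor_sum[OF Q0 du(2) dt(3) Q du(2) dv(2), of "ide \<C> H" g', simplified, folded j_def]
  note [simp] = j
  note a = a[folded j_def]
  obtain M \<eta> d e \<theta> \<epsilon> where b: "xt3 B (bobj Q) M (j \<cdot> \<gamma>0) \<eta> \<theta>" "xt3 L M L' d e \<epsilon>"
    and be: "\<eta> \<cdot> j = d \<cdot> \<phi>" "e \<cdot> \<eta> = f' \<cdot> pr2 Q"
    and bc: "\<And>W. \<lbrakk>W \<in> obj \<C>; cexact W \<gamma>0 \<phi>; cexact W j (f' \<cdot> pr2 Q)\<rbrakk>
      \<Longrightarrow> cexact W (j \<cdot> \<gamma>0) \<eta> \<and> cexact W d e"
    by (rule xtri_compose[OF p a(1)]) blast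
  note [simp] = etriD(1-9)[OF xtri_etri[OF b(1)]] etriD(1-9)[OF xtri_etri[OF b(2)]]
  have bc': "cexact W (j \<cdot> \<gamma>0) \<eta> \<and> cexact W d e" if W: "W \<in> \<W>" for W
    using bc[OF _ ce0[OF W] a(2)[OF _ ce(3)[OF W]]] W WW by blast
  have "(j \<cdot> \<gamma>0) \<cdot> x = in1 Q \<cdot> g" by (simp add: pe(1) cmp_reduce[OF j(4)])
  moreover have "pr2 Q \<cdot> (j \<cdot> \<gamma>0) = g' \<cdot> y" by (subst cmp_reduce[OF j(7)]) (simp_all add: pe(2))
  moreover have "\<eta> \<cdot> in1 Q = d \<cdot> f"
  proof -
    have "\<eta> \<cdot> in1 Q = (\<eta> \<cdot> j) \<cdot> in1 Q0" by simp
    also have "\<dots> = d \<cdot> f" unfolding be(1) by (simp add: pe(3))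
    finally show ?thesis .
  qed
  ultimately show ?thesis using that[of M "j \<cdot> \<gamma>0" \<eta> \<theta> d e \<epsilon>] b be(2) bc' by blast
qed

section \<open>Sums of injective and of relatively Gorenstein injective objects\<close>

lemma xinj_obj: "xinj \<C> \<xi> \<subseteq> obj \<C>"
  unfolding xinj_def by blast

lemma xinj_iff:
  "I \<in> xinj \<C> \<xi> \<longleftrightarrow> I \<in> obj \<C> \<and> (\<forall>A B C x y \<delta>. xt3 A B C x y \<delta> \<longrightarrow> cexact I x y)"
proof (cases "I \<in> obj \<C>")
  case True
  have "contra_exact \<C> {I} A B C x y \<longleftrightarrow> cexact I x y" if "xt3 A B C x y \<delta>" for A B C x y \<delta>
    using contra_exact_iff[OF xtri_etri[OF that], of "{I}"] True by simp
  then show ?thesis using True unfolding xinj_def by blast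
qed (simp add: xinj_def)

lemma xinj_biprod:
  assumes "I \<in> xinj \<C> \<xi>" "I' \<in> xinj \<C> \<xi>" "is_biprod \<C> I I' Q"
  shows "bobj Q \<in> xinj \<C> \<xi>"
proof -
  have obs: "I \<in> obj \<C>" "I' \<in> obj \<C>" using assms xinj_obj by auto
  have "cexact (bobj Q) x y" if t: "xt3 A B C x y \<delta>" for A B C x y \<delta>
  proof (rule cexact_biprod[OF _ _ assms(3) obs])
    show "cexact I x y" "cexact I' x y" using assms(1,2) t unfolding xinj_iff by blast+
  qed (use etriD[OF xtri_etri[OF t]] in auto)
  then show ?thesis using biprodD(1)[OF assms(3) obs] unfolding xinj_iff by blast
qed

lemma complete_xinj_coresI:
  assumes X: "\<And>n. X n \<in> xinj \<C> \<xi>"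
    and r: "\<And>n. xt3 (K (n + 1)) (X n) (K n) (g n) (f n) (\<rho> n)"
    and v: "\<And>n W. W \<in> xinj \<C> \<xi> \<Longrightarrow> vexact W (g n) (f n)"
    and d: "\<And>n. d n = g (n - 1) \<cdot> f n"
  shows "complete_xinj_cores \<C> \<xi> X d K"
proof -
  note tr = etriD(1-9)[OF xtri_etri[OF r]]
  have gm: "arr (g (n - 1))" "dm (g (n - 1)) = K n" "cd (g (n - 1)) = X (n - 1)" for n
    using tr(4-6)[of "n - 1"] by simp_all
  note [simp] = tr gm
  have "d n \<cdot> d (n + 1) = zer (X (n + 1)) (X (n - 1))" for n
    using cmp_reduce[OF etri_cmp_zer[OF xtri_etri[OF r[of n]]], of "f (n + 1)"] by (simp add: d)
  moreover have "d n \<in> mor \<C> (X n) (X (n - 1))" for n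
    using arr_cmp[of "f n" "g (n - 1)"] by (simp add: d mor_iff)
  moreover have "cov_exact \<C> (xinj \<C> \<xi>) (K (n + 1)) (X n) (K n) (g n) (f n)" for n
    using cov_exact_iff[OF xtri_etri[OF r] xinj_obj] v by blast
  ultimately show ?thesis using X r d unfolding complete_xinj_cores_def by blast
qed

lemma complete_xinj_coresE:
  assumes "complete_xinj_cores \<C> \<xi> X d K"
  obtains g f \<rho> where "\<And>n. X n \<in> xinj \<C> \<xi>"
    "\<And>n. xt3 (K (n + 1)) (X n) (K n) (g n) (f n) (\<rho> n)"
    "\<And>n W. W \<in> xinj \<C> \<xi> \<Longrightarrow> vexact W (g n) (f n)"
proof -
  obtain g f \<rho> where *: "\<And>n. X n \<in> xinj \<C> \<xi>"
    "\<And>n. xt3 (K (n + 1)) (X n) (K n) (g n) (f n) (\<rho> n)"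
    "\<And>n. cov_exact \<C> (xinj \<C> \<xi>) (K (n + 1)) (X n) (K n) (g n) (f n)"
    using assms unfolding complete_xinj_cores_def by blast
  then show ?thesis using that[of g f \<rho>] cov_exact_iff[OF xtri_etri[OF *(2)] xinj_obj] by blast
qed

text \<open>Shifting the indices puts \<open>M\<close> in degree 0. Two coresolutions can then be
  added degreewise with their chosen objects in the same degree.\<close>

lemma GI_E:
  assumes "M \<in> GIs"
  obtains X K g f \<rho> where "\<And>n. X n \<in> xinj \<C> \<xi>"
    "\<And>n. xt3 (K (n + 1)) (X n) (K n) (g n) (f n) (\<rho> n)"
    "\<And>n W. W \<in> xinj \<C> \<xi> \<Longrightarrow> vexact W (g n) (f n)"
    "M = K (0::int)"
proof -
  obtain X d K n where c: "complete_xinj_cores \<C> \<xi> X d K" and M: "M = K n"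
    using assms unfolding GI_def by blast
  obtain g f \<rho> where *: "\<And>n. X n \<in> xinj \<C> \<xi>"
    "\<And>n. xt3 (K (n + 1)) (X n) (K n) (g n) (f n) (\<rho> n)"
    "\<And>n W. W \<in> xinj \<C> \<xi> \<Longrightarrow> vexact W (g n) (f n)"
    by (rule complete_xinj_coresE[OF c]) blast
  have "xt3 (K (i + 1 + n)) (X (i + n)) (K (i + n)) (g (i + n)) (f (i + n)) (\<rho> (i + n))" for i
    using *(2)[of "i + n"] by (simp add: algebra_simps)
  then show ?thesis
    using that[of "\<lambda>i. X (i + n)" "\<lambda>i. K (i + n)" "\<lambda>i. g (i + n)" "\<lambda>i. f (i + n)" "\<lambda>i. \<rho> (i + n)"] * M
    by simp
qed

lemma GI_obj: "GIs \<subseteq> obj \<C>"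
proof
  fix M assume "M \<in> GIs"
  then obtain X K g f \<rho> where t: "\<And>n. xt3 (K (n + 1)) (X n) (K n) (g n) (f n) (\<rho> n)" "M = K (0::int)"
    by (rule GI_E) blast
  show "M \<in> obj \<C>" unfolding t(2) by (rule etriD(3)[OF xtri_etri[OF t(1)]])
qed

lemma GI_biprod:
  assumes M: "M \<in> GIs" and M': "M' \<in> GIs" and Q: "is_biprod \<C> M M' Q"
  shows "bobj Q \<in> GIs"
proof -
  obtain X K g f \<rho> where 1: "\<And>n. X n \<in> xinj \<C> \<xi>"
    "\<And>n. xt3 (K (n + 1)) (X n) (K n) (g n) (f n) (\<rho> n)"
    "\<And>n W. W \<in> xinj \<C> \<xi> \<Longrightarrow> vexact W (g n) (f n)" "M = K (0::int)"
    by (rule GI_E[OF M]) blast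
  obtain X' K' g' f' \<rho>' where 2: "\<And>n. X' n \<in> xinj \<C> \<xi>"
    "\<And>n. xt3 (K' (n + 1)) (X' n) (K' n) (g' n) (f' n) (\<rho>' n)"
    "\<And>n W. W \<in> xinj \<C> \<xi> \<Longrightarrow> vexact W (g' n) (f' n)" "M' = K' (0::int)"
    by (rule GI_E[OF M']) blast
  note t1 = etriD[OF xtri_etri[OF 1(2)]] and t2 = etriD[OF xtri_etri[OF 2(2)]]
  have "\<forall>n. \<exists>P. is_biprod \<C> (X n) (X' n) P" using biproducts t1(2) t2(2) by blast
  then obtain P where P: "\<And>n. is_biprod \<C> (X n) (X' n) (P n)" by metis
  have "\<forall>n. \<exists>P. is_biprod \<C> (K n) (K' n) P" using biproducts t1(3) t2(3) by blast
  then obtain R0 where R0: "\<And>n. is_biprod \<C> (K n) (K' n) (R0 n)" by metis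
  \<comment> \<open>The claim concerns the given biproduct \<open>Q\<close>, so \<open>Q\<close>
    must be the one used in degree 0.\<close>
  define R where "R = R0(0 := Q)"
  have R: "is_biprod \<C> (K n) (K' n) (R n)" for n using R0 Q 1(4) 2(4) by (simp add: R_def)
  \<comment> \<open>The index \<open>n - 1 + 1\<close> is the shape in which the source of the
    inclusion at stage \<open>n - 1\<close> occurs in \<open>complete_xinj_coresI\<close>.\<close>
  have "complete_xinj_cores \<C> \<xi> (\<lambda>n. bobj (P n))
    (\<lambda>n. mor_sum \<C> (R (n - 1 + 1)) (P (n - 1)) (g (n - 1)) (g' (n - 1)) \<cdot> mor_sum \<C> (P n) (R n) (f n) (f' n))
    (\<lambda>n. bobj (R n))"
  proof (rule complete_xinj_coresI)
    show "bobj (P n) \<in> xinj \<C> \<xi>" for n by (rule xinj_biprod[OF 1(1) 2(1) P])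
    show "xt3 (bobj (R (n + 1))) (bobj (P n)) (bobj (R n)) (mor_sum \<C> (R (n + 1)) (P n) (g n) (g' n))
      (mor_sum \<C> (P n) (R n) (f n) (f' n)) (ext_sum \<C> (R (n + 1)) (R n) (\<rho> n) (\<rho>' n))" for n
      by (rule xtri_sum[OF 1(2) 2(2) R P R])
    show "vexact W (mor_sum \<C> (R (n + 1)) (P n) (g n) (g' n)) (mor_sum \<C> (P n) (R n) (f n) (f' n))"
      if W: "W \<in> xinj \<C> \<xi>" for n W
      by (rule vexact_sum[OF 1(3)[OF W] 2(3)[OF W] _ t1(4-9) t2(4-9) R P R]) (use W xinj_obj in blast)
  qed simp
  then show ?thesis unfolding GI_def using R_def by (auto intro!: exI[of _ 0] exI)
qed

lemma GI_exact_iff: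
  assumes "etri \<C> A B C x y \<delta>"
  shows "contra_exact \<C> GIs A B C x y \<longleftrightarrow> (\<forall>W \<in> GIs. cexact W x y)"
  by (rule contra_exact_iff[OF assms GI_obj])

section \<open>Proper coresolutions and their splice\<close>

lemma proper_coresE:
  assumes "proper_GI_cores \<C> \<xi> B H"
  obtains L g f \<rho> where "\<And>i. cobj H i \<in> GIs" "L 0 = B" "caug H = g 0"
    "\<And>i. xt3 (L i) (cobj H i) (L (Suc i)) (g i) (f i) (\<rho> i)"
    "\<And>i W. W \<in> GIs \<Longrightarrow> cexact W (g i) (f i)"
    "\<And>i. cdiff H i = g (Suc i) \<cdot> f i"
proof -
  obtain L g f \<rho> where *: "\<And>i. cobj H i \<in> GIs" "L 0 = B" "caug H = g 0"
    "\<And>i. xt3 (L i) (cobj H i) (L (Suc i)) (g i) (f i) (\<rho> i)"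
    "\<And>i. contra_exact \<C> GIs (L i) (cobj H i) (L (Suc i)) (g i) (f i)"
    "\<And>i. cdiff H i = g (Suc i) \<cdot> f i"
    using assms unfolding proper_GI_cores_def by blast
  have "cexact W (g i) (f i)" if "W \<in> GIs" for W i
    using GI_exact_iff[OF xtri_etri[OF *(4)]] *(5) that by blast
  then show ?thesis using that[OF *(1-4) _ *(6)] by blast
qed

lemma proper_coresI:
  assumes "\<And>i. cobj H i \<in> GIs" "L 0 = B" "caug H = g 0"
    and t: "\<And>i. xt3 (L i) (cobj H i) (L (Suc i)) (g i) (f i) (\<rho> i)"
    and ce: "\<And>i W. W \<in> GIs \<Longrightarrow> cexact W (g i) (f i)"
    and d: "\<And>i. cdiff H i = g (Suc i) \<cdot> f i"
  shows "proper_GI_cores \<C> \<xi> B H"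
proof -
  note e = xtri_etri[OF t]
  note [simp] = etriD(1-9)[OF e]
  have [simp]: "B \<in> obj \<C>" using etriD(1)[OF e[of 0]] assms(2) by simp
  have "cdiff H i \<in> mor \<C> (cobj H i) (cobj H (Suc i))" for i by (simp add: d mor_iff)
  moreover have "cdiff H 0 \<cdot> caug H = zer B (cobj H 1)"
    using etri_cmp_zer[OF e[of 0]] by (simp add: d assms(2,3))
  moreover have "cdiff H (Suc i) \<cdot> cdiff H i = zer (cobj H i) (cobj H (Suc (Suc i)))" for i
    using cmp_reduce[OF etri_cmp_zer[OF e[of "Suc i"]], of "f i"] by (simp add: d)
  moreover have "caug H \<in> mor \<C> B (cobj H 0)" using assms(2,3) etriD(1,2,4-6)[OF e[of 0]] by (simp add: mor_iff)
  moreover have "contra_exact \<C> GIs (L i) (cobj H i) (L (Suc i)) (g i) (f i)" for i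
    using GI_exact_iff[OF e] ce by blast
  ultimately show ?thesis using assms(1-3) t d unfolding proper_GI_cores_def by blast
qed

lemma horseshoe:
  assumes xi: "xt3 A B C x y \<delta>" "\<And>W. W \<in> GIs \<Longrightarrow> cexact W x y"
    and HA: "proper_GI_cores \<C> \<xi> A HA" and HC: "proper_GI_cores \<C> \<xi> C HC"
  obtains HM Q where "proper_GI_cores \<C> \<xi> B HM" "\<And>i. is_biprod \<C> (cobj HA i) (cobj HC i) (Q i)"
    "\<And>i. cobj HM i = bobj (Q i)"
    "caug HM \<cdot> x = in1 (Q 0) \<cdot> caug HA" "pr2 (Q 0) \<cdot> caug HM = caug HC \<cdot> y"
    "\<And>i. cdiff HM i \<cdot> in1 (Q i) = in1 (Q (Suc i)) \<cdot> cdiff HA i"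
    "\<And>i. pr2 (Q (Suc i)) \<cdot> cdiff HM i = cdiff HC i \<cdot> pr2 (Q i)"
proof -
  obtain L g f \<rho> where 1: "\<And>i. cobj HA i \<in> GIs" "L 0 = A" "caug HA = g 0"
    "\<And>i. xt3 (L i) (cobj HA i) (L (Suc i)) (g i) (f i) (\<rho> i)"
    "\<And>i W. W \<in> GIs \<Longrightarrow> cexact W (g i) (f i)" "\<And>i. cdiff HA i = g (Suc i) \<cdot> f i"
    by (rule proper_coresE[OF HA]) blast
  obtain L' g' f' \<rho>' where 2: "\<And>i. cobj HC i \<in> GIs" "L' 0 = C" "caug HC = g' 0"
    "\<And>i. xt3 (L' i) (cobj HC i) (L' (Suc i)) (g' i) (f' i) (\<rho>' i)"
    "\<And>i W. W \<in> GIs \<Longrightarrow> cexact W (g' i) (f' i)" "\<And>i. cdiff HC i = g' (Suc i) \<cdot> f' i"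
    by (rule proper_coresE[OF HC]) blast
  have "\<forall>i. \<exists>P. is_biprod \<C> (cobj HA i) (cobj HC i) P" using biproducts 1(1) 2(1) GI_obj by blast
  then obtain Q where Q: "\<And>i. is_biprod \<C> (cobj HA i) (cobj HC i) (Q i)" by metis
  \<comment> \<open>A state is a triangle from the \<open>n\<close>-th cosyzygy of \<open>A\<close>
    to that of \<open>C\<close>; the given triangle is the state for \<open>n = 0\<close>.\<close>
  define good where "good = (\<lambda>n (M, x, y, \<delta>). xt3 (L n) M (L' n) x y \<delta> \<and> (\<forall>W \<in> GIs. cexact W x y))"
  define step where "step = (\<lambda>n (M, x, y, \<delta>::'e) (M', x', y', \<delta>'::'e) \<gamma> \<eta> \<theta>.
    xt3 M (bobj (Q n)) M' \<gamma> \<eta> \<theta> \<and> (\<forall>W \<in> GIs. cexact W \<gamma> \<eta>) \<and> \<gamma> \<cdot> x = in1 (Q n) \<cdot> g n \<and>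
    pr2 (Q n) \<cdot> \<gamma> = g' n \<cdot> y \<and> \<eta> \<cdot> in1 (Q n) = x' \<cdot> f n \<and> y' \<cdot> \<eta> = f' n \<cdot> pr2 (Q n))"
  \<comment> \<open>The clause for \<open>n = 0\<close> pins the initial state, which the choice
    principle alone would leave arbitrary.\<close>
  have "\<exists>s. \<forall>n. (good n (s n) \<and> (n = 0 \<longrightarrow> s n = (B, x, y, \<delta>))) \<and> (\<exists>\<gamma> \<eta> \<theta>. step n (s n) (s (Suc n)) \<gamma> \<eta> \<theta>)"
  proof (rule dependent_nat_choice)
    show "\<exists>s. good 0 s \<and> (0 = (0::nat) \<longrightarrow> s = (B, x, y, \<delta>))"
      using xi by (intro exI[of _ "(B, x, y, \<delta>)"]) (simp add: good_def 1(2) 2(2))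
  next
    fix s n assume s: "good n s \<and> (n = 0 \<longrightarrow> s = (B, x, y, \<delta>))"
    obtain M u v \<epsilon> where sM: "s = (M, u, v, \<epsilon>)" by (cases s)
    then have i: "xt3 (L n) M (L' n) u v \<epsilon>" "\<And>W. W \<in> GIs \<Longrightarrow> cexact W u v" using s by (auto simp: good_def)
    obtain M' \<gamma> \<eta> \<theta> d e \<epsilon>' where
      "xt3 M (bobj (Q n)) M' \<gamma> \<eta> \<theta>" "\<And>W. W \<in> GIs \<Longrightarrow> cexact W \<gamma> \<eta>"
      "xt3 (L (Suc n)) M' (L' (Suc n)) d e \<epsilon>'" "\<And>W. W \<in> GIs \<Longrightarrow> cexact W d e"
      "\<gamma> \<cdot> u = in1 (Q n) \<cdot> g n" "pr2 (Q n) \<cdot> \<gamma> = g' n \<cdot> v"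
      "\<eta> \<cdot> in1 (Q n) = d \<cdot> f n" "e \<cdot> \<eta> = f' n \<cdot> pr2 (Q n)"
      by (rule horseshoe_step[OF i(1) 1(4) 2(4) GI_obj 1(1) i(2) 1(5) 2(5) Q]) blast+
    then have "good (Suc n) (M', d, e, \<epsilon>')" "step n s (M', d, e, \<epsilon>') \<gamma> \<eta> \<theta>"
      by (simp_all add: good_def step_def sM)
    then show "\<exists>s'. (good (Suc n) s' \<and> (Suc n = 0 \<longrightarrow> s' = (B, x, y, \<delta>))) \<and> (\<exists>\<gamma> \<eta> \<theta>. step n s s' \<gamma> \<eta> \<theta>)"
      by blast
  qed
  then obtain s where s: "\<And>n. good n (s n)" "s 0 = (B, x, y, \<delta>)"
    "\<forall>n. \<exists>\<gamma> \<eta> \<theta>. step n (s n) (s (Suc n)) \<gamma> \<eta> \<theta>" by blast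
  then obtain \<gamma> \<eta> \<theta> where st: "\<And>n. step n (s n) (s (Suc n)) (\<gamma> n) (\<eta> n) (\<theta> n)" by metis
  define M where "M n = fst (s n)" for n
  define u where "u n = fst (snd (s n))" for n
  define v where "v n = fst (snd (snd (s n)))" for n
  have M0: "M 0 = B" "u 0 = x" "v 0 = y" using s(2) by (simp_all add: M_def u_def v_def)
  have r: "xt3 (M n) (bobj (Q n)) (M (Suc n)) (\<gamma> n) (\<eta> n) (\<theta> n)"
    "\<And>W. W \<in> GIs \<Longrightarrow> cexact W (\<gamma> n) (\<eta> n)" "\<gamma> n \<cdot> u n = in1 (Q n) \<cdot> g n"
    "pr2 (Q n) \<cdot> \<gamma> n = g' n \<cdot> v n" "\<eta> n \<cdot> in1 (Q n) = u (Suc n) \<cdot> f n"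
    "v (Suc n) \<cdot> \<eta> n = f' n \<cdot> pr2 (Q n)" for n
    using st[of n] unfolding step_def M_def u_def v_def by (simp_all add: case_prod_unfold)
  have i: "xt3 (L n) (M n) (L' n) (u n) (v n) (snd (snd (snd (s n))))" for n
    using s(1)[of n] unfolding good_def M_def u_def v_def by (simp add: case_prod_unfold)
  \<comment> \<open>The triangles \<open>M n \<rightarrow> Q n \<rightarrow> M (Suc n)\<close> are
    the resolution triangles, so the differential passes through \<open>M (Suc n)\<close>.\<close>
  let ?H = "\<lparr>caug = \<gamma> 0, cobj = (\<lambda>n. bobj (Q n)), cdiff = (\<lambda>n. \<gamma> (Suc n) \<cdot> \<eta> n)\<rparr>"
  have p: "proper_GI_cores \<C> \<xi> B ?H"
  proof (rule proper_coresI[where L = M and g = \<gamma> and f = \<eta> and \<rho> = \<theta>])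
    show "cobj ?H i \<in> GIs" for i using GI_biprod[OF 1(1) 2(1) Q] by simp
  qed (use r(1,2) M0 in simp_all)
  note [simp] = etriD(1-9)[OF xtri_etri[OF 1(4)]] etriD(1-9)[OF xtri_etri[OF 2(4)]]
    etriD(1-9)[OF xtri_etri[OF r(1)]] etriD(1-9)[OF xtri_etri[OF i]]
  note [simp] = biprodD[OF Q etriD(2)[OF xtri_etri[OF 1(4)]] etriD(2)[OF xtri_etri[OF 2(4)]]]
  have a: "cdiff ?H i \<cdot> in1 (Q i) = in1 (Q (Suc i)) \<cdot> cdiff HA i" for i
    by (simp add: r(5) 1(6) cmp_reduce[OF r(3)])
  have b: "pr2 (Q (Suc i)) \<cdot> cdiff ?H i = cdiff HC i \<cdot> pr2 (Q i)" for i
    by (simp add: 2(6) cmp_reduce[OF r(4)] r(6))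
  show ?thesis
    using that[OF p Q _ _ _ a b] r(3,4)[of 0] M0 1(3) 2(3) by simp
qed

end

section \<open>Cohomology and comparison of coresolutions\<close>

context additive_category
begin

text \<open>The augmentation is left out because cohomology is taken of the deleted complex.\<close>

definition cpx where
  "cpx H \<longleftrightarrow> (\<forall>i. cobj H i \<in> obj \<C> \<and> arr (cdiff H i) \<and> dm (cdiff H i) = cobj H i \<and>
     cd (cdiff H i) = cobj H (Suc i) \<and> cdiff H (Suc i) \<cdot> cdiff H i = zer (cobj H i) (cobj H (Suc (Suc i))))"

lemma cpxD:
  assumes "cpx H"
  shows "cobj H i \<in> obj \<C>" "arr (cdiff H i)" "dm (cdiff H i) = cobj H i" "cd (cdiff H i) = cobj H (Suc i)"
    "cdiff H (Suc i) \<cdot> cdiff H i = zer (cobj H i) (cobj H (Suc (Suc i)))"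
    "\<lbrakk>arr k; cd k = cobj H i\<rbrakk> \<Longrightarrow> cdiff H (Suc i) \<cdot> (cdiff H i \<cdot> k) = zer (dm k) (cobj H (Suc (Suc i)))"
proof -
  show a: "cobj H i \<in> obj \<C>" "arr (cdiff H i)" "dm (cdiff H i) = cobj H i" "cd (cdiff H i) = cobj H (Suc i)"
    "cdiff H (Suc i) \<cdot> cdiff H i = zer (cobj H i) (cobj H (Suc (Suc i)))" for i
    using assms unfolding cpx_def by blast+
  show "\<lbrakk>arr k; cd k = cobj H i\<rbrakk> \<Longrightarrow> cdiff H (Suc i) \<cdot> (cdiff H i \<cdot> k) = zer (dm k) (cobj H (Suc (Suc i)))"
    by (subst cmp_reduce[OF a(5)[of i]]) (simp_all add: a(1-4))
qed

section \<open>Cocycles and coboundaries\<close>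

lemma cocycles_iff:
  assumes "cpx H" "X \<in> obj \<C>"
  shows "f \<in> cocycles \<C> H n X \<longleftrightarrow>
    arr f \<and> dm f = X \<and> cd f = cobj H n \<and> cdiff H n \<cdot> f = zer X (cobj H (Suc n))"
  using assms cpxD[OF assms(1)] unfolding cocycles_def kernel_def by (auto simp: mor_iff)

lemma cobounds_0: "cobounds \<C> H 0 X = {zer X (cobj H 0)}"
  by (simp add: cobounds_def)

lemma cobounds_Suc:
  assumes "cpx H" "X \<in> obj \<C>"
  shows "f \<in> cobounds \<C> H (Suc m) X \<longleftrightarrow> (\<exists>u. arr u \<and> dm u = X \<and> cd u = cobj H m \<and> f = cdiff H m \<cdot> u)"
  using assms cpxD(1)[OF assms(1)] unfolding cobounds_def by (auto simp: mor_iff)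

lemma cobounds_arr:
  assumes "cpx H" "X \<in> obj \<C>" "f \<in> cobounds \<C> H n X"
  shows "arr f" "dm f = X" "cd f = cobj H n"
  using assms cpxD[OF assms(1)] by (cases n; auto simp: cobounds_0 cobounds_Suc)+

lemma cobounds_cocycles:
  assumes "cpx H" "X \<in> obj \<C>" "f \<in> cobounds \<C> H n X"
  shows "f \<in> cocycles \<C> H n X"
  using assms cpxD[OF assms(1)] by (cases n) (auto simp: cobounds_0 cobounds_Suc cocycles_iff)

lemma zer_cocycle: "\<lbrakk>cpx H; X \<in> obj \<C>\<rbrakk> \<Longrightarrow> zer X (cobj H n) \<in> cocycles \<C> H n X"
  using cpxD[of H] by (simp add: cocycles_iff)

lemma zer_cobound: "\<lbrakk>cpx H; X \<in> obj \<C>\<rbrakk> \<Longrightarrow> zer X (cobj H n) \<in> cobounds \<C> H n X"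
proof (cases n)
  case (Suc m)
  assume "cpx H" "X \<in> obj \<C>"
  then show ?thesis using cpxD[of H] Suc by (auto simp: cobounds_Suc intro!: exI[of _ "zer X (cobj H m)"])
qed (simp add: cobounds_0)

lemma cobounds_add:
  assumes "cpx H" "X \<in> obj \<C>" "f \<in> cobounds \<C> H n X" "g \<in> cobounds \<C> H n X"
  shows "f \<boxplus> g \<in> cobounds \<C> H n X"
proof (cases n)
  case (Suc m)
  obtain u v where "arr u" "dm u = X" "cd u = cobj H m" "f = cdiff H m \<cdot> u"
    "arr v" "dm v = X" "cd v = cobj H m" "g = cdiff H m \<cdot> v"
    using assms Suc by (auto simp: cobounds_Suc)
  then show ?thesis
    using Suc assms(1,2) cpxD[OF assms(1)] by (auto simp: cobounds_Suc intro!: exI[of _ "u \<boxplus> v"])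
qed (use assms cpxD[OF assms(1)] in \<open>auto simp: cobounds_0\<close>)

lemma cobounds_neg:
  assumes "cpx H" "X \<in> obj \<C>" "f \<in> cobounds \<C> H n X"
  shows "neg f \<in> cobounds \<C> H n X"
proof (cases n)
  case (Suc m)
  obtain u where "arr u" "dm u = X" "cd u = cobj H m" "f = cdiff H m \<cdot> u"
    using assms Suc by (auto simp: cobounds_Suc)
  then show ?thesis
    using Suc assms(1,2) cpxD[OF assms(1)] by (auto simp: cobounds_Suc intro!: exI[of _ "neg u"])
qed (use assms cpxD[OF assms(1)] in \<open>auto simp: cobounds_0\<close>)

lemma cocycles_add:
  assumes "cpx H" "X \<in> obj \<C>" "f \<in> cocycles \<C> H n X" "g \<in> cocycles \<C> H n X"
  shows "f \<boxplus> g \<in> cocycles \<C> H n X"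
  using assms cpxD[OF assms(1)] by (auto simp: cocycles_iff)

lemma cocycles_neg:
  assumes "cpx H" "X \<in> obj \<C>" "f \<in> cocycles \<C> H n X"
  shows "neg f \<in> cocycles \<C> H n X"
  using assms cpxD[OF assms(1)] by (auto simp: cocycles_iff)

section \<open>Cohomology classes, their groups and induced maps\<close>

abbreviation coh where "coh \<equiv> coh_class \<C>"

text \<open>This trades cosets for differences of arrows, so that later arguments stay inside the
  arrow calculus.\<close>

lemma mem_coh_iff:
  assumes H: "cpx H" "X \<in> obj \<C>" and f: "f \<in> cocycles \<C> H n X"
  shows "h \<in> coh H n X f \<longleftrightarrow> arr h \<and> dm h = X \<and> cd h = cobj H n \<and> h \<boxplus> neg f \<in> cobounds \<C> H n X"
proof -
  note b = cobounds_arr[OF H]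
  have f' [simp]: "arr f" "dm f = X" "cd f = cobj H n" using f cocycles_iff[OF H] by auto
  have "h \<in> coh H n X f \<longleftrightarrow> (\<exists>b \<in> cobounds \<C> H n X. h = b \<otimes>\<^bsub>Mor \<C> X (cobj H n)\<^esub> f)"
    unfolding coh_class_def r_coset_def by blast
  also have "\<dots> \<longleftrightarrow> (\<exists>b \<in> cobounds \<C> H n X. h = b \<boxplus> f)"
    using b unfolding add_def by (metis (no_types))
  also have "\<dots> \<longleftrightarrow> arr h \<and> dm h = X \<and> cd h = cobj H n \<and> h \<boxplus> neg f \<in> cobounds \<C> H n X"
  proof (intro iffI; elim bexE conjE)
    fix c assume c: "c \<in> cobounds \<C> H n X" "h = c \<boxplus> f"
    have "(c \<boxplus> f) \<boxplus> neg f = c" using b[OF c(1)] by (simp add: add_assoc')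
    then show "arr h \<and> dm h = X \<and> cd h = cobj H n \<and> h \<boxplus> neg f \<in> cobounds \<C> H n X"
      using b[OF c(1)] c by simp
  next
    assume h: "arr h" "dm h = X" "cd h = cobj H n" "h \<boxplus> neg f \<in> cobounds \<C> H n X"
    have "(h \<boxplus> neg f) \<boxplus> f = h" using h(1-3) by (simp add: add_assoc')
    then show "\<exists>b \<in> cobounds \<C> H n X. h = b \<boxplus> f" using h(4) by metis
  qed
  finally show ?thesis .
qed

lemma coh_self:
  assumes H: "cpx H" "X \<in> obj \<C>" and f: "f \<in> cocycles \<C> H n X"
  shows "f \<in> coh H n X f"
proof -
  have "arr f" "dm f = X" "cd f = cobj H n" using f cocycles_iff[OF H] by auto
  then show ?thesis using mem_coh_iff[OF H f] zer_cobound[OF H] by auto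
qed

lemma coh_eq_iff:
  assumes H: "cpx H" "X \<in> obj \<C>" and f: "f \<in> cocycles \<C> H n X" and g: "g \<in> cocycles \<C> H n X"
  shows "coh H n X f = coh H n X g \<longleftrightarrow> f \<boxplus> neg g \<in> cobounds \<C> H n X"
proof
  have f' [simp]: "arr f" "dm f = X" "cd f = cobj H n" using f cocycles_iff[OF H] by auto
  have g' [simp]: "arr g" "dm g = X" "cd g = cobj H n" using g cocycles_iff[OF H] by auto
  show "f \<boxplus> neg g \<in> cobounds \<C> H n X" if "coh H n X f = coh H n X g"
    using that coh_self[OF H f] mem_coh_iff[OF H g] by auto
  assume e: "f \<boxplus> neg g \<in> cobounds \<C> H n X"
  have "h \<boxplus> neg f \<in> cobounds \<C> H n X \<longleftrightarrow> h \<boxplus> neg g \<in> cobounds \<C> H n X"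
    if [simp]: "arr h" "dm h = X" "cd h = cobj H n" for h
  proof
    assume "h \<boxplus> neg f \<in> cobounds \<C> H n X"
    moreover have "(h \<boxplus> neg f) \<boxplus> (f \<boxplus> neg g) = h \<boxplus> neg g" by (simp add: add_assoc')
    ultimately show "h \<boxplus> neg g \<in> cobounds \<C> H n X" using cobounds_add[OF H _ e] by metis
  next
    assume "h \<boxplus> neg g \<in> cobounds \<C> H n X"
    moreover have "(h \<boxplus> neg g) \<boxplus> neg (f \<boxplus> neg g) = h \<boxplus> neg f"
      using add_comm[of "neg f" g] by (simp add: add_assoc')
    ultimately show "h \<boxplus> neg f \<in> cobounds \<C> H n X"
      using cobounds_add[OF H _ cobounds_neg[OF H e]] by metis
  qed
  then show "coh H n X f = coh H n X g"
    using mem_coh_iff[OF H f] mem_coh_iff[OF H g] by blast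
qed

lemma coh_zer_iff:
  assumes H: "cpx H" "X \<in> obj \<C>" and f: "f \<in> cocycles \<C> H n X"
  shows "coh H n X f = coh H n X (zer X (cobj H n)) \<longleftrightarrow> f \<in> cobounds \<C> H n X"
proof -
  have "arr f" "dm f = X" "cd f = cobj H n" using f cocycles_iff[OF H] by auto
  then show ?thesis using coh_eq_iff[OF H f zer_cocycle[OF H]] cpxD(1)[OF H(1)] H(2) by simp
qed

lemma xt_group:
  assumes H: "cpx H" "X \<in> obj \<C>"
  shows "group (xt \<C> H n X)"
    and "carrier (xt \<C> H n X) = coh H n X ` cocycles \<C> H n X"
    and "\<one>\<^bsub>xt \<C> H n X\<^esub> = coh H n X (zer X (cobj H n))"
    and "\<And>f g. \<lbrakk>f \<in> cocycles \<C> H n X; g \<in> cocycles \<C> H n X\<rbrakk> \<Longrightarrow>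
      coh H n X f \<otimes>\<^bsub>xt \<C> H n X\<^esub> coh H n X g = coh H n X (f \<boxplus> g)"
proof -
  let ?M = "Mor \<C> X (cobj H n)"
  let ?Z = "?M\<lparr>carrier := cocycles \<C> H n X\<rparr>"
  interpret M: comm_group ?M using Mor_group cpxD(1)[OF H(1)] H(2) by blast
  have Zs: "subgroup (cocycles \<C> H n X) ?M"
    using group_hom.subgroup_kernel[OF postcomp_hom[OF cpxD(2)[OF H(1)] H(2)], of n] cpxD(3,4)[OF H(1)]
    unfolding cocycles_def by simp
  have "comm_group ?Z"
    by (rule group.group_comm_groupI[OF subgroup.subgroup_is_group[OF Zs M.is_group]])
       (use subgroup.subset[OF Zs] M.m_comm in auto)
  then interpret Z: comm_group ?Z .
  have add: "f \<otimes>\<^bsub>?M\<^esub> g = f \<boxplus> g" if "f \<in> cocycles \<C> H n X" for f g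
    using that cocycles_iff[OF H] unfolding add_def by metis
  have inv: "inv\<^bsub>?Z\<^esub> f = neg f" if f: "f \<in> cocycles \<C> H n X" for f
  proof -
    have "inv\<^bsub>?Z\<^esub> f = inv\<^bsub>?M\<^esub> f" by (rule M.m_inv_consistent[OF Zs f])
    then show ?thesis using f cocycles_iff[OF H] unfolding neg_def by metis
  qed
  have "subgroup (cobounds \<C> H n X) ?Z"
  proof (rule Z.subgroupI)
    show "cobounds \<C> H n X \<subseteq> carrier ?Z" using cobounds_cocycles[OF H] by auto
    show "cobounds \<C> H n X \<noteq> {}" using zer_cobound[OF H] by blast
    show "inv\<^bsub>?Z\<^esub> f \<in> cobounds \<C> H n X" if "f \<in> cobounds \<C> H n X" for f
      using inv[OF cobounds_cocycles[OF H that]] cobounds_neg[OF H that] by simp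
    show "f \<otimes>\<^bsub>?Z\<^esub> g \<in> cobounds \<C> H n X" if "f \<in> cobounds \<C> H n X" "g \<in> cobounds \<C> H n X" for f g
      using add[OF cobounds_cocycles[OF H that(1)]] cobounds_add[OF H that] by simp
  qed
  then have N: "cobounds \<C> H n X \<lhd> ?Z" by (rule Z.subgroup_imp_normal)
  have coset: "cobounds \<C> H n X #>\<^bsub>?Z\<^esub> f = coh H n X f" for f
    unfolding coh_class_def r_coset_def by simp
  show "group (xt \<C> H n X)" unfolding xt_def by (rule normal.factorgroup_is_group[OF N])
  show "carrier (xt \<C> H n X) = coh H n X ` cocycles \<C> H n X"
    unfolding xt_def carrier_FactGroup coset by simp
  show "coh H n X f \<otimes>\<^bsub>xt \<C> H n X\<^esub> coh H n X g = coh H n X (f \<boxplus> g)"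
    if fg: "f \<in> cocycles \<C> H n X" "g \<in> cocycles \<C> H n X" for f g
    using normal.rcos_sum[OF N, of f g] fg add[OF fg(1), of g] unfolding xt_def coset by simp
  have "\<one>\<^bsub>xt \<C> H n X\<^esub> = cobounds \<C> H n X" unfolding xt_def by simp
  also have "\<dots> = coh H n X (zer X (cobj H n))"
    unfolding coh_class_def
    using M.coset_mult_one cobounds_cocycles[OF H] subgroup.subset[OF Zs] by blast
  finally show "\<one>\<^bsub>xt \<C> H n X\<^esub> = coh H n X (zer X (cobj H n))" .
qed

text \<open>The two degrees are independent, so that components of chain maps and the degree-raising
  \<open>tau\<close> are covered alike.\<close>

definition cmap where
  "cmap X H n H' n' t \<longleftrightarrow> arr t \<and> dm t = cobj H n \<and> cd t = cobj H' n' \<and>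
     (\<forall>f \<in> cocycles \<C> H n X. t \<cdot> f \<in> cocycles \<C> H' n' X) \<and>
     (\<forall>f \<in> cobounds \<C> H n X. t \<cdot> f \<in> cobounds \<C> H' n' X)"

lemma cmapD:
  assumes "cmap X H n H' n' t"
  shows "arr t" "dm t = cobj H n" "cd t = cobj H' n'"
    "f \<in> cocycles \<C> H n X \<Longrightarrow> t \<cdot> f \<in> cocycles \<C> H' n' X"
    "f \<in> cobounds \<C> H n X \<Longrightarrow> t \<cdot> f \<in> cobounds \<C> H' n' X"
  using assms unfolding cmap_def by blast+

lemma cmap_coh:
  assumes H: "cpx H" "cpx H'" "X \<in> obj \<C>" and t: "cmap X H n H' n' t"
    and f: "f \<in> cocycles \<C> H n X" "g \<in> cocycles \<C> H n X" "coh H n X f = coh H n X g"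
  shows "coh H' n' X (t \<cdot> f) = coh H' n' X (t \<cdot> g)"
proof -
  have [simp]: "arr f" "dm f = X" "cd f = cobj H n" "arr g" "dm g = X" "cd g = cobj H n"
    using f cocycles_iff[OF H(1,3)] by auto
  note [simp] = cmapD(1-3)[OF t]
  have "f \<boxplus> neg g \<in> cobounds \<C> H n X" using f coh_eq_iff[OF H(1,3)] by blast
  from cmapD(5)[OF t this] have "t \<cdot> f \<boxplus> neg (t \<cdot> g) \<in> cobounds \<C> H' n' X" by simp
  then show ?thesis using coh_eq_iff[OF H(2,3)] cmapD(4)[OF t] f by blast
qed

text \<open>The function on classes is kept apart from the arrow representing it:
  \<open>xt_map\<close> is defined through \<open>the_elem\<close> over all lifts and the connecting
  map by choice, but only their effect on classes of cocycles matters.\<close>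

definition induces where
  "induces X H n H' n' t F \<longleftrightarrow>
     cmap X H n H' n' t \<and> (\<forall>f \<in> cocycles \<C> H n X. F (coh H n X f) = coh H' n' X (t \<cdot> f))"

lemma induces_hom:
  assumes H: "cpx H" "cpx H'" "X \<in> obj \<C>" and F: "induces X H n H' n' t F"
  shows "F \<in> hom (xt \<C> H n X) (xt \<C> H' n' X)"
proof (rule homI)
  have t: "cmap X H n H' n' t" and Ff: "\<And>f. f \<in> cocycles \<C> H n X \<Longrightarrow> F (coh H n X f) = coh H' n' X (t \<cdot> f)"
    using F unfolding induces_def by blast+
  note [simp] = cmapD(1-3)[OF t]
  fix K assume "K \<in> carrier (xt \<C> H n X)"
  then obtain f where f: "f \<in> cocycles \<C> H n X" "K = coh H n X f"
    unfolding xt_group(2)[OF H(1,3)] by blast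
  show "F K \<in> carrier (xt \<C> H' n' X)"
    unfolding f(2) Ff[OF f(1)] xt_group(2)[OF H(2,3)] using cmapD(4)[OF t f(1)] by blast
  fix K' assume "K' \<in> carrier (xt \<C> H n X)"
  then obtain g where g: "g \<in> cocycles \<C> H n X" "K' = coh H n X g"
    unfolding xt_group(2)[OF H(1,3)] by blast
  have "t \<cdot> (f \<boxplus> g) = t \<cdot> f \<boxplus> t \<cdot> g"
    using f(1) g(1) cocycles_iff[OF H(1,3)] by simp
  then show "F (K \<otimes>\<^bsub>xt \<C> H n X\<^esub> K') = F K \<otimes>\<^bsub>xt \<C> H' n' X\<^esub> F K'"
    unfolding f(2) g(2) xt_group(4)[OF H(1,3) f(1) g(1)] Ff[OF f(1)] Ff[OF g(1)]
      Ff[OF cocycles_add[OF H(1,3) f(1) g(1)]]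
      xt_group(4)[OF H(2,3) cmapD(4)[OF t f(1)] cmapD(4)[OF t g(1)]] by simp
qed

text \<open>Every class has a cocycle representative and being zero means being a coboundary, so
  kernel and image can be compared on cocycles.\<close>

lemma induces_exact:
  assumes H: "cpx H1" "cpx H2" "cpx H3" "X \<in> obj \<C>"
    and F: "induces X H1 n1 H2 n2 t F" and G: "induces X H2 n2 H3 n3 u G"
    and ex: "\<And>f. f \<in> cocycles \<C> H2 n2 X \<Longrightarrow>
      u \<cdot> f \<in> cobounds \<C> H3 n3 X \<longleftrightarrow> (\<exists>a \<in> cocycles \<C> H1 n1 X. coh H2 n2 X f = coh H2 n2 X (t \<cdot> a))"
  shows "exact_seq ([xt \<C> H3 n3 X, xt \<C> H2 n2 X, xt \<C> H1 n1 X], [G, F])"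
proof -
  have Ff: "\<And>f. f \<in> cocycles \<C> H1 n1 X \<Longrightarrow> F (coh H1 n1 X f) = coh H2 n2 X (t \<cdot> f)"
    and t: "cmap X H1 n1 H2 n2 t"
    and Gf: "\<And>f. f \<in> cocycles \<C> H2 n2 X \<Longrightarrow> G (coh H2 n2 X f) = coh H3 n3 X (u \<cdot> f)"
    and u: "cmap X H2 n2 H3 n3 u"
    using F G unfolding induces_def by blast+
  have "kernel (xt \<C> H2 n2 X) (xt \<C> H3 n3 X) G = F ` carrier (xt \<C> H1 n1 X)"
  proof (rule subset_antisym; rule subsetI)
    fix K assume "K \<in> kernel (xt \<C> H2 n2 X) (xt \<C> H3 n3 X) G"
    then obtain f where f: "f \<in> cocycles \<C> H2 n2 X" "K = coh H2 n2 X f"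
      and "G K = coh H3 n3 X (zer X (cobj H3 n3))"
      unfolding kernel_def xt_group(2)[OF H(2,4)] xt_group(3)[OF H(3,4)] by blast
    then have "u \<cdot> f \<in> cobounds \<C> H3 n3 X"
      using Gf coh_zer_iff[OF H(3,4) cmapD(4)[OF u f(1)]] by simp
    then obtain a where "a \<in> cocycles \<C> H1 n1 X" "coh H2 n2 X f = coh H2 n2 X (t \<cdot> a)"
      using ex[OF f(1)] by blast
    then show "K \<in> F ` carrier (xt \<C> H1 n1 X)"
      unfolding xt_group(2)[OF H(1,4)] using Ff f(2) by force
  next
    fix K assume "K \<in> F ` carrier (xt \<C> H1 n1 X)"
    then obtain a where a: "a \<in> cocycles \<C> H1 n1 X" "K = coh H2 n2 X (t \<cdot> a)"
      unfolding xt_group(2)[OF H(1,4)] using Ff by force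
    have z: "t \<cdot> a \<in> cocycles \<C> H2 n2 X" by (rule cmapD(4)[OF t a(1)])
    then have "u \<cdot> (t \<cdot> a) \<in> cobounds \<C> H3 n3 X" using ex a(1) by blast
    then show "K \<in> kernel (xt \<C> H2 n2 X) (xt \<C> H3 n3 X) G"
      unfolding kernel_def xt_group(2)[OF H(2,4)] xt_group(3)[OF H(3,4)] a(2)
      using Gf[OF z] z coh_zer_iff[OF H(3,4) cmapD(4)[OF u z]] by simp
  qed
  then show ?thesis
    using induces_hom[OF H(1,2,4) F] induces_hom[OF H(2,3,4) G] xt_group(1)[OF H(1,4)]
      xt_group(1)[OF H(2,4)] xt_group(1)[OF H(3,4)]
    by (simp add: group_hom_def group_hom_axioms_def)
qed

section \<open>Chain maps over a morphism\<close>

lemma liftsD: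
  assumes "lifts \<C> H H' b \<phi>" "cpx H" "cpx H'"
  shows "arr (\<phi> i)" "dm (\<phi> i) = cobj H i" "cd (\<phi> i) = cobj H' i"
    "\<phi> 0 \<cdot> caug H = caug H' \<cdot> b" "\<phi> (Suc i) \<cdot> cdiff H i = cdiff H' i \<cdot> \<phi> i"
  using assms(1) cpxD(1)[OF assms(2)] cpxD(1)[OF assms(3)] unfolding lifts_def by (auto simp: mor_iff)

lemma liftsI:
  assumes "cpx H" "cpx H'"
    "\<And>i. arr (\<phi> i)" "\<And>i. dm (\<phi> i) = cobj H i" "\<And>i. cd (\<phi> i) = cobj H' i"
    "\<phi> 0 \<cdot> caug H = caug H' \<cdot> b" "\<And>i. \<phi> (Suc i) \<cdot> cdiff H i = cdiff H' i \<cdot> \<phi> i"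
  shows "lifts \<C> H H' b \<phi>"
  using assms(3-) cpxD(1)[OF assms(1)] cpxD(1)[OF assms(2)] unfolding lifts_def by (auto simp: mor_iff)

text \<open>No augmentation enters, so the inclusions and projections of a degreewise split complex
  are covered as well.\<close>

lemma chain_map_cmap:
  assumes H: "cpx H" "cpx H'" "X \<in> obj \<C>"
    and \<phi>: "\<And>i. arr (\<phi> i)" "\<And>i. dm (\<phi> i) = cobj H i" "\<And>i. cd (\<phi> i) = cobj H' i"
      "\<And>i. \<phi> (Suc i) \<cdot> cdiff H i = cdiff H' i \<cdot> \<phi> i"
  shows "cmap X H n H' n (\<phi> n)"
proof -
  note [simp] = cpxD[OF H(1)] cpxD[OF H(2)] H(3) \<phi>(1-3)
  have "\<phi> n \<cdot> f \<in> cocycles \<C> H' n X" if f: "f \<in> cocycles \<C> H n X" for f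
  proof -
    have f' [simp]: "arr f" "dm f = X" "cd f = cobj H n" and z: "cdiff H n \<cdot> f = zer X (cobj H (Suc n))"
      using f cocycles_iff[OF H(1,3)] by auto
    have "cdiff H' n \<cdot> (\<phi> n \<cdot> f) = \<phi> (Suc n) \<cdot> (cdiff H n \<cdot> f)"
      by (subst cmp_reduce[OF \<phi>(4)]) simp_all
    then show ?thesis using z by (simp add: cocycles_iff[OF H(2,3)])
  qed
  moreover have "\<phi> n \<cdot> f \<in> cobounds \<C> H' n X" if f: "f \<in> cobounds \<C> H n X" for f
  proof (cases n)
    case 0
    then show ?thesis using f by (simp add: cobounds_0)
  next
    case (Suc m)
    then obtain u where u: "arr u" "dm u = X" "cd u = cobj H m" "f = cdiff H m \<cdot> u"
      using f cobounds_Suc[OF H(1,3)] by blast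
    note [simp] = u(1-3)
    have "\<phi> n \<cdot> f = cdiff H' m \<cdot> (\<phi> m \<cdot> u)"
      unfolding u(4) Suc by (subst cmp_reduce[OF \<phi>(4)]) simp_all
    then show ?thesis unfolding Suc cobounds_Suc[OF H(2,3)]
      by (intro exI[of _ "\<phi> m \<cdot> u"]) simp
  qed
  ultimately show ?thesis unfolding cmap_def by simp
qed

lemma lifts_cmap:
  assumes "cpx H" "cpx H'" "X \<in> obj \<C>" "lifts \<C> H H' b \<phi>"
  shows "cmap X H n H' n (\<phi> n)"
  by (rule chain_map_cmap[OF assms(1-3)]) (use liftsD[OF assms(4,1,2)] in blast)+

lemma lifts_comp:
  assumes H: "cpx H" "cpx H'" "cpx H''"
    and l: "lifts \<C> H H' b \<phi>" "lifts \<C> H' H'' b' \<psi>"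
    and "arr b" "arr b'" "dm b' = cd b" "arr (caug H)" "cd (caug H) = cobj H 0"
      "arr (caug H')" "dm (caug H') = cd b" "cd (caug H') = cobj H' 0"
      "arr (caug H'')" "dm (caug H'') = cd b'" "cd (caug H'') = cobj H'' 0"
  shows "lifts \<C> H H'' (b' \<cdot> b) (\<lambda>i. \<psi> i \<cdot> \<phi> i)"
proof -
  note p = liftsD[OF l(1) H(1,2)] and q = liftsD[OF l(2) H(2,3)]
  note [simp] = p(1-3) q(1-3) cpxD(1-4)[OF H(1)] cpxD(1-4)[OF H(2)] cpxD(1-4)[OF H(3)] assms(6-)
  show ?thesis
    by (rule liftsI[OF H(1,3)])
       (simp_all add: p(4,5) cmp_reduce[OF q(4)] cmp_reduce[OF q(5)])
qed

lemma lifts_ide: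
  assumes "cpx H" "arr (caug H)" "dm (caug H) = B" "cd (caug H) = cobj H 0"
  shows "lifts \<C> H H (ide \<C> B) (\<lambda>i. ide \<C> (cobj H i))"
  using assms cpxD(1-4)[OF assms(1)] by (intro liftsI) simp_all

text \<open>This reduces the comparison of two lifts to lifts of zero.\<close>

lemma lifts_diff:
  assumes H: "cpx H" "cpx H'" and l: "lifts \<C> H H' b \<phi>" "lifts \<C> H H' b \<psi>"
    and b [simp]: "arr b" "dm b = B" "cd b = B'"
      "arr (caug H)" "cd (caug H) = cobj H 0" "dm (caug H) = B" "arr (caug H')" "dm (caug H') = B'"
  shows "lifts \<C> H H' (zer B B') (\<lambda>i. \<phi> i \<boxplus> neg (\<psi> i))"
proof -
  have [simp]: "B \<in> obj \<C>" "B' \<in> obj \<C>" using arrD[OF b(1)] by simp_all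
  note p = liftsD[OF l(1) H] and q = liftsD[OF l(2) H]
  \<comment> \<open>The codomain is not among the hypotheses; the square in degree 0 forces
    it.\<close>
  have [simp]: "cd (caug H') = cobj H' 0"
  proof -
    have "cd (caug H' \<cdot> b) = cd (\<phi> 0 \<cdot> caug H)" using p(4) by simp
    then show ?thesis using p(1-3) by simp
  qed
  note [simp] = p(1-3) q(1-3) cpxD(1-4)[OF H(1)] cpxD(1-4)[OF H(2)]
  show ?thesis
    by (rule liftsI[OF H]) (simp_all add: p(4,5) q(4,5))
qed

end

context proper_extri
begin

section \<open>Existence of lifts and their uniqueness up to homotopy\<close>

lemma proper_coresD:
  assumes H: "proper_GI_cores \<C> \<xi> B H"
  shows "cpx H" "B \<in> obj \<C>" "arr (caug H)" "dm (caug H) = B" "cd (caug H) = cobj H 0"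
    "cdiff H 0 \<cdot> caug H = zer B (cobj H (Suc 0))" "cobj H i \<in> GIs" "cobj H i \<in> obj \<C>"
proof -
  obtain L g f \<rho> where 1: "\<And>i. cobj H i \<in> GIs" "L 0 = B" "caug H = g 0"
    "\<And>i. xt3 (L i) (cobj H i) (L (Suc i)) (g i) (f i) (\<rho> i)"
    "\<And>i. cdiff H i = g (Suc i) \<cdot> f i"
    by (rule proper_coresE[OF H]) blast
  note t = etriD[OF xtri_etri[OF 1(4)]]
  note [simp] = t
  show B: "B \<in> obj \<C>" "arr (caug H)" "dm (caug H) = B" "cd (caug H) = cobj H 0"
    using t(1,4-6)[of 0] 1(2,3) by simp_all
  show "cobj H i \<in> GIs" "cobj H i \<in> obj \<C>" using 1(1) t(2) by simp_all
  have "cdiff H (Suc i) \<cdot> cdiff H i = zer (cobj H i) (cobj H (Suc (Suc i)))" for i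
    using H unfolding proper_GI_cores_def by blast
  then show "cpx H" unfolding cpx_def by (simp add: 1(5))
  show "cdiff H 0 \<cdot> caug H = zer B (cobj H (Suc 0))"
    using H unfolding proper_GI_cores_def by simp
qed

text \<open>Every object of \<open>GIs\<close> behaves like an injective towards a proper
  coresolution: a map that kills the incoming arrow extends along the outgoing one.\<close>

lemma proper_cores_extend:
  assumes H: "proper_GI_cores \<C> \<xi> B H" and W: "W \<in> GIs" and h: "arr h" "cd h = W"
  shows "dm h = B \<Longrightarrow> \<exists>s. arr s \<and> dm s = cobj H 0 \<and> cd s = W \<and> s \<cdot> caug H = h"
    and "\<lbrakk>dm h = cobj H 0; h \<cdot> caug H = zer B W\<rbrakk> \<Longrightarrow>
      \<exists>s. arr s \<and> dm s = cobj H (Suc 0) \<and> cd s = W \<and> s \<cdot> cdiff H 0 = h"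
    and "\<lbrakk>dm h = cobj H (Suc i); h \<cdot> cdiff H i = zer (cobj H i) W\<rbrakk> \<Longrightarrow>
      \<exists>s. arr s \<and> dm s = cobj H (Suc (Suc i)) \<and> cd s = W \<and> s \<cdot> cdiff H (Suc i) = h"
proof -
  obtain L g f \<rho> where 1: "L 0 = B" "caug H = g 0"
    "\<And>i. xt3 (L i) (cobj H i) (L (Suc i)) (g i) (f i) (\<rho> i)"
    "\<And>i W. W \<in> GIs \<Longrightarrow> cexact W (g i) (f i)"
    "\<And>i. cdiff H i = g (Suc i) \<cdot> f i"
    by (rule proper_coresE[OF H]) blast
  note t = xtri_etri[OF 1(3)]
  note [simp] = etriD(1-9)[OF t] h
  have W' [simp]: "W \<in> obj \<C>" using W GI_obj by blast
  \<comment> \<open>A map that kills \<open>g i\<close> descends along \<open>f i\<close>, and the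
    descent extends along \<open>g (Suc i)\<close>; together these make up the differential.\<close>
  have *: "\<exists>s. arr s \<and> dm s = cobj H (Suc i) \<and> cd s = W \<and> s \<cdot> cdiff H i = h"
    if [simp]: "dm h = cobj H i" and z: "h \<cdot> g i = zer (L i) W" for i
  proof -
    obtain k where k [simp]: "arr k" "dm k = L (Suc i)" "cd k = W" "k \<cdot> f i = h"
      using weak_cokernel[OF t[of i], of h] z by auto
    obtain s where s [simp]: "arr s" "dm s = cobj H (Suc i)" "cd s = W" and sg: "s \<cdot> g (Suc i) = k"
      using cexact_extend[OF 1(4)[OF W], of k "Suc i"] by auto
    have "s \<cdot> cdiff H i = h" unfolding 1(5) using cmp_reduce[OF sg, of "f i"] by simp
    then show ?thesis using s by blast
  qed
  show "\<exists>s. arr s \<and> dm s = cobj H 0 \<and> cd s = W \<and> s \<cdot> caug H = h" if "dm h = B"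
    using cexact_extend[OF 1(4)[OF W], of h 0] that 1(1,2) by auto
  show "\<exists>s. arr s \<and> dm s = cobj H (Suc 0) \<and> cd s = W \<and> s \<cdot> cdiff H 0 = h"
    if "dm h = cobj H 0" "h \<cdot> caug H = zer B W"
    using *[of 0] that 1(1,2) by simp
  show "\<exists>s. arr s \<and> dm s = cobj H (Suc (Suc i)) \<and> cd s = W \<and> s \<cdot> cdiff H (Suc i) = h"
    if [simp]: "dm h = cobj H (Suc i)" and z: "h \<cdot> cdiff H i = zer (cobj H i) W"
  proof (rule *)
    \<comment> \<open>Only the composite with \<open>f i\<close> is known to vanish. The injectivity
      clause cancels \<open>f i\<close>, which need not be epic.\<close>
    have "(h \<cdot> g (Suc i)) \<cdot> f i = zer (cobj H i) W" using z by (simp add: 1(5))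
    then show "h \<cdot> g (Suc i) = zer (L (Suc i)) W"
      using cexact_mono[OF 1(4)[OF W], of "h \<cdot> g (Suc i)" i] by simp
  qed simp
qed

lemma lifts_exist:
  assumes H: "proper_GI_cores \<C> \<xi> B H" and H': "proper_GI_cores \<C> \<xi> B' H'"
    and b [simp]: "arr b" "dm b = B" "cd b = B'"
  obtains \<phi> where "lifts \<C> H H' b \<phi>"
proof -
  note c = cpxD[OF proper_coresD(1)[OF H]] and c' = cpxD[OF proper_coresD(1)[OF H']]
  note [simp] = c(1-5) c' proper_coresD(2-6)[OF H] proper_coresD(2-6)[OF H']
  \<comment> \<open>The case distinction records what the next extension needs: compatibility with
    the augmentations in degree 0, vanishing on the incoming differential afterwards.\<close>
  define P where "P n \<phi> \<longleftrightarrow> arr \<phi> \<and> dm \<phi> = cobj H n \<and> cd \<phi> = cobj H' n \<and>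
    (case n of 0 \<Rightarrow> \<phi> \<cdot> caug H = caug H' \<cdot> b
     | Suc m \<Rightarrow> (cdiff H' n \<cdot> \<phi>) \<cdot> cdiff H m = zer (cobj H m) (cobj H' (Suc n)))" for n \<phi>
  have "\<exists>\<phi>. \<forall>n. P n (\<phi> n) \<and> \<phi> (Suc n) \<cdot> cdiff H n = cdiff H' n \<cdot> \<phi> n"
  proof (rule dependent_nat_choice)
    show "\<exists>\<phi>. P 0 \<phi>"
      using proper_cores_extend(1)[OF H proper_coresD(7)[OF H'], of "caug H' \<cdot> b" 0] by (simp add: P_def)
  next
    fix \<phi> n assume p: "P n \<phi>"
    then have [simp]: "arr \<phi>" "dm \<phi> = cobj H n" "cd \<phi> = cobj H' n" by (simp_all add: P_def)
    let ?h = "cdiff H' n \<cdot> \<phi>"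
    have "\<exists>s. arr s \<and> dm s = cobj H (Suc n) \<and> cd s = cobj H' (Suc n) \<and> s \<cdot> cdiff H n = ?h"
    proof (cases n)
      case 0
      have "?h \<cdot> caug H = zer B (cobj H' (Suc n))"
        using p 0 cmp_reduce[OF proper_coresD(6)[OF H'], of b] by (simp add: P_def)
      then show ?thesis
        using 0 proper_cores_extend(2)[OF H proper_coresD(7)[OF H'], of ?h] by simp
    next
      case (Suc m)
      then have "?h \<cdot> cdiff H m = zer (cobj H m) (cobj H' (Suc n))"
        using p by (simp add: P_def)
      then show ?thesis
        using Suc proper_cores_extend(3)[OF H proper_coresD(7)[OF H'], of ?h "Suc n" m] by simp
    qed
    then obtain s where s [simp]: "arr s" "dm s = cobj H (Suc n)" "cd s = cobj H' (Suc n)"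
      and sd: "s \<cdot> cdiff H n = ?h" by blast
    have "P (Suc n) s" unfolding P_def by (simp add: sd)
    then show "\<exists>s. P (Suc n) s \<and> s \<cdot> cdiff H n = cdiff H' n \<cdot> \<phi>" using sd by blast
  qed
  then obtain \<phi> where \<phi>: "\<And>n. P n (\<phi> n)" "\<And>n. \<phi> (Suc n) \<cdot> cdiff H n = cdiff H' n \<cdot> \<phi> n" by blast
  have "lifts \<C> H H' b \<phi>"
    by (rule liftsI) (use \<phi>(1) \<phi>(1)[of 0] \<phi>(2) proper_coresD(1)[OF H] proper_coresD(1)[OF H'] in
        \<open>auto simp: P_def\<close>)
  then show ?thesis by (rule that)
qed

text \<open>A lift of zero is null-homotopic, and a homotopy turns its value on a cocycle into a
  coboundary. In degree \<open>n\<close> at most two neighbouring components of the homotopy occur,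
  so no infinite family has to be chosen.\<close>

lemma lifts_zer_cobound:
  assumes H: "proper_GI_cores \<C> \<xi> B H" and H': "proper_GI_cores \<C> \<xi> B' H'"
    and l: "lifts \<C> H H' (zer B B') \<chi>" and X: "X \<in> obj \<C>" and f: "f \<in> cocycles \<C> H n X"
  shows "\<chi> n \<cdot> f \<in> cobounds \<C> H' n X"
proof -
  note k = proper_coresD(1)[OF H] and k' = proper_coresD(1)[OF H']
  note c = cpxD[OF k] and c' = cpxD[OF k']
  note p = liftsD[OF l k k']
  note [simp] = c(1-5) c' proper_coresD(2-6)[OF H] proper_coresD(2-6)[OF H'] p(1-3) X
  have [simp]: "arr f" "dm f = X" "cd f = cobj H n" and fz: "cdiff H n \<cdot> f = zer X (cobj H (Suc n))"
    using f cocycles_iff[OF k X] by auto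
  have "\<chi> 0 \<cdot> caug H = zer B (cobj H' 0)" using p(4) by simp
  then obtain s0 where s0 [simp]: "arr s0" "dm s0 = cobj H (Suc 0)" "cd s0 = cobj H' 0" and s0d: "s0 \<cdot> cdiff H 0 = \<chi> 0"
    using proper_cores_extend(2)[OF H proper_coresD(7)[OF H'], of "\<chi> 0" 0] by auto
  \<comment> \<open>This condition says that \<open>\<chi> (Suc m)\<close> minus
    \<open>cdiff H' m \<cdot> s\<close> kills \<open>cdiff H m\<close>, which is what allows the
    next component of the homotopy to be built.\<close>
  define good where "good m s \<longleftrightarrow> arr s \<and> dm s = cobj H (Suc m) \<and> cd s = cobj H' m \<and>
    cdiff H' m \<cdot> (s \<cdot> cdiff H m) = \<chi> (Suc m) \<cdot> cdiff H m" for m s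
  have step: "\<exists>s'. good (Suc m) s' \<and> s' \<cdot> cdiff H (Suc m) = \<chi> (Suc m) \<boxplus> neg (cdiff H' m \<cdot> s)"
    if s: "good m s" for m s
  proof -
    have [simp]: "arr s" "dm s = cobj H (Suc m)" "cd s = cobj H' m"
      and e: "cdiff H' m \<cdot> (s \<cdot> cdiff H m) = \<chi> (Suc m) \<cdot> cdiff H m" using s by (auto simp: good_def)
    let ?k = "\<chi> (Suc m) \<boxplus> neg (cdiff H' m \<cdot> s)"
    have "?k \<cdot> cdiff H m = zer (cobj H m) (cobj H' (Suc m))" by (simp add: e)
    then obtain s' where s' [simp]: "arr s'" "dm s' = cobj H (Suc (Suc m))" "cd s' = cobj H' (Suc m)"
      and sd: "s' \<cdot> cdiff H (Suc m) = ?k"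
      using proper_cores_extend(3)[OF H proper_coresD(7)[OF H'], of ?k "Suc m" m] by (auto simp del: cmp_add)
    have "cdiff H' (Suc m) \<cdot> (s' \<cdot> cdiff H (Suc m)) = \<chi> (Suc (Suc m)) \<cdot> cdiff H (Suc m)"
      unfolding sd by (simp add: p(5))
    then have "good (Suc m) s'" by (simp add: good_def)
    then show ?thesis using sd by blast
  qed
  have ex: "\<exists>s. good m s" for m
  proof (induction m)
    case 0
    then show ?case using p(5)[of 0] by (intro exI[of _ s0]) (simp add: good_def s0d)
  next
    case (Suc m)
    then show ?case using step by blast
  qed
  show ?thesis
  proof (cases n)
    case 0
    have "\<chi> n \<cdot> f = s0 \<cdot> (cdiff H n \<cdot> f)" using cmp_reduce[OF s0d, of f] 0 by simp
    then show ?thesis using 0 fz by (simp add: cobounds_0)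
  next
    case (Suc m)
    obtain s where s: "good m s" using ex by blast
    then have [simp]: "arr s" "dm s = cobj H (Suc m)" "cd s = cobj H' m" by (auto simp: good_def)
    obtain s' where "good (Suc m) s'" and sd: "s' \<cdot> cdiff H (Suc m) = \<chi> (Suc m) \<boxplus> neg (cdiff H' m \<cdot> s)"
      using step[OF s] by blast
    then have [simp]: "arr s'" "dm s' = cobj H (Suc (Suc m))" "cd s' = cobj H' (Suc m)" by (auto simp: good_def)
    note [simp] = Suc
    have "(\<chi> (Suc m) \<boxplus> neg (cdiff H' m \<cdot> s)) \<cdot> f = s' \<cdot> (cdiff H (Suc m) \<cdot> f)"
      by (subst cmp_reduce[OF sd]) simp_all
    also have "\<dots> = zer X (cobj H' (Suc m))" using fz Suc by simp
    finally have "\<chi> (Suc m) \<cdot> f \<boxplus> neg (cdiff H' m \<cdot> (s \<cdot> f)) = zer X (cobj H' (Suc m))" by simp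
    then have "\<chi> n \<cdot> f = cdiff H' m \<cdot> (s \<cdot> f)"
      using sub_zer_iff[of "\<chi> (Suc m) \<cdot> f" "cdiff H' m \<cdot> (s \<cdot> f)"] Suc by simp
    then show ?thesis unfolding Suc cobounds_Suc[OF k' X] by (intro exI[of _ "s \<cdot> f"]) simp
  qed
qed

lemma lifts_coh_unique:
  assumes H: "proper_GI_cores \<C> \<xi> B H" and H': "proper_GI_cores \<C> \<xi> B' H'"
    and b: "arr b" "dm b = B" "cd b = B'"
    and l: "lifts \<C> H H' b \<phi>" "lifts \<C> H H' b \<psi>" and X: "X \<in> obj \<C>" and f: "f \<in> cocycles \<C> H n X"
  shows "coh H' n X (\<phi> n \<cdot> f) = coh H' n X (\<psi> n \<cdot> f)"
proof -
  note k = proper_coresD(1)[OF H] and k' = proper_coresD(1)[OF H']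
  note [simp] = liftsD(1-3)[OF l(1) k k'] liftsD(1-3)[OF l(2) k k']
  have [simp]: "arr f" "dm f = X" "cd f = cobj H n"
    using f cocycles_iff[OF k X] by auto
  have "lifts \<C> H H' (zer B B') (\<lambda>i. \<phi> i \<boxplus> neg (\<psi> i))"
    by (rule lifts_diff[OF k k' l b]) (use proper_coresD[OF H] proper_coresD[OF H'] in simp_all)
  from lifts_zer_cobound[OF H H' this X f]
  have "\<phi> n \<cdot> f \<boxplus> neg (\<psi> n \<cdot> f) \<in> cobounds \<C> H' n X" by simp
  then show ?thesis
    using coh_eq_iff[OF k' X] cmapD(4)[OF lifts_cmap[OF k k' X l(1)] f] cmapD(4)[OF lifts_cmap[OF k k' X l(2)] f]
    by blast
qed

lemma mem_coh_cocycle: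
  assumes H: "cpx H" "X \<in> obj \<C>" and f: "f \<in> cocycles \<C> H n X" and g: "g \<in> coh H n X f"
  shows "g \<in> cocycles \<C> H n X" "coh H n X g = coh H n X f"
proof -
  have [simp]: "arr f" "dm f = X" "cd f = cobj H n" using f cocycles_iff[OF H] by auto
  have g' [simp]: "arr g" "dm g = X" "cd g = cobj H n" and b: "g \<boxplus> neg f \<in> cobounds \<C> H n X"
    using g mem_coh_iff[OF H f] by auto
  have "(g \<boxplus> neg f) \<boxplus> f = g" by (simp add: add_assoc')
  then show z: "g \<in> cocycles \<C> H n X"
    using cocycles_add[OF H cobounds_cocycles[OF H b] f] by simp
  show "coh H n X g = coh H n X f" using coh_eq_iff[OF H z f] b by blast
qed

text \<open>Independence of the lift and of the representative makes the set in
  \<open>xt_map\<close> a singleton, so one lift computes the map.\<close>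

lemma xt_map_induces:
  assumes H: "proper_GI_cores \<C> \<xi> B H" and H': "proper_GI_cores \<C> \<xi> B' H'"
    and b: "arr b" "dm b = B" "cd b = B'"
    and l: "lifts \<C> H H' b \<phi>" and X: "X \<in> obj \<C>"
  shows "induces X H n H' n (\<phi> n) (xt_map \<C> H H' b n X)"
  unfolding induces_def
proof (intro conjI ballI)
  note k = proper_coresD(1)[OF H] and k' = proper_coresD(1)[OF H']
  show cm: "cmap X H n H' n (\<phi> n)" by (rule lifts_cmap[OF k k' X l])
  fix f assume f: "f \<in> cocycles \<C> H n X"
  have "coh H' n X (\<psi> n \<cdot> g) = coh H' n X (\<phi> n \<cdot> f)" if "lifts \<C> H H' b \<psi>" "g \<in> coh H n X f" for \<psi> g
    using lifts_coh_unique[OF H H' b that(1) l X] mem_coh_cocycle[OF k X f that(2)]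
      cmap_coh[OF k k' X cm _ f] by simp
  then have "{coh H' n X (\<psi> n \<cdot> g) | \<psi> g. lifts \<C> H H' b \<psi> \<and> g \<in> coh H n X f} = {coh H' n X (\<phi> n \<cdot> f)}"
    using l coh_self[OF k X f] by blast
  then show "xt_map \<C> H H' b n X (coh H n X f) = coh H' n X (\<phi> n \<cdot> f)"
    unfolding xt_map_def by simp
qed

text \<open>Composition with \<open>u\<close> on the right respects coboundaries, so all members of
  a coset have the same image class and \<open>the_elem\<close> is applied to a singleton.\<close>

lemma xt_pre_coh:
  assumes k: "cpx H" and u [simp]: "arr u" "dm u = X'" "cd u = X" and f: "f \<in> cocycles \<C> H n X"
  shows "f \<cdot> u \<in> cocycles \<C> H n X'" "xt_pre \<C> H n X' u (coh H n X f) = coh H n X' (f \<cdot> u)"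
proof -
  have X [simp]: "X \<in> obj \<C>" "X' \<in> obj \<C>" using arrD[OF u(1)] by simp_all
  note [simp] = cpxD(1-4)[OF k]
  have z: "g \<cdot> u \<in> cocycles \<C> H n X'" if g: "g \<in> cocycles \<C> H n X" for g
  proof -
    have [simp]: "arr g" "dm g = X" "cd g = cobj H n" and z: "cdiff H n \<cdot> g = zer X (cobj H (Suc n))"
      using g cocycles_iff[OF k X(1)] by auto
    show ?thesis using cmp_reduce[OF z, of u] by (simp add: cocycles_iff[OF k X(2)])
  qed
  show "f \<cdot> u \<in> cocycles \<C> H n X'" by (rule z[OF f])
  have "coh H n X' (g \<cdot> u) = coh H n X' (f \<cdot> u)" if g: "g \<in> coh H n X f" for g
  proof -
    have gz: "g \<in> cocycles \<C> H n X" using mem_coh_cocycle[OF k X(1) f g] by blast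
    have [simp]: "arr f" "dm f = X" "cd f = cobj H n" "arr g" "dm g = X" "cd g = cobj H n"
      using f gz cocycles_iff[OF k X(1)] by auto
    have b: "g \<boxplus> neg f \<in> cobounds \<C> H n X" using g mem_coh_iff[OF k X(1) f] by blast
    have "(g \<boxplus> neg f) \<cdot> u \<in> cobounds \<C> H n X'"
    proof (cases n)
      case 0
      then have "g \<boxplus> neg f = zer X (cobj H n)" using b by (simp add: cobounds_0)
      then show ?thesis using 0 by (simp add: cobounds_0 del: cmp_add)
    next
      case (Suc m)
      then obtain v where [simp]: "arr v" "dm v = X" "cd v = cobj H m" and v: "g \<boxplus> neg f = cdiff H m \<cdot> v"
        using b cobounds_Suc[OF k X(1)] by blast
      show ?thesis unfolding Suc cobounds_Suc[OF k X(2)] v by (intro exI[of _ "v \<cdot> u"]) simp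
    qed
    then have "g \<cdot> u \<boxplus> neg (f \<cdot> u) \<in> cobounds \<C> H n X'" by simp
    then show ?thesis using coh_eq_iff[OF k X(2) z[OF gz] z[OF f]] by blast
  qed
  then have "(\<lambda>g. coh H n X' (g \<cdot> u)) ` coh H n X f = {coh H n X' (f \<cdot> u)}"
    using coh_self[OF k X(1) f] by blast
  then show "xt_pre \<C> H n X' u (coh H n X f) = coh H n X' (f \<cdot> u)" unfolding xt_pre_def by simp
qed

end

section \<open>The long exact sequence\<close>

text \<open>\<open>din\<close> and \<open>dpr\<close> say that the differential of the middle
  complex is upper triangular. From here on the long exact sequence is algebra in an additive
  category, without triangles.\<close>

locale split_cpx = additive_category +
  fixes HA HM HC :: "('a, 'b) cores" and Q :: "nat \<Rightarrow> ('a, 'b) biprod"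
  assumes cA: "cpx HA" and cM: "cpx HM" and cC: "cpx HC"
    and Q: "is_biprod \<C> (cobj HA i) (cobj HC i) (Q i)"
    and M: "cobj HM i = bobj (Q i)"
    and din: "cdiff HM i \<cdot> in1 (Q i) = in1 (Q (Suc i)) \<cdot> cdiff HA i"
    and dpr: "pr2 (Q (Suc i)) \<cdot> cdiff HM i = cdiff HC i \<cdot> pr2 (Q i)"
begin

text \<open>The off-diagonal entry of the differential \<open>((d\<^sub>A, \<tau>), (0, d\<^sub>C))\<close> of the middle complex. It
  anticommutes with the differentials and represents the connecting homomorphism.\<close>

definition tau where
  "tau n = pr1 (Q (Suc n)) \<cdot> (cdiff HM n \<cdot> in2 (Q n))"

lemmas bpD = biprodD[OF Q cpxD(1)[OF cA] cpxD(1)[OF cC]]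

text \<open>Item 22 of \<open>bpD\<close>, the decomposition of the identity, is kept out of this
  rewrite set and applied by hand.\<close>

lemmas base = cpxD[OF cA] cpxD[OF cM] cpxD[OF cC] M bpD(1-21)

lemma tau_arr [simp]: "arr (tau n)" "dm (tau n) = cobj HC n" "cd (tau n) = cobj HA (Suc n)"
  by (simp_all add: tau_def base)

lemma d_in2: "cdiff HM n \<cdot> in2 (Q n) = in1 (Q (Suc n)) \<cdot> tau n \<boxplus> in2 (Q (Suc n)) \<cdot> cdiff HC n"
  by (rule biprod_ext_to[OF Q[of "Suc n"] cpxD(1)[OF cA] cpxD(1)[OF cC]])
     (simp_all add: base tau_def cmp_reduce[OF dpr])

lemma pr1_d: "pr1 (Q (Suc n)) \<cdot> cdiff HM n = cdiff HA n \<cdot> pr1 (Q n) \<boxplus> tau n \<cdot> pr2 (Q n)"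
  by (rule biprod_ext_from[OF Q[of n] cpxD(1)[OF cA] cpxD(1)[OF cC]])
     (simp_all add: base d_in2 din)

text \<open>This is the off-diagonal entry of the square of the middle differential, which is
  zero.\<close>

lemma tau_d: "tau (Suc n) \<cdot> cdiff HC n = neg (cdiff HA (Suc n) \<cdot> tau n)"
proof -
  have "zer (cobj HC n) (cobj HA (Suc (Suc n))) =
      pr1 (Q (Suc (Suc n))) \<cdot> ((cdiff HM (Suc n) \<cdot> cdiff HM n) \<cdot> in2 (Q n))"
    by (subst cpxD(5)[OF cM]) (simp add: base)
  also have "\<dots> = (pr1 (Q (Suc (Suc n))) \<cdot> cdiff HM (Suc n)) \<cdot> (cdiff HM n \<cdot> in2 (Q n))"
    by (simp add: base)
  also have "\<dots> = cdiff HA (Suc n) \<cdot> tau n \<boxplus> tau (Suc n) \<cdot> cdiff HC n"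
    by (subst pr1_d, subst d_in2) (simp add: base)
  finally show ?thesis
    by (intro neg_unique) (simp_all add: base)
qed

lemma cmap_in1:
  assumes "X \<in> obj \<C>"
  shows "cmap X HA n HM n (in1 (Q n))"
  by (rule chain_map_cmap[OF cA cM assms]) (simp_all add: base din)

lemma cmap_pr2:
  assumes "X \<in> obj \<C>"
  shows "cmap X HM n HC n (pr2 (Q n))"
  by (rule chain_map_cmap[OF cM cC assms]) (simp_all add: base dpr)

text \<open>Anticommuting costs only a sign, and cocycles and coboundaries are closed under
  negation.\<close>

lemma cmap_tau:
  assumes X: "X \<in> obj \<C>"
  shows "cmap X HC n HA (Suc n) (tau n)"
proof -
  note [simp] = base X
  have "tau n \<cdot> f \<in> cocycles \<C> HA (Suc n) X" if f: "f \<in> cocycles \<C> HC n X" for f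
  proof -
    have [simp]: "arr f" "dm f = X" "cd f = cobj HC n" and z: "cdiff HC n \<cdot> f = zer X (cobj HC (Suc n))"
      using f cocycles_iff[OF cC X] by auto
    have "neg (cdiff HA (Suc n) \<cdot> tau n) \<cdot> f = tau (Suc n) \<cdot> (cdiff HC n \<cdot> f)"
      by (subst tau_d[symmetric]) simp
    then have "neg (cdiff HA (Suc n) \<cdot> (tau n \<cdot> f)) = zer X (cobj HA (Suc (Suc n)))"
      using z by simp
    then have "neg (neg (cdiff HA (Suc n) \<cdot> (tau n \<cdot> f))) = neg (zer X (cobj HA (Suc (Suc n))))"
      by (rule arg_cong)
    then show ?thesis by (simp add: cocycles_iff[OF cA X])
  qed
  moreover have "tau n \<cdot> f \<in> cobounds \<C> HA (Suc n) X" if f: "f \<in> cobounds \<C> HC n X" for f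
  proof (cases n)
    case 0
    then have "tau n \<cdot> f = zer X (cobj HA (Suc n))" using f by (simp add: cobounds_0)
    then show ?thesis using zer_cobound[OF cA X] by simp
  next
    case (Suc m)
    then obtain u where [simp]: "arr u" "dm u = X" "cd u = cobj HC m" and u: "f = cdiff HC m \<cdot> u"
      using f cobounds_Suc[OF cC X] by blast
    have "tau n \<cdot> f = neg (cdiff HA (Suc m) \<cdot> tau m) \<cdot> u"
      unfolding Suc u by (subst tau_d[symmetric]) simp
    then show ?thesis unfolding Suc cobounds_Suc[OF cA X]
      by (intro exI[of _ "neg (tau m \<cdot> u)"]) simp
  qed
  ultimately show ?thesis unfolding cmap_def by simp
qed

section \<open>Cocycle chases in the split complex\<close>

context
  fixes X assumes X [simp]: "X \<in> obj \<C>"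
begin

lemma from_kernel_pr2:
  assumes m: "m \<in> cocycles \<C> HM n X" "pr2 (Q n) \<cdot> m = zer X (cobj HC n)"
  shows "pr1 (Q n) \<cdot> m \<in> cocycles \<C> HA n X" "in1 (Q n) \<cdot> (pr1 (Q n) \<cdot> m) = m"
proof -
  note [simp] = base
  have [simp]: "arr m" "dm m = X" "cd m = bobj (Q n)" and z: "cdiff HM n \<cdot> m = zer X (cobj HM (Suc n))"
    using m cocycles_iff[OF cM X] by auto
  have "(in1 (Q n) \<cdot> pr1 (Q n) \<boxplus> in2 (Q n) \<cdot> pr2 (Q n)) \<cdot> m = m"
    by (subst bpD(22)) simp
  then show i: "in1 (Q n) \<cdot> (pr1 (Q n) \<cdot> m) = m" by (simp add: m(2))
  have "cdiff HA n \<cdot> (pr1 (Q n) \<cdot> m) = pr1 (Q (Suc n)) \<cdot> (in1 (Q (Suc n)) \<cdot> (cdiff HA n \<cdot> (pr1 (Q n) \<cdot> m)))"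
    by simp
  also have "\<dots> = pr1 (Q (Suc n)) \<cdot> ((cdiff HM n \<cdot> in1 (Q n)) \<cdot> (pr1 (Q n) \<cdot> m))"
    by (subst din) simp
  also have "\<dots> = pr1 (Q (Suc n)) \<cdot> (cdiff HM n \<cdot> (in1 (Q n) \<cdot> (pr1 (Q n) \<cdot> m)))" by simp
  also have "\<dots> = zer X (cobj HA (Suc n))" unfolding i z by simp
  finally show "pr1 (Q n) \<cdot> m \<in> cocycles \<C> HA n X" by (simp add: cocycles_iff[OF cA X])
qed

text \<open>The cocycle can be changed by a coboundary until its \<open>C\<close>-component is
  exactly zero; it then comes from \<open>A\<close>.\<close>

lemma exact_middle:
  assumes m: "m \<in> cocycles \<C> HM n X" and b: "pr2 (Q n) \<cdot> m \<in> cobounds \<C> HC n X"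
  obtains a where "a \<in> cocycles \<C> HA n X" "coh HM n X m = coh HM n X (in1 (Q n) \<cdot> a)"
proof -
  note [simp] = base
  have [simp]: "arr m" "dm m = X" "cd m = bobj (Q n)" using m cocycles_iff[OF cM X] by auto
  have "\<exists>m' \<in> cocycles \<C> HM n X. pr2 (Q n) \<cdot> m' = zer X (cobj HC n) \<and> coh HM n X m = coh HM n X m'"
  proof (cases n)
    case 0
    then show ?thesis using b m by (auto simp: cobounds_0)
  next
    case (Suc k)
    then obtain u where [simp]: "arr u" "dm u = X" "cd u = cobj HC k" and u: "pr2 (Q n) \<cdot> m = cdiff HC k \<cdot> u"
      using b cobounds_Suc[OF cC X] by blast
    \<comment> \<open>The bounding cochain \<open>u\<close> is moved into the middle complex along
      \<open>in2\<close>; its differential has \<open>C\<close>-component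
      \<open>cdiff HC k \<cdot> u\<close>. In degree 0 no correction is possible or needed.\<close>
    let ?b = "cdiff HM k \<cdot> (in2 (Q k) \<cdot> u)"
    let ?m = "m \<boxplus> neg ?b"
    have bb: "?b \<in> cobounds \<C> HM n X"
      unfolding Suc cobounds_Suc[OF cM X] by (intro exI[of _ "in2 (Q k) \<cdot> u"]) simp
    have [simp]: "cd ?b = bobj (Q n)" using Suc by simp
    have z: "?m \<in> cocycles \<C> HM n X"
      by (rule cocycles_add[OF cM X m cocycles_neg[OF cM X cobounds_cocycles[OF cM X bb]]])
    have "m \<boxplus> neg ?m = ?b" using add_neg_cancel(1)[of m ?b] Suc by simp
    then have "coh HM n X m = coh HM n X ?m" using coh_eq_iff[OF cM X m z] bb by simp
    moreover have "pr2 (Q (Suc k)) \<cdot> ?b = cdiff HC k \<cdot> u"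
      by (subst cmp_reduce[OF dpr]) simp_all
    then have "pr2 (Q n) \<cdot> ?m = zer X (cobj HC n)" using u Suc by simp
    ultimately show ?thesis using z by blast
  qed
  then show ?thesis using that from_kernel_pr2 by metis
qed

lemma exact_tau_lift:
  assumes c: "c \<in> cocycles \<C> HC n X" and b: "tau n \<cdot> c \<in> cobounds \<C> HA (Suc n) X"
  obtains m where "m \<in> cocycles \<C> HM n X" "pr2 (Q n) \<cdot> m = c"
proof -
  note [simp] = base
  have [simp]: "arr c" "dm c = X" "cd c = cobj HC n" and z: "cdiff HC n \<cdot> c = zer X (cobj HC (Suc n))"
    using c cocycles_iff[OF cC X] by auto
  obtain u where [simp]: "arr u" "dm u = X" "cd u = cobj HA n" and u: "tau n \<cdot> c = cdiff HA n \<cdot> u"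
    using b cobounds_Suc[OF cA X] by blast
  \<comment> \<open>Since \<open>c\<close> is a cocycle, the differential of \<open>in2 c\<close> is
    \<open>in1\<close> of \<open>tau n \<cdot> c = cdiff HA n \<cdot> u\<close>. Subtracting
    \<open>in1 u\<close> cancels it.\<close>
  let ?m = "in2 (Q n) \<cdot> c \<boxplus> neg (in1 (Q n) \<cdot> u)"
  have "cdiff HM n \<cdot> (in2 (Q n) \<cdot> c) = in1 (Q (Suc n)) \<cdot> (cdiff HA n \<cdot> u)"
    by (subst cmp_reduce[OF d_in2]) (simp_all add: z u)
  moreover have "cdiff HM n \<cdot> (in1 (Q n) \<cdot> u) = in1 (Q (Suc n)) \<cdot> (cdiff HA n \<cdot> u)"
    by (subst cmp_reduce[OF din]) simp_all
  ultimately have "?m \<in> cocycles \<C> HM n X" by (simp add: cocycles_iff[OF cM X])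
  moreover have "pr2 (Q n) \<cdot> ?m = c" by simp
  ultimately show ?thesis by (rule that)
qed

text \<open>The \<open>A\<close>-component of the cocycle equation for \<open>m\<close> exhibits the
  bounding cochain, up to sign.\<close>

lemma tau_pr2_cobound:
  assumes m: "m \<in> cocycles \<C> HM n X"
  shows "tau n \<cdot> (pr2 (Q n) \<cdot> m) \<in> cobounds \<C> HA (Suc n) X"
proof -
  note [simp] = base
  have [simp]: "arr m" "dm m = X" "cd m = bobj (Q n)" and z: "cdiff HM n \<cdot> m = zer X (cobj HM (Suc n))"
    using m cocycles_iff[OF cM X] by auto
  have "(cdiff HA n \<cdot> pr1 (Q n) \<boxplus> tau n \<cdot> pr2 (Q n)) \<cdot> m = pr1 (Q (Suc n)) \<cdot> (cdiff HM n \<cdot> m)"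
    by (subst pr1_d[symmetric]) simp
  then have "cdiff HA n \<cdot> (pr1 (Q n) \<cdot> m) \<boxplus> tau n \<cdot> (pr2 (Q n) \<cdot> m) = zer X (cobj HA (Suc n))"
    using z by simp
  then have "tau n \<cdot> (pr2 (Q n) \<cdot> m) = neg (cdiff HA n \<cdot> (pr1 (Q n) \<cdot> m))"
    by (intro neg_unique) simp_all
  then show ?thesis unfolding cobounds_Suc[OF cA X]
    by (intro exI[of _ "neg (pr1 (Q n) \<cdot> m)"]) simp
qed

text \<open>Split \<open>in1 a = d m\<close> into components: the \<open>C\<close>-part says that
  \<open>pr2 m\<close> is a cocycle, the \<open>A\<close>-part that \<open>a\<close> and
  \<open>tau n\<close> of it differ by a coboundary.\<close>

lemma exact_in1:
  assumes a: "a \<in> cocycles \<C> HA (Suc n) X" and b: "in1 (Q (Suc n)) \<cdot> a \<in> cobounds \<C> HM (Suc n) X"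
  obtains c where "c \<in> cocycles \<C> HC n X" "coh HA (Suc n) X a = coh HA (Suc n) X (tau n \<cdot> c)"
proof -
  note [simp] = base
  have [simp]: "arr a" "dm a = X" "cd a = cobj HA (Suc n)"
    using a cocycles_iff[OF cA X] by auto
  obtain m where [simp]: "arr m" "dm m = X" "cd m = bobj (Q n)" and m: "in1 (Q (Suc n)) \<cdot> a = cdiff HM n \<cdot> m"
    using b cobounds_Suc[OF cM X] by auto
  have "cdiff HC n \<cdot> (pr2 (Q n) \<cdot> m) = (pr2 (Q (Suc n)) \<cdot> cdiff HM n) \<cdot> m"
    by (subst dpr) simp
  also have "\<dots> = zer X (cobj HC (Suc n))" by (simp flip: m)
  finally have c: "pr2 (Q n) \<cdot> m \<in> cocycles \<C> HC n X" by (simp add: cocycles_iff[OF cC X])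
  have "a = (pr1 (Q (Suc n)) \<cdot> cdiff HM n) \<cdot> m" by (simp flip: m)
  also have "\<dots> = cdiff HA n \<cdot> (pr1 (Q n) \<cdot> m) \<boxplus> tau n \<cdot> (pr2 (Q n) \<cdot> m)"
    by (subst pr1_d) simp
  finally have "a \<boxplus> neg (tau n \<cdot> (pr2 (Q n) \<cdot> m)) = cdiff HA n \<cdot> (pr1 (Q n) \<cdot> m)"
    by (simp add: add_assoc')
  then have "a \<boxplus> neg (tau n \<cdot> (pr2 (Q n) \<cdot> m)) \<in> cobounds \<C> HA (Suc n) X"
    unfolding cobounds_Suc[OF cA X] by (intro exI[of _ "pr1 (Q n) \<cdot> m"]) simp
  then show ?thesis using that[OF c] coh_eq_iff[OF cA X a cmapD(4)[OF cmap_tau[OF X] c]] by blast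
qed

lemma in1_tau_cobound:
  assumes c: "c \<in> cocycles \<C> HC n X"
  shows "in1 (Q (Suc n)) \<cdot> (tau n \<cdot> c) \<in> cobounds \<C> HM (Suc n) X"
proof -
  note [simp] = base
  have [simp]: "arr c" "dm c = X" "cd c = cobj HC n" and z: "cdiff HC n \<cdot> c = zer X (cobj HC (Suc n))"
    using c cocycles_iff[OF cC X] by auto
  have "in1 (Q (Suc n)) \<cdot> (tau n \<cdot> c) = cdiff HM n \<cdot> (in2 (Q n) \<cdot> c)"
    by (subst cmp_reduce[OF d_in2]) (simp_all add: z)
  then show ?thesis unfolding cobounds_Suc[OF cM X] by (intro exI[of _ "in2 (Q n) \<cdot> c"]) simp
qed

text \<open>There are no nonzero coboundaries in degree 0, and \<open>in1\<close> is split
  monic.\<close>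

lemma in1_mono_0:
  assumes a: "a \<in> cocycles \<C> HA 0 X" and b: "in1 (Q 0) \<cdot> a \<in> cobounds \<C> HM 0 X"
  shows "a \<in> cobounds \<C> HA 0 X"
proof -
  note [simp] = base
  have [simp]: "arr a" "dm a = X" "cd a = cobj HA 0" using a cocycles_iff[OF cA X] by auto
  have "pr1 (Q 0) \<cdot> (in1 (Q 0) \<cdot> a) = pr1 (Q 0) \<cdot> zer X (bobj (Q 0))"
    using b by (simp add: cobounds_0)
  then show ?thesis by (simp add: cobounds_0)
qed

end

text \<open>The choice of representative is harmless, because \<open>tau\<close> respects
  classes.\<close>

definition con where
  "con n X K = coh HA (Suc n) X (tau n \<cdot> (SOME f. f \<in> cocycles \<C> HC n X \<and> coh HC n X f = K))"

lemma con_induces: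
  assumes X: "X \<in> obj \<C>"
  shows "induces X HC n HA (Suc n) (tau n) (con n X)"
  unfolding induces_def
proof (intro conjI ballI)
  show t: "cmap X HC n HA (Suc n) (tau n)" by (rule cmap_tau[OF X])
  fix f assume f: "f \<in> cocycles \<C> HC n X"
  let ?g = "SOME g. g \<in> cocycles \<C> HC n X \<and> coh HC n X g = coh HC n X f"
  have "?g \<in> cocycles \<C> HC n X \<and> coh HC n X ?g = coh HC n X f"
    by (rule someI[of _ f]) (simp add: f)
  then show "con n X (coh HC n X f) = coh HA (Suc n) X (tau n \<cdot> f)"
    unfolding con_def using cmap_coh[OF cC cA X t _ f] by blast
qed

text \<open>The split complex computes the sequence, but the maps demanded refer to another complex
  \<open>HB\<close>. It is enough that \<alpha> and \<beta> are mutually inverse on cohomology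
  classes.\<close>

lemma long_exact_transport:
  assumes X: "X \<in> obj \<C>" and cB: "cpx HB"
    and \<alpha>: "\<And>n. cmap X HM n HB n (\<alpha> n)" and \<beta>: "\<And>n. cmap X HB n HM n (\<beta> n)"
    and \<beta>\<alpha>: "\<And>n m. m \<in> cocycles \<C> HM n X \<Longrightarrow> coh HM n X (\<beta> n \<cdot> (\<alpha> n \<cdot> m)) = coh HM n X m"
    and \<alpha>\<beta>: "\<And>n b. b \<in> cocycles \<C> HB n X \<Longrightarrow> coh HB n X (\<alpha> n \<cdot> (\<beta> n \<cdot> b)) = coh HB n X b"
    and F: "\<And>n. induces X HA n HB n (\<alpha> n \<cdot> in1 (Q n)) (F n)"
    and G: "\<And>n. induces X HB n HC n (pr2 (Q n) \<cdot> \<beta> n) (G n)"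
  shows "F 0 \<in> mon (xt \<C> HA 0 X) (xt \<C> HB 0 X)"
    and "exact_seq ([xt \<C> HC n X, xt \<C> HB n X, xt \<C> HA n X], [G n, F n])"
    and "exact_seq ([xt \<C> HA (Suc n) X, xt \<C> HC n X, xt \<C> HB n X], [con n X, G n])"
    and "exact_seq ([xt \<C> HB (Suc n) X, xt \<C> HA (Suc n) X, xt \<C> HC n X], [F (Suc n), con n X])"
proof -
  note [simp] = base X cpxD(1-4)[OF cB] cmapD(1-3)[OF \<alpha>, simplified M] cmapD(1-3)[OF \<beta>, simplified M]
  note zA = cocycles_iff[OF cA X] and zB = cocycles_iff[OF cB X]
    and zC = cocycles_iff[OF cC X] and zM = cocycles_iff[OF cM X]
  have Fe: "(\<alpha> n \<cdot> in1 (Q n)) \<cdot> a = \<alpha> n \<cdot> (in1 (Q n) \<cdot> a)" if "a \<in> cocycles \<C> HA n X" for a n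
    using that zA by simp
  have Ge: "(pr2 (Q n) \<cdot> \<beta> n) \<cdot> b = pr2 (Q n) \<cdot> (\<beta> n \<cdot> b)" if "b \<in> cocycles \<C> HB n X" for b n
    using that zB by simp
  have in1Z: "in1 (Q n) \<cdot> a \<in> cocycles \<C> HM n X" if "a \<in> cocycles \<C> HA n X" for a n
    by (rule cmapD(4)[OF cmap_in1[OF X] that])
  have pr2Z: "pr2 (Q n) \<cdot> m \<in> cocycles \<C> HC n X" if "m \<in> cocycles \<C> HM n X" for m n
    by (rule cmapD(4)[OF cmap_pr2[OF X] that])
  note \<alpha>Z = cmapD(4)[OF \<alpha>] and \<beta>Z = cmapD(4)[OF \<beta>]
  \<comment> \<open>\<alpha> reflects coboundaries because \<beta> undoes it up to a
    coboundary.\<close>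
  have F_cob: "\<alpha> n \<cdot> (in1 (Q n) \<cdot> a) \<in> cobounds \<C> HB n X \<longleftrightarrow> in1 (Q n) \<cdot> a \<in> cobounds \<C> HM n X"
    if a: "a \<in> cocycles \<C> HA n X" for a n
  proof
    assume "\<alpha> n \<cdot> (in1 (Q n) \<cdot> a) \<in> cobounds \<C> HB n X"
    then have "\<beta> n \<cdot> (\<alpha> n \<cdot> (in1 (Q n) \<cdot> a)) \<in> cobounds \<C> HM n X" by (rule cmapD(5)[OF \<beta>])
    then show "in1 (Q n) \<cdot> a \<in> cobounds \<C> HM n X"
      using \<beta>\<alpha>[OF in1Z[OF a]] coh_zer_iff[OF cM X] in1Z[OF a] \<beta>Z[OF \<alpha>Z[OF in1Z[OF a]]] by metis
  qed (rule cmapD(5)[OF \<alpha>])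
  have zer_in1: "pr2 (Q n) \<cdot> (in1 (Q n) \<cdot> a) \<in> cobounds \<C> HC n X" if "a \<in> cocycles \<C> HA n X" for a n
    using that zer_cobound[OF cC X] by (simp add: zA)
  show "exact_seq ([xt \<C> HC n X, xt \<C> HB n X, xt \<C> HA n X], [G n, F n])"
  proof (rule induces_exact[OF cA cB cC X F G])
    fix b assume b: "b \<in> cocycles \<C> HB n X"
    show "(pr2 (Q n) \<cdot> \<beta> n) \<cdot> b \<in> cobounds \<C> HC n X \<longleftrightarrow>
      (\<exists>a \<in> cocycles \<C> HA n X. coh HB n X b = coh HB n X ((\<alpha> n \<cdot> in1 (Q n)) \<cdot> a))"
      unfolding Ge[OF b]
    proof
      assume "pr2 (Q n) \<cdot> (\<beta> n \<cdot> b) \<in> cobounds \<C> HC n X"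
      then obtain a where a: "a \<in> cocycles \<C> HA n X" "coh HM n X (\<beta> n \<cdot> b) = coh HM n X (in1 (Q n) \<cdot> a)"
        by (rule exact_middle[OF X \<beta>Z[OF b]])
      have "coh HB n X (\<alpha> n \<cdot> (\<beta> n \<cdot> b)) = coh HB n X (\<alpha> n \<cdot> (in1 (Q n) \<cdot> a))"
        by (rule cmap_coh[OF cM cB X \<alpha> \<beta>Z[OF b] in1Z[OF a(1)] a(2)])
      then show "\<exists>a \<in> cocycles \<C> HA n X. coh HB n X b = coh HB n X ((\<alpha> n \<cdot> in1 (Q n)) \<cdot> a)"
        using a(1) \<alpha>\<beta>[OF b] Fe[OF a(1)] by metis
    next
      assume "\<exists>a \<in> cocycles \<C> HA n X. coh HB n X b = coh HB n X ((\<alpha> n \<cdot> in1 (Q n)) \<cdot> a)"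
      then obtain a where a: "a \<in> cocycles \<C> HA n X" "coh HB n X b = coh HB n X (\<alpha> n \<cdot> (in1 (Q n) \<cdot> a))"
        using Fe by metis
      have "coh HM n X (\<beta> n \<cdot> b) = coh HM n X (\<beta> n \<cdot> (\<alpha> n \<cdot> (in1 (Q n) \<cdot> a)))"
        by (rule cmap_coh[OF cB cM X \<beta> b \<alpha>Z[OF in1Z[OF a(1)]] a(2)])
      then have "coh HM n X (\<beta> n \<cdot> b) = coh HM n X (in1 (Q n) \<cdot> a)" using \<beta>\<alpha>[OF in1Z[OF a(1)]] by simp
      then have "coh HC n X (pr2 (Q n) \<cdot> (\<beta> n \<cdot> b)) = coh HC n X (pr2 (Q n) \<cdot> (in1 (Q n) \<cdot> a))"
        by (rule cmap_coh[OF cM cC X cmap_pr2[OF X] \<beta>Z[OF b] in1Z[OF a(1)]])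
      then show "pr2 (Q n) \<cdot> (\<beta> n \<cdot> b) \<in> cobounds \<C> HC n X"
        using coh_zer_iff[OF cC X] pr2Z[OF \<beta>Z[OF b]] pr2Z[OF in1Z[OF a(1)]] zer_in1[OF a(1)] by metis
    qed
  qed
  show "exact_seq ([xt \<C> HA (Suc n) X, xt \<C> HC n X, xt \<C> HB n X], [con n X, G n])"
  proof (rule induces_exact[OF cB cC cA X G con_induces[OF X]])
    fix c assume c: "c \<in> cocycles \<C> HC n X"
    show "tau n \<cdot> c \<in> cobounds \<C> HA (Suc n) X \<longleftrightarrow>
      (\<exists>b \<in> cocycles \<C> HB n X. coh HC n X c = coh HC n X ((pr2 (Q n) \<cdot> \<beta> n) \<cdot> b))"
    proof
      assume "tau n \<cdot> c \<in> cobounds \<C> HA (Suc n) X"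
      then obtain m where m: "m \<in> cocycles \<C> HM n X" "pr2 (Q n) \<cdot> m = c"
        by (rule exact_tau_lift[OF X c])
      \<comment> \<open>The required cocycle of \<open>HB\<close> is
        \<open>\<alpha> n \<cdot> m\<close>; going back along \<beta> returns \<open>m\<close> up to
        a coboundary.\<close>
      have "coh HC n X (pr2 (Q n) \<cdot> (\<beta> n \<cdot> (\<alpha> n \<cdot> m))) = coh HC n X (pr2 (Q n) \<cdot> m)"
        by (rule cmap_coh[OF cM cC X cmap_pr2[OF X] \<beta>Z[OF \<alpha>Z[OF m(1)]] m(1) \<beta>\<alpha>[OF m(1)]])
      then show "\<exists>b \<in> cocycles \<C> HB n X. coh HC n X c = coh HC n X ((pr2 (Q n) \<cdot> \<beta> n) \<cdot> b)"
        using \<alpha>Z[OF m(1)] Ge m(2) by metis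
    next
      assume "\<exists>b \<in> cocycles \<C> HB n X. coh HC n X c = coh HC n X ((pr2 (Q n) \<cdot> \<beta> n) \<cdot> b)"
      then obtain b where b: "b \<in> cocycles \<C> HB n X" "coh HC n X c = coh HC n X (pr2 (Q n) \<cdot> (\<beta> n \<cdot> b))"
        using Ge by metis
      note p = pr2Z[OF \<beta>Z[OF b(1)]]
      have "coh HA (Suc n) X (tau n \<cdot> c) = coh HA (Suc n) X (tau n \<cdot> (pr2 (Q n) \<cdot> (\<beta> n \<cdot> b)))"
        by (rule cmap_coh[OF cC cA X cmap_tau[OF X] c p b(2)])
      then show "tau n \<cdot> c \<in> cobounds \<C> HA (Suc n) X"
        using coh_zer_iff[OF cA X] cmapD(4)[OF cmap_tau[OF X] c] cmapD(4)[OF cmap_tau[OF X] p]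
          tau_pr2_cobound[OF X \<beta>Z[OF b(1)]] by metis
    qed
  qed
  show "exact_seq ([xt \<C> HB (Suc n) X, xt \<C> HA (Suc n) X, xt \<C> HC n X], [F (Suc n), con n X])"
  proof (rule induces_exact[OF cC cA cB X con_induces[OF X] F])
    fix a assume a: "a \<in> cocycles \<C> HA (Suc n) X"
    show "(\<alpha> (Suc n) \<cdot> in1 (Q (Suc n))) \<cdot> a \<in> cobounds \<C> HB (Suc n) X \<longleftrightarrow>
      (\<exists>c \<in> cocycles \<C> HC n X. coh HA (Suc n) X a = coh HA (Suc n) X (tau n \<cdot> c))"
      unfolding Fe[OF a] F_cob[OF a]
    proof
      assume "in1 (Q (Suc n)) \<cdot> a \<in> cobounds \<C> HM (Suc n) X"
      then show "\<exists>c \<in> cocycles \<C> HC n X. coh HA (Suc n) X a = coh HA (Suc n) X (tau n \<cdot> c)"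
        by (rule exact_in1[OF X a]) blast
    next
      assume "\<exists>c \<in> cocycles \<C> HC n X. coh HA (Suc n) X a = coh HA (Suc n) X (tau n \<cdot> c)"
      then obtain c where c: "c \<in> cocycles \<C> HC n X" "coh HA (Suc n) X a = coh HA (Suc n) X (tau n \<cdot> c)"
        by blast
      note tz = cmapD(4)[OF cmap_tau[OF X] c(1)]
      have "coh HM (Suc n) X (in1 (Q (Suc n)) \<cdot> a) = coh HM (Suc n) X (in1 (Q (Suc n)) \<cdot> (tau n \<cdot> c))"
        by (rule cmap_coh[OF cA cM X cmap_in1[OF X] a tz c(2)])
      then show "in1 (Q (Suc n)) \<cdot> a \<in> cobounds \<C> HM (Suc n) X"
        using coh_zer_iff[OF cM X] in1Z[OF a] in1Z[OF tz] in1_tau_cobound[OF X c(1)] by metis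
    qed
  qed
  have hF: "F 0 \<in> hom (xt \<C> HA 0 X) (xt \<C> HB 0 X)" by (rule induces_hom[OF cA cB X F])
  have "K = \<one>\<^bsub>xt \<C> HA 0 X\<^esub>" if K: "K \<in> carrier (xt \<C> HA 0 X)" "F 0 K = \<one>\<^bsub>xt \<C> HB 0 X\<^esub>" for K
  proof -
    obtain a where a: "a \<in> cocycles \<C> HA 0 X" "K = coh HA 0 X a"
      using K(1) unfolding xt_group(2)[OF cA X] by blast
    have "coh HB 0 X (\<alpha> 0 \<cdot> (in1 (Q 0) \<cdot> a)) = coh HB 0 X (zer X (cobj HB 0))"
      using K(2) F[of 0] a Fe[OF a(1)] unfolding induces_def xt_group(3)[OF cB X] by simp
    then have "\<alpha> 0 \<cdot> (in1 (Q 0) \<cdot> a) \<in> cobounds \<C> HB 0 X"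
      using coh_zer_iff[OF cB X \<alpha>Z[OF in1Z[OF a(1)]]] by blast
    then have "a \<in> cobounds \<C> HA 0 X" using F_cob[OF a(1)] in1_mono_0[OF X a(1)] by blast
    then show ?thesis unfolding a(2) xt_group(3)[OF cA X] using coh_zer_iff[OF cA X a(1)] by blast
  qed
  moreover have "group_hom (xt \<C> HA 0 X) (xt \<C> HB 0 X) (F 0)"
    using hF xt_group(1)[OF cA X] xt_group(1)[OF cB X] by (simp add: group_hom_def group_hom_axioms_def)
  ultimately show "F 0 \<in> mon (xt \<C> HA 0 X) (xt \<C> HB 0 X)"
    using group_hom.inj_on_one_iff hF unfolding mon_def by fastforce
qed

end

theorem theorem3p13:
  fixes \<C> :: "('o, 'm, 'e) extri"
    and \<xi> :: "('m \<times> 'm \<times> 'e) set"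
    and A B C :: 'o and x y :: 'm and \<delta> :: 'e
  assumes "extriangulated_category \<C>"
    and "WIC \<C>"
    and "proper_class \<C> \<xi>"
    and "enough_xproj \<C> \<xi>"
    and "enough_xinj \<C> \<xi>"
    and "xtri \<C> \<xi> A B C x y \<delta>"
    and "contra_exact \<C> (GI \<C> \<xi>) A B C x y"
    and "A \<in> Res_GI \<C> \<xi>"
    and "C \<in> Res_GI \<C> \<xi>"
  shows "B \<in> Res_GI \<C> \<xi> \<and>
    (\<forall>HA HB HC.
       proper_GI_cores \<C> \<xi> A HA \<and> proper_GI_cores \<C> \<xi> B HB \<and> proper_GI_cores \<C> \<xi> C HC \<longrightarrow>
       (\<exists>con :: nat \<Rightarrow> 'o \<Rightarrow> 'm set \<Rightarrow> 'm set.
          (\<forall>n. \<forall>X \<in> obj \<C>. con n X \<in> hom (xt \<C> HC n X) (xt \<C> HA (Suc n) X)) \<and>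
          (\<forall>n. \<forall>X \<in> obj \<C>. \<forall>X' \<in> obj \<C>. \<forall>u \<in> mor \<C> X' X. \<forall>K \<in> carrier (xt \<C> HC n X).
             con n X' (xt_pre \<C> HC n X' u K) = xt_pre \<C> HA (Suc n) X' u (con n X K)) \<and>
          (\<forall>X \<in> obj \<C>.
             xt_map \<C> HA HB x 0 X \<in> mon (xt \<C> HA 0 X) (xt \<C> HB 0 X) \<and>
             (\<forall>n. exact_seq ([xt \<C> HC n X, xt \<C> HB n X, xt \<C> HA n X],
                             [xt_map \<C> HB HC y n X, xt_map \<C> HA HB x n X])) \<and>
             (\<forall>n. exact_seq ([xt \<C> HA (Suc n) X, xt \<C> HC n X, xt \<C> HB n X],
                             [con n X, xt_map \<C> HB HC y n X])) \<and>
             (\<forall>n. exact_seq ([xt \<C> HB (Suc n) X, xt \<C> HA (Suc n) X, xt \<C> HC n X],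
                             [xt_map \<C> HA HB x (Suc n) X, con n X])))))"
proof -
  interpret proper_extri \<C> \<xi>
    using assms(1,3,4) by (simp add: proper_extri_def proper_extri_axioms_def)
  note t = etriD[OF xtri_etri[OF assms(6)]]
  have ce: "\<And>W. W \<in> GIs \<Longrightarrow> cexact W x y"
    using GI_exact_iff[OF xtri_etri[OF assms(6)]] assms(7) by blast
  have "B \<in> Res_GI \<C> \<xi>"
  proof -
    obtain HA HC where "proper_GI_cores \<C> \<xi> A HA" "proper_GI_cores \<C> \<xi> C HC"
      using assms(8,9) unfolding Res_GI_def by blast
    then obtain HM where "proper_GI_cores \<C> \<xi> B HM" using horseshoe[OF assms(6) ce] by metis
    then show ?thesis using t(2) unfolding Res_GI_def by blast
  qed
  moreover have "\<exists>con :: nat \<Rightarrow> 'o \<Rightarrow> 'm set \<Rightarrow> 'm set.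
          (\<forall>n. \<forall>X \<in> obj \<C>. con n X \<in> hom (xt \<C> HC n X) (xt \<C> HA (Suc n) X)) \<and>
          (\<forall>n. \<forall>X \<in> obj \<C>. \<forall>X' \<in> obj \<C>. \<forall>u \<in> mor \<C> X' X. \<forall>K \<in> carrier (xt \<C> HC n X).
             con n X' (xt_pre \<C> HC n X' u K) = xt_pre \<C> HA (Suc n) X' u (con n X K)) \<and>
          (\<forall>X \<in> obj \<C>.
             xt_map \<C> HA HB x 0 X \<in> mon (xt \<C> HA 0 X) (xt \<C> HB 0 X) \<and>
             (\<forall>n. exact_seq ([xt \<C> HC n X, xt \<C> HB n X, xt \<C> HA n X],
                             [xt_map \<C> HB HC y n X, xt_map \<C> HA HB x n X])) \<and>
             (\<forall>n. exact_seq ([xt \<C> HA (Suc n) X, xt \<C> HC n X, xt \<C> HB n X],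
                             [con n X, xt_map \<C> HB HC y n X])) \<and>
             (\<forall>n. exact_seq ([xt \<C> HB (Suc n) X, xt \<C> HA (Suc n) X, xt \<C> HC n X],
                             [xt_map \<C> HA HB x (Suc n) X, con n X])))"
    if HA: "proper_GI_cores \<C> \<xi> A HA" and HB: "proper_GI_cores \<C> \<xi> B HB" and HC: "proper_GI_cores \<C> \<xi> C HC"
    for HA HB HC
  proof -
    \<comment> \<open>The splice is fixed before any \<open>X\<close>, so a single family
      \<open>tau\<close> serves all test objects.\<close>
    obtain HM Q where HM: "proper_GI_cores \<C> \<xi> B HM"
      and Q: "\<And>i. is_biprod \<C> (cobj HA i) (cobj HC i) (Q i)" "\<And>i. cobj HM i = bobj (Q i)"
      and aug: "caug HM \<cdot>\<^bsub>\<C>\<^esub> x = in1 (Q 0) \<cdot>\<^bsub>\<C>\<^esub> caug HA" "pr2 (Q 0) \<cdot>\<^bsub>\<C>\<^esub> caug HM = caug HC \<cdot>\<^bsub>\<C>\<^esub> y"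
      and d: "\<And>i. cdiff HM i \<cdot>\<^bsub>\<C>\<^esub> in1 (Q i) = in1 (Q (Suc i)) \<cdot>\<^bsub>\<C>\<^esub> cdiff HA i"
        "\<And>i. pr2 (Q (Suc i)) \<cdot>\<^bsub>\<C>\<^esub> cdiff HM i = cdiff HC i \<cdot>\<^bsub>\<C>\<^esub> pr2 (Q i)"
      by (rule horseshoe[OF assms(6) ce HA HC]) blast+
    note cA = proper_coresD(1)[OF HA] and cB = proper_coresD(1)[OF HB]
      and cC = proper_coresD(1)[OF HC] and cM = proper_coresD(1)[OF HM]
    note augs = proper_coresD(3-5)[OF HA] proper_coresD(3-5)[OF HB] proper_coresD(3-5)[OF HC]
      proper_coresD(3-5)[OF HM]
    interpret split_cpx \<C> HA HM HC Q
      using additive_category_axioms cA cM cC Q d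
      unfolding split_cpx_def split_cpx_axioms_def by blast
    \<comment> \<open>Inclusions and projections lift \<open>x\<close> and \<open>y\<close>.
      Composed with the comparison maps below they become lifts to and from \<open>HB\<close>, and
      so compute \<open>xt_map\<close>.\<close>
    have l1: "lifts \<C> HA HM x (\<lambda>i. in1 (Q i))"
      by (rule liftsI[OF cA cM]) (simp_all add: base aug din)
    have l2: "lifts \<C> HM HC y (\<lambda>i. pr2 (Q i))"
      by (rule liftsI[OF cM cC]) (simp_all add: base aug dpr)
    note idB = arr_ide[OF t(2)]
    \<comment> \<open>The given \<open>HB\<close> need not split degreewise; lifts of the identity
      of \<open>B\<close> connect it with \<open>HM\<close> in both directions.\<close>
    obtain \<alpha> where \<alpha>: "lifts \<C> HM HB (ide \<C> B) \<alpha>" by (rule lifts_exist[OF HM HB idB])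
    obtain \<beta> where \<beta>: "lifts \<C> HB HM (ide \<C> B) \<beta>" by (rule lifts_exist[OF HB HM idB])
    have lx: "lifts \<C> HA HB x (\<lambda>i. \<alpha> i \<cdot>\<^bsub>\<C>\<^esub> in1 (Q i))"
      using lifts_comp[OF cA cM cB l1 \<alpha>] augs t idB by simp
    have ly: "lifts \<C> HB HC y (\<lambda>i. pr2 (Q i) \<cdot>\<^bsub>\<C>\<^esub> \<beta> i)"
      using lifts_comp[OF cB cM cC \<beta> l2] augs t idB by simp
    \<comment> \<open>This composite and the identity chain map both lie over
      \<open>ide \<C> B\<close>, so they agree on cohomology.\<close>
    have lM: "lifts \<C> HM HM (ide \<C> B) (\<lambda>i. \<beta> i \<cdot>\<^bsub>\<C>\<^esub> \<alpha> i)"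
      using lifts_comp[OF cM cB cM \<alpha> \<beta>] augs t idB by simp
    have lB: "lifts \<C> HB HB (ide \<C> B) (\<lambda>i. \<alpha> i \<cdot>\<^bsub>\<C>\<^esub> \<beta> i)"
      using lifts_comp[OF cB cM cB \<beta> \<alpha>] augs t idB by simp
    have les: "xt_map \<C> HA HB x 0 X \<in> mon (xt \<C> HA 0 X) (xt \<C> HB 0 X)"
      "exact_seq ([xt \<C> HC n X, xt \<C> HB n X, xt \<C> HA n X], [xt_map \<C> HB HC y n X, xt_map \<C> HA HB x n X])"
      "exact_seq ([xt \<C> HA (Suc n) X, xt \<C> HC n X, xt \<C> HB n X], [con n X, xt_map \<C> HB HC y n X])"
      "exact_seq ([xt \<C> HB (Suc n) X, xt \<C> HA (Suc n) X, xt \<C> HC n X], [xt_map \<C> HA HB x (Suc n) X, con n X])"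
      if X: "X \<in> obj \<C>" for X n
    proof -
      have ba: "coh HM n X (\<beta> n \<cdot>\<^bsub>\<C>\<^esub> (\<alpha> n \<cdot>\<^bsub>\<C>\<^esub> m)) = coh HM n X m" if m: "m \<in> cocycles \<C> HM n X" for n m
      proof -
        have "arr m" "dm m = X" "cd m = cobj HM n" using m cocycles_iff[OF cM X] by auto
        then show ?thesis
          using lifts_coh_unique[OF HM HM idB lM lifts_ide[OF cM augs(10-12)] X m]
            liftsD(1-3)[OF \<alpha> cM cB] liftsD(1-3)[OF \<beta> cB cM] by simp
      qed
      have ab: "coh HB n X (\<alpha> n \<cdot>\<^bsub>\<C>\<^esub> (\<beta> n \<cdot>\<^bsub>\<C>\<^esub> m)) = coh HB n X m" if m: "m \<in> cocycles \<C> HB n X" for n m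
      proof -
        have "arr m" "dm m = X" "cd m = cobj HB n" using m cocycles_iff[OF cB X] by auto
        then show ?thesis
          using lifts_coh_unique[OF HB HB idB lB lifts_ide[OF cB augs(4-6)] X m]
            liftsD(1-3)[OF \<alpha> cM cB] liftsD(1-3)[OF \<beta> cB cM] by simp
      qed
      note les = long_exact_transport[OF X cB lifts_cmap[OF cM cB X \<alpha>] lifts_cmap[OF cB cM X \<beta>] ba ab
          xt_map_induces[OF HA HB t(4-6) lx X] xt_map_induces[OF HB HC t(7-9) ly X]]
      show "xt_map \<C> HA HB x 0 X \<in> mon (xt \<C> HA 0 X) (xt \<C> HB 0 X)"
        "exact_seq ([xt \<C> HC n X, xt \<C> HB n X, xt \<C> HA n X], [xt_map \<C> HB HC y n X, xt_map \<C> HA HB x n X])"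
        "exact_seq ([xt \<C> HA (Suc n) X, xt \<C> HC n X, xt \<C> HB n X], [con n X, xt_map \<C> HB HC y n X])"
        "exact_seq ([xt \<C> HB (Suc n) X, xt \<C> HA (Suc n) X, xt \<C> HC n X], [xt_map \<C> HA HB x (Suc n) X, con n X])"
        by (rule les; assumption)+
    qed
    have nat: "con n X' (xt_pre \<C> HC n X' u K) = xt_pre \<C> HA (Suc n) X' u (con n X K)"
      if X: "X \<in> obj \<C>" "X' \<in> obj \<C>" and u: "u \<in> mor \<C> X' X" and K: "K \<in> carrier (xt \<C> HC n X)" for n X X' u K
    proof -
      have u': "arr u" "dm u = X'" "cd u = X" using u X by (simp_all add: mor_iff)
      obtain f where f: "f \<in> cocycles \<C> HC n X" "K = coh HC n X f"
        using K unfolding xt_group(2)[OF cC X(1)] by blast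
      have f': "arr f" "dm f = X" "cd f = cobj HC n" using f(1) cocycles_iff[OF cC X(1)] by auto
      have con: "con n Y (coh HC n Y g) = coh HA (Suc n) Y (tau n \<cdot>\<^bsub>\<C>\<^esub> g)"
        "tau n \<cdot>\<^bsub>\<C>\<^esub> g \<in> cocycles \<C> HA (Suc n) Y"
        if "Y \<in> obj \<C>" "g \<in> cocycles \<C> HC n Y" for Y g
        using con_induces[OF that(1), of n] that(2) cmapD(4) unfolding induces_def by blast+
      \<comment> \<open>On a representative both sides are the class of \<open>tau n\<close>
        followed on the right by \<open>f\<close> and \<open>u\<close>, differing only in the
        bracketing.\<close>
      show ?thesis
        unfolding f(2) con(1)[OF X(1) f(1)] xt_pre_coh(2)[OF cC u' f(1)]
          con(1)[OF X(2) xt_pre_coh(1)[OF cC u' f(1)]] xt_pre_coh(2)[OF cA u' con(2)[OF X(1) f(1)]]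
        using u' f' by simp
    qed
    have hom: "con n X \<in> hom (xt \<C> HC n X) (xt \<C> HA (Suc n) X)" if "X \<in> obj \<C>" for n X
      by (rule induces_hom[OF cC cA that con_induces[OF that]])
    show ?thesis
      by (intro exI[of _ con] conjI allI ballI) (use hom nat les in blast)+
  qed
  ultimately show ?thesis by blast
qed

end
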